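(* Let $0<\alpha<1/2$ and $p\in(0,1)$ be constants. There exist a constant $K>0$, a positive integer $N_0$ (depending on $p,\alpha$), and a function $\delta:\mathbb N\to[0,\infty)$ with $\delta(n)/n\to 0$, such that for every $n\ge N_0$, \[1-f_\alpha(n)\ \ge\ \left(1-e^{-K n^{1/2-\alpha}}\right)\left(1-\max_{n'\in[n/4-\delta(n),\,n/4+\delta(n)]} f_\alpha(n')^2\right),\] where the maximum is over integers $n'$ in that interval.
   Context: A graph $G$ on $n$ vertices is even-degenerate if there is an ordering $v_1,\dots,v_n$ of its vertices such that for every $1\le i\le n-2$, $v_i$ has an even number of neighbours in $\{v_{i+1},\dots,v_n\}$. For $0<\alpha<1/2$ and $p\in(0,1)$, a random graph $G=(V,E)$ with $|V|=n$ is an $\alpha$-partially revealed $p$-graph if there is a set $A\subseteq V$ with $|A|\le n^{1-2\alpha}$ (the revealed part) such that $G$ is distributed as $G(n,p)$ on $V$ (each pair an edge independently with probability $p$) conditioned on a fixed (feasible) value of: the induced subgraph $G[A]$, the parities of $\deg_G(a)$ for all $a\in A$, and the parity of $|E|$. $f_\alpha(n)$ denotes the maximum, over all $\alpha$-partially revealed $p$-graphs $G$ on $n$ vertices (over all choices of $A$ and of the conditioned values), of the probability that $G$ is not even-degenerate. (The paper writes the factors as $1-e^{-\Theta(n^{1/2-\alpha})}$ and the interval as $[n/4-o(n),n/4+o(n)]$.) *)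

theory Defs
  imports "HOL-Probability.Probability" "HOL-Library.Ramsey"
begin

text \<open>A simple graph on the vertex set \<open>V\<close> is given by its edge set, a subset of
  \<open>nsets V 2\<close>, the set of two-element subsets of \<open>V\<close>.\<close>

definition neighbours :: "'a set set \<Rightarrow> 'a \<Rightarrow> 'a set" where
  "neighbours E v = {u. {v, u} \<in> E}"

definition degree :: "'a set set \<Rightarrow> 'a \<Rightarrow> nat" where
  "degree E v = card (neighbours E v)"

definition induced_edges :: "'a set set \<Rightarrow> 'a set \<Rightarrow> 'a set set" where
  "induced_edges E A = {e \<in> E. e \<subseteq> A}"

text \<open>The list \<open>vs\<close> is the ordering, indexed from 0, so the constrained positions
  are \<open>0, \<dots>, n - 3\<close>.\<close>

definition even_degenerate :: "'a set \<Rightarrow> 'a set set \<Rightarrow> bool" where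
  "even_degenerate V E \<longleftrightarrow>
     (\<exists>vs. distinct vs \<and> set vs = V \<and>
       (\<forall>i. i + 2 < length vs \<longrightarrow>
          even (card (neighbours E (vs ! i) \<inter> set (drop (Suc i) vs)))))"

definition random_graph :: "'a set \<Rightarrow> real \<Rightarrow> 'a set set pmf" where
  "random_graph V p =
     map_pmf (\<lambda>b. {e \<in> nsets V 2. b e})
       (Pi_pmf (nsets V 2) False (\<lambda>_. bernoulli_pmf p))"

text \<open>The data revealed about a graph: its induced subgraph on \<open>A\<close>, the degree parities on \<open>A\<close>
  (encoded as the set of vertices of \<open>A\<close> having odd degree in the whole graph), and the parity
  of the number of edges.\<close>

definition revealed :: "'a set \<Rightarrow> 'a set set \<Rightarrow> 'a set set \<times> 'a set \<times> bool" where
  "revealed A E = (induced_edges E A, {a \<in> A. odd (degree E a)}, odd (card E))"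

text \<open>\<open>M\<close> is the distribution of a partially revealed graph. The condition that
  \<open>set_pmf (random_graph V p)\<close> meets the event says that the revealed value \<open>r\<close> is feasible.\<close>

definition partially_revealed :: "real \<Rightarrow> real \<Rightarrow> 'a set \<Rightarrow> 'a set set pmf \<Rightarrow> bool" where
  "partially_revealed \<alpha> p V M \<longleftrightarrow>
     (\<exists>A r. A \<subseteq> V \<and> real (card A) \<le> real (card V) powr (1 - 2 * \<alpha>) \<and>
        set_pmf (random_graph V p) \<inter> {E. revealed A E = r} \<noteq> {} \<and>
        M = cond_pmf (random_graph V p) {E. revealed A E = r})"

text \<open>As everything is invariant under renaming vertices, the vertex set is taken to be
  \<open>{..<n}\<close>.\<close>

definition max_failure_prob :: "real \<Rightarrow> real \<Rightarrow> nat \<Rightarrow> real" where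
  "max_failure_prob \<alpha> p n =
     Max {measure_pmf.prob M {E. \<not> even_degenerate {..<n} E} | M.
            partially_revealed \<alpha> p {..<n} M}"

text \<open>The maximum is over a finite, nonempty set.\<close>

lemma max_failure_prob_wf:
  fixes n :: nat
  shows "finite {measure_pmf.prob M {E. \<not> even_degenerate {..<n} E} | M.
            partially_revealed \<alpha> p {..<n} M}" (is "finite ?S")
    and "{measure_pmf.prob M {E. \<not> even_degenerate {..<n} E} | M.
            partially_revealed \<alpha> p {..<n} M} \<noteq> {}"
proof -
  let ?G = "random_graph {..<n} p"
  have fin: "finite (set_pmf ?G)"
    by (rule finite_subset[of _ "Pow (nsets {..<n} 2)"])
       (auto simp: random_graph_def finite_imp_finite_nsets)
  have "?S \<subseteq> (\<lambda>(A, E). measure_pmf.prob (cond_pmf ?G {E'. revealed A E' = revealed A E})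
                 {E. \<not> even_degenerate {..<n} E}) ` (Pow {..<n} \<times> set_pmf ?G)" (is "_ \<subseteq> ?T")
  proof
    fix x assume "x \<in> ?S"
    then obtain A r where A: "A \<subseteq> {..<n}"
      and ne: "set_pmf ?G \<inter> {E. revealed A E = r} \<noteq> {}"
      and x: "x = measure_pmf.prob (cond_pmf ?G {E. revealed A E = r}) {E. \<not> even_degenerate {..<n} E}"
      unfolding partially_revealed_def by blast
    from ne obtain E where "E \<in> set_pmf ?G" "revealed A E = r" by blast
    with A x show "x \<in> ?T" by (intro image_eqI[of _ _ "(A, E)"]) auto
  qed
  then show "finite ?S"
    by (rule finite_subset) (use fin in auto)
  obtain E where "E \<in> set_pmf ?G"
    using set_pmf_not_empty[of ?G] by blast
  then have "partially_revealed \<alpha> p {..<n} (cond_pmf ?G {E'. revealed {} E' = revealed {} E})"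
    unfolding partially_revealed_def by (intro exI[of _ "{}"] exI[of _ "revealed {} E"]) auto
  then show "?S \<noteq> {}" by blast
qed

end

theory Submission
  imports Defs "HOL-Real_Asymp.Real_Asymp"
begin

text \<open>The recursive factor is not needed, because the failure probability itself is at most
  \<open>exp (- K * n powr (1 / 2 - \<alpha>))\<close> for large \<open>n\<close>; taking \<open>\<delta> = 1\<close> merely keeps the interval
  nonempty.

  Keep two unrevealed vertices \<open>u\<close>, \<open>v\<close> for the end and go through the others in some order. A
  vertex of even degree into what remains is removed. One of odd degree is put on a stack, which is
  emptied at the end in reverse order; this is legitimate if the vertex has an odd number of
  neighbours among the vertices not yet processed. So an order in which every vertex has odd degree
  into the unprocessed vertices succeeds whatever the edges at \<open>u\<close> and \<open>v\<close> are. Building such an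
  order greedily from the front and from the back, and revealing edges only when they are needed,
  leaves over at most \<open>2 * t\<close> vertices at all but a small proportion of the cuts between the two
  parts. The leftovers can be removed if the edges from \<open>u\<close> to them follow a certain pattern; this
  has probability at least \<open>q ^ (2 * t)\<close>, where \<open>q = min p (1 - p)\<close>, independently for different
  cuts. Disjoint windows provide about \<open>sqrt n\<close> cuts, so the probability that all of them fail is
  exponentially small in \<open>sqrt n\<close>. The vertex processed last costs nothing if the parity of the
  number of edges agrees with \<open>u\<close> and \<open>v\<close> being adjacent, which is achieved by choosing \<open>v\<close>.\<close>

section \<open>Expectations over random subsets\<close>

text \<open>The obstacle is dependence: the parity of a vertex decides when it is processed, which
  biases the edges already seen. The remedy is renewal. Processing a vertex adds its still unseen
  edges to all remaining parities, and whatever was learnt about the old parities, the new ones are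
  again independent, each odd with probability \<open>p\<close> or \<open>1 - p\<close>. This is why
  the estimates concern product measures with varying probabilities in \<open>[q, 1 - q]\<close>. A
  constant success probability per cut has to become a bound exponential in the number of cuts. Two
  thresholds for the leftovers achieve this. With at most \<open>\<tau>\<close> of them, linear in
  \<open>m\<close>, the process can go on; this fails with probability exponentially small in
  \<open>m\<close>. With at most the constant \<open>t\<close>, the cut is usable; given the past,
  this fails with a small constant probability. Recovering from \<open>\<tau>\<close> leftovers with
  such a small error takes a window of length linear in \<open>m\<close>, and \<open>8 * m\<close>
  such windows fit into \<open>n\<close> vertices if \<open>m\<close> is a small multiple of
  \<open>sqrt n\<close>.\<close>

definition bexp :: "'i set \<Rightarrow> ('i \<Rightarrow> real) \<Rightarrow> ('i set \<Rightarrow> real) \<Rightarrow> real" where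
  "bexp I pr f = (\<Sum>H\<in>Pow I. (\<Prod>i\<in>I. if i \<in> H then pr i else 1 - pr i) * f H)"

abbreviation pexp :: "real \<Rightarrow> 'i set \<Rightarrow> ('i set \<Rightarrow> real) \<Rightarrow> real" where
  "pexp p I \<equiv> bexp I (\<lambda>_. p)"

text \<open>The condition is symmetric in \<open>pr\<close> and \<open>1 - pr\<close>, so it
  survives the flips of parities caused by processing a vertex.\<close>

definition spread :: "real \<Rightarrow> 'i set \<Rightarrow> ('i \<Rightarrow> real) \<Rightarrow> bool" where
  "spread q I pr \<longleftrightarrow> (\<forall>i\<in>I. q \<le> pr i \<and> pr i \<le> 1 - q)"

lemma spread_subset: "spread q I pr \<Longrightarrow> J \<subseteq> I \<Longrightarrow> spread q J pr"
  by (auto simp: spread_def)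

lemma spread_flip: "spread q I pr \<Longrightarrow> spread q I (\<lambda>i. if i \<in> \<sigma> then 1 - pr i else pr i)"
  by (force simp: spread_def)

lemma spread_le: "spread q I pr \<Longrightarrow> q' \<le> q \<Longrightarrow> spread q' I pr"
  by (force simp: spread_def)

lemma bexp_empty [simp]: "bexp {} pr f = f {}"
  by (simp add: bexp_def)

lemma bexp_insert:
  assumes "finite I" "i \<notin> I"
  shows "bexp (insert i I) pr f = pr i * bexp I pr (\<lambda>H. f (insert i H)) + (1 - pr i) * bexp I pr f"
proof -
  let ?w = "\<lambda>H j. if j \<in> H then pr j else 1 - pr j"
  have "bexp (insert i I) pr f =
      (\<Sum>H\<in>Pow I. prod (?w H) (insert i I) * f H)
      + (\<Sum>H\<in>insert i ` Pow I. prod (?w H) (insert i I) * f H)"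
    unfolding bexp_def Pow_insert using assms by (intro sum.union_disjoint) auto
  also have "(\<Sum>H\<in>insert i ` Pow I. prod (?w H) (insert i I) * f H) =
      (\<Sum>H\<in>Pow I. prod (?w (insert i H)) (insert i I) * f (insert i H))"
    using assms by (subst sum.reindex) (auto simp: inj_on_def)
  also have "\<dots> = (\<Sum>H\<in>Pow I. pr i * (prod (?w H) I * f (insert i H)))"
  proof (rule sum.cong[OF refl])
    fix H assume "H \<in> Pow I"
    have "prod (?w (insert i H)) I = prod (?w H) I"
      using assms by (intro prod.cong) auto
    then show "prod (?w (insert i H)) (insert i I) * f (insert i H) = pr i * (prod (?w H) I * f (insert i H))"
      using assms by simp
  qed
  also have "(\<Sum>H\<in>Pow I. prod (?w H) (insert i I) * f H) = (\<Sum>H\<in>Pow I. (1 - pr i) * (prod (?w H) I * f H))"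
    using assms by (intro sum.cong) auto
  finally show ?thesis
    by (simp add: bexp_def sum_distrib_left)
qed

lemma bexp_cong:
  assumes "\<And>H. H \<subseteq> I \<Longrightarrow> f H = g H" "\<And>i. i \<in> I \<Longrightarrow> pr i = \<phi> i"
  shows "bexp I pr f = bexp I \<phi> g"
  unfolding bexp_def using assms by (intro sum.cong arg_cong2[of _ _ _ _ "(*)"] prod.cong) auto

lemma bexp_mono:
  assumes "spread 0 I pr" "\<And>H. H \<subseteq> I \<Longrightarrow> f H \<le> g H"
  shows "bexp I pr f \<le> bexp I pr g"
  unfolding bexp_def using assms
  by (intro sum_mono mult_left_mono prod_nonneg) (auto simp: spread_def)

lemma bexp_add: "bexp I pr (\<lambda>H. f H + g H) = bexp I pr f + bexp I pr g"
  by (simp add: bexp_def sum.distrib distrib_left)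

lemma bexp_cmult: "bexp I pr (\<lambda>H. c * f H) = c * bexp I pr f"
  by (simp add: bexp_def sum_distrib_left mult.left_commute)

lemma bexp_sum: "bexp I pr (\<lambda>H. \<Sum>k\<in>A. f k H) = (\<Sum>k\<in>A. bexp I pr (f k))"
  unfolding bexp_def by (subst sum.swap) (simp add: sum_distrib_left)

lemma bexp_const [simp]: "finite I \<Longrightarrow> bexp I pr (\<lambda>_. c) = c"
  by (induction I rule: finite_induct) (auto simp: bexp_insert algebra_simps)

lemma bexp_le:
  assumes "finite I" "spread 0 I pr" "\<And>H. H \<subseteq> I \<Longrightarrow> f H \<le> c"
  shows "bexp I pr f \<le> c"
  using bexp_mono[OF assms(2), of f "\<lambda>_. c"] assms by simp

lemma bexp_nonneg:
  assumes "spread 0 I pr" "\<And>H. H \<subseteq> I \<Longrightarrow> 0 \<le> f H"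
  shows "0 \<le> bexp I pr f"
  using bexp_mono[OF assms(1), of "\<lambda>_. 0" f] assms by (simp add: bexp_def)

lemma bexp_swap:
  "bexp I pr (\<lambda>H. bexp J \<phi> (f H)) = bexp J \<phi> (\<lambda>\<eta>. bexp I pr (\<lambda>H. f H \<eta>))"
  unfolding bexp_def sum_distrib_left by (subst sum.swap) (simp add: mult_ac)

lemma bexp_union:
  assumes "finite I" "finite J" "I \<inter> J = {}"
  shows "bexp (I \<union> J) pr f = bexp I pr (\<lambda>H. bexp J pr (\<lambda>\<eta>. f (H \<union> \<eta>)))"
  using assms
proof (induction I arbitrary: f rule: finite_induct)
  case (insert i I)
  have "bexp (insert i I \<union> J) pr f = pr i * bexp (I \<union> J) pr (\<lambda>H. f (insert i H)) + (1 - pr i) * bexp (I \<union> J) pr f"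
    using insert by (simp add: bexp_insert)
  then show ?case using insert by (simp add: bexp_insert)
qed simp

lemma bexp_image:
  assumes "finite I" "inj_on h I"
  shows "bexp (h ` I) pr f = bexp I (\<lambda>i. pr (h i)) (\<lambda>H. f (h ` H))"
  using assms
proof (induction I arbitrary: f rule: finite_induct)
  case (insert i I)
  then have "h i \<notin> h ` I" by auto
  then show ?case using insert by (simp add: bexp_insert)
qed simp

text \<open>Toggling a fixed set of coordinates turns a product measure into another one. In this
  way known edges are added to random parities.\<close>

lemma bexp_flip:
  assumes "\<sigma> \<subseteq> I"
  shows "bexp I pr (\<lambda>H. f (sym_diff H \<sigma>)) = bexp I (\<lambda>i. if i \<in> \<sigma> then 1 - pr i else pr i) f"
proof -
  let ?h = "\<lambda>H. sym_diff H \<sigma>"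
  have "bij_betw ?h (Pow I) (Pow I)"
    by (rule bij_betw_byWitness[of _ ?h]) (use assms in blast)+
  then have "bexp I (\<lambda>i. if i \<in> \<sigma> then 1 - pr i else pr i) f =
      (\<Sum>H\<in>Pow I. (\<Prod>i\<in>I. if i \<in> ?h H then (if i \<in> \<sigma> then 1 - pr i else pr i)
                          else 1 - (if i \<in> \<sigma> then 1 - pr i else pr i)) * f (?h H))"
    unfolding bexp_def by (rule sum.reindex_bij_betw[symmetric])
  also have "\<dots> = bexp I pr (\<lambda>H. f (?h H))"
    unfolding bexp_def by (intro sum.cong arg_cong2[of _ _ _ _ "(*)"] prod.cong) auto
  finally show ?thesis by simp
qed

text \<open>This is the only way in which a greedy choice gets stuck: none of the candidates in
  \<open>N\<close> has odd parity at the moment.\<close>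

lemma bexp_disjoint_le:
  assumes "finite I" "spread q I pr" "0 \<le> q" "N \<subseteq> I"
  shows "bexp I pr (\<lambda>H. of_bool (H \<inter> N = {})) \<le> (1 - q) ^ card N"
  using assms
proof (induction I arbitrary: N rule: finite_induct)
  case (insert i I)
  have q: "q \<le> pr i" "pr i \<le> 1 - q" and sp: "spread q I pr"
    using insert.prems by (auto simp: spread_def)
  show ?case
  proof (cases "i \<in> N")
    case True
    have fN: "finite N" using insert.prems(3) insert.hyps(1) finite_subset by blast
    have c: "card N = Suc (card (N - {i}))" using True fN by (metis card.remove)
    have "bexp I pr (\<lambda>H. of_bool (H \<inter> N = {})) = bexp I pr (\<lambda>H. of_bool (H \<inter> (N - {i}) = {}))"
      using insert.hyps by (intro bexp_cong arg_cong[of _ _ of_bool]) auto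
    also have "\<dots> \<le> (1 - q) ^ card (N - {i})"
      using insert.prems sp by (intro insert.IH) auto
    finally have "(1 - pr i) * bexp I pr (\<lambda>H. of_bool (H \<inter> N = {})) \<le> (1 - q) * (1 - q) ^ card (N - {i})"
      using q insert.prems(2) by (intro mult_mono bexp_nonneg) (auto intro: spread_le[OF sp])
    then show ?thesis using True insert.hyps(1)
      unfolding bexp_insert[OF insert.hyps] c by (simp add: Int_insert_left)
  next
    case False
    then have "N \<subseteq> I" using insert.prems(3) by blast
    then have "bexp I pr (\<lambda>H. of_bool (H \<inter> N = {})) \<le> (1 - q) ^ card N"
      using sp insert.prems(2) by (intro insert.IH)
    moreover have "bexp (insert i I) pr (\<lambda>H. of_bool (H \<inter> N = {})) = bexp I pr (\<lambda>H. of_bool (H \<inter> N = {}))"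
      unfolding bexp_insert[OF insert.hyps] using False by (simp add: Int_insert_left left_diff_distrib)
    ultimately show ?thesis by simp
  qed
qed simp

lemma bexp_split_le:
  assumes "finite I" "spread 0 I pr" "J \<subseteq> I"
    and "\<And>\<eta>. \<eta> \<subseteq> I - J \<Longrightarrow> bexp J pr (\<lambda>H. f (H \<union> \<eta>)) \<le> c"
  shows "bexp I pr f \<le> c"
proof -
  have "bexp I pr f = bexp ((I - J) \<union> J) pr f" using assms(3) by (simp add: Un_absorb2)
  also have "\<dots> = bexp (I - J) pr (\<lambda>\<eta>. bexp J pr (\<lambda>H. f (\<eta> \<union> H)))"
    using assms finite_subset by (intro bexp_union) auto
  also have "\<dots> \<le> c"
  proof (rule bexp_le)
    show "bexp J pr (\<lambda>H. f (\<eta> \<union> H)) \<le> c" if "\<eta> \<subseteq> I - J" for \<eta>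
      using assms(4)[OF that] by (simp add: Un_commute)
  qed (use assms in \<open>auto simp: spread_def\<close>)
  finally show ?thesis .
qed

text \<open>The generating function of a binomial variable at \<open>1 / 2\<close>: each element
  contributes the factor \<open>p / 2 + (1 - p)\<close>.\<close>

lemma bexp_card_power:
  assumes "finite I"
  shows "pexp p I (\<lambda>H. (1 / 2) ^ card H) = (1 - p / 2) ^ card I"
  using assms
proof (induction I rule: finite_induct)
  case (insert i I)
  have "pexp p I (\<lambda>H. (1 / 2) ^ card (insert i H)) = pexp p I (\<lambda>H. (1 / 2) * (1 / 2) ^ card H)"
  proof (intro bexp_cong)
    fix H assume "H \<subseteq> I"
    then have "finite H" "i \<notin> H" using insert.hyps finite_subset by auto
    then show "(1 / 2 :: real) ^ card (insert i H) = 1 / 2 * (1 / 2) ^ card H" by simp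
  qed simp
  then have "pexp p (insert i I) (\<lambda>H. (1 / 2) ^ card H)
      = p * ((1 / 2) * (1 - p / 2) ^ card I) + (1 - p) * (1 - p / 2) ^ card I"
    unfolding bexp_insert[OF insert.hyps] bexp_cmult insert.IH by simp
  then show ?case using insert.hyps by (simp add: field_simps)
qed simp

text \<open>Exponential Markov inequality: \<open>2 ^ M * (1 / 2) ^ card H\<close> is at least 1 on
  the event.\<close>

lemma bexp_card_less:
  assumes "finite I" "0 \<le> p" "p \<le> 1"
  shows "pexp p I (\<lambda>H. of_bool (card H < M)) \<le> 2 ^ M * (1 - p / 2) ^ card I"
proof -
  have "pexp p I (\<lambda>H. of_bool (card H < M)) \<le> pexp p I (\<lambda>H. 2 ^ M * (1 / 2) ^ card H)"
  proof (rule bexp_mono)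
    fix H :: "'a set"
    have "(1/2::real) ^ M \<le> (1/2) ^ card H" if "card H < M"
      using that by (intro power_decreasing) auto
    then show "of_bool (card H < M) \<le> (2::real) ^ M * (1 / 2) ^ card H"
      by (auto simp: power_one_over field_simps)
  qed (use assms in \<open>auto simp: spread_def\<close>)
  then show ?thesis using assms by (simp add: bexp_cmult bexp_card_power)
qed

section \<open>Absorbing vertices one at a time\<close>

definition bip :: "'a set \<Rightarrow> 'a set \<Rightarrow> 'a set set" where
  "bip X Y = (\<Union>x\<in>X. \<Union>y\<in>Y. {{x, y}})"

text \<open>These pairs are still random when \<open>Y\<close> is fresh and \<open>X\<close>
  consists of the leftovers so far; pairs inside \<open>X\<close> count as known.\<close>

definition pairs_into :: "'a set \<Rightarrow> 'a set \<Rightarrow> 'a set set" where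
  "pairs_into X Y = bip X Y \<union> nsets Y 2"

definition oddnb :: "'a set set \<Rightarrow> 'a \<Rightarrow> 'a set \<Rightarrow> bool" where
  "oddnb E x S \<longleftrightarrow> odd (card {y \<in> S. {x, y} \<in> E})"

lemma finite_bip [simp]: "finite X \<Longrightarrow> finite Y \<Longrightarrow> finite (bip X Y)"
  by (simp add: bip_def)

lemma finite_nsets [simp]: "finite X \<Longrightarrow> finite (nsets X k)"
  by (rule finite_imp_finite_nsets)

lemma finite_pairs_into [simp]: "finite X \<Longrightarrow> finite Y \<Longrightarrow> finite (pairs_into X Y)"
  by (simp add: pairs_into_def)

lemma doubleton_in_bip [simp]: "{x, y} \<in> bip X Y \<longleftrightarrow> x \<in> X \<and> y \<in> Y \<or> y \<in> X \<and> x \<in> Y"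
  by (auto simp: bip_def doubleton_eq_iff)

lemma doubleton_in_pairs_into [simp]:
  "{x, y} \<in> pairs_into X Y \<longleftrightarrow> x \<in> X \<and> y \<in> Y \<or> y \<in> X \<and> x \<in> Y \<or> x \<in> Y \<and> y \<in> Y \<and> x \<noteq> y"
  by (auto simp: pairs_into_def)

lemma bip_empty [simp]: "bip {} Y = {}" "bip X {} = {}"
  by (simp_all add: bip_def)

lemma pairs_into_empty [simp]: "pairs_into {} Y = nsets Y 2"
  by (simp add: pairs_into_def)

lemma bip_singleton: "bip {x} Y = (\<lambda>y. {x, y}) ` Y"
  by (auto simp: bip_def)

lemma inj_on_doubleton: "x \<notin> Y \<Longrightarrow> inj_on (\<lambda>y. {x, y}) Y"
  by (auto simp: inj_on_def doubleton_eq_iff)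

lemma bip_Un_left: "bip (X \<union> X') Y = bip X Y \<union> bip X' Y"
  by (auto simp: bip_def)

lemma bip_Un_right: "bip X (Y \<union> Y') = bip X Y \<union> bip X Y'"
  by (auto simp: bip_def)

lemma bip_commute: "bip X Y = bip Y X"
  by (auto simp: bip_def insert_commute)

lemma nsets_Un:
  assumes "X \<inter> Y = {}"
  shows "nsets (X \<union> Y) 2 = nsets X 2 \<union> bip X Y \<union> nsets Y 2"
  using assms unfolding nsets_2_eq bip_def by (auto simp: insert_commute) blast+

lemma bip_Int_nsets: "X \<inter> Y' = {} \<Longrightarrow> bip X Y \<inter> nsets Y' 2 = {}"
  by (auto simp: bip_def)

lemma oddnb_empty [simp]: "\<not> oddnb E x {}"
  by (simp add: oddnb_def)

lemma oddnb_insert: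
  assumes "finite S" "y \<notin> S"
  shows "oddnb E x (insert y S) \<longleftrightarrow> oddnb E x S \<noteq> ({x, y} \<in> E)"
proof -
  have "{z \<in> insert y S. {x, z} \<in> E} = (if {x, y} \<in> E then insert y {z \<in> S. {x, z} \<in> E} else {z \<in> S. {x, z} \<in> E})"
    by auto
  then show ?thesis using assms by (simp add: oddnb_def)
qed

lemma oddnb_Un:
  assumes "finite S" "finite T" "S \<inter> T = {}"
  shows "oddnb E x (S \<union> T) \<longleftrightarrow> oddnb E x S \<noteq> oddnb E x T"
  using assms
proof (induction S rule: finite_induct)
  case (insert y S)
  then have "oddnb E x (insert y (S \<union> T)) \<longleftrightarrow> oddnb E x (S \<union> T) \<noteq> ({x, y} \<in> E)"
    by (intro oddnb_insert) auto
  then show ?case using insert by (auto simp: oddnb_insert)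
qed simp

lemma oddnb_cong:
  assumes "\<And>y. y \<in> S \<Longrightarrow> {x, y} \<in> E \<longleftrightarrow> {x, y} \<in> E'"
  shows "oddnb E x S \<longleftrightarrow> oddnb E' x S"
proof -
  have "{y \<in> S. {x, y} \<in> E} = {y \<in> S. {x, y} \<in> E'}" using assms by auto
  then show ?thesis by (simp add: oddnb_def)
qed

text \<open>\<open>a y\<close> is the current parity of the degree of \<open>y\<close>; processing \<open>x\<close>, whose parity has to be odd,
  flips the parities of its neighbours.\<close>

fun absorb :: "'a set set \<Rightarrow> ('a \<Rightarrow> bool) \<Rightarrow> 'a list \<Rightarrow> bool" where
  "absorb E a [] \<longleftrightarrow> True"
| "absorb E a (x # xs) \<longleftrightarrow> a x \<and> absorb E (\<lambda>y. a y \<noteq> ({x, y} \<in> E)) xs"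

text \<open>Only the existence of an order is asked for, not the success of a particular strategy.
  So the events below depend on the graph and the parities alone, and every proof may choose its own
  strategy.\<close>

definition absorbable :: "'a set set \<Rightarrow> ('a \<Rightarrow> bool) \<Rightarrow> 'a set \<Rightarrow> bool" where
  "absorbable E a S \<longleftrightarrow> (\<exists>xs. distinct xs \<and> set xs = S \<and> absorb E a xs)"

lemma absorb_cong:
  assumes "distinct xs" "\<And>x. x \<in> set xs \<Longrightarrow> a x = a' x"
    and "\<And>x y. x \<in> set xs \<Longrightarrow> y \<in> set xs \<Longrightarrow> x \<noteq> y \<Longrightarrow> {x, y} \<in> E \<longleftrightarrow> {x, y} \<in> E'"
  shows "absorb E a xs \<longleftrightarrow> absorb E' a' xs"
  using assms
proof (induction xs arbitrary: a a')
  case (Cons x xs)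
  have "absorb E (\<lambda>y. a y \<noteq> ({x, y} \<in> E)) xs \<longleftrightarrow> absorb E' (\<lambda>y. a' y \<noteq> ({x, y} \<in> E')) xs"
  proof (rule Cons.IH)
    fix y assume "y \<in> set xs"
    then show "(a y \<noteq> ({x, y} \<in> E)) = (a' y \<noteq> ({x, y} \<in> E'))"
      using Cons.prems(1) Cons.prems(2)[of y] Cons.prems(3)[of x y] by auto
  qed (use Cons.prems in auto)
  then show ?case using Cons.prems(2)[of x] by simp
qed simp

lemma absorbable_cong:
  assumes "\<And>x. x \<in> S \<Longrightarrow> a x = a' x"
    and "\<And>x y. x \<in> S \<Longrightarrow> y \<in> S \<Longrightarrow> x \<noteq> y \<Longrightarrow> {x, y} \<in> E \<longleftrightarrow> {x, y} \<in> E'"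
  shows "absorbable E a S \<longleftrightarrow> absorbable E' a' S"
  unfolding absorbable_def using assms by (intro ex_cong1 conj_cong refl absorb_cong) auto

lemma absorb_append:
  assumes "distinct xs"
  shows "absorb E a (xs @ ys) \<longleftrightarrow> absorb E a xs \<and> absorb E (\<lambda>y. a y \<noteq> oddnb E y (set xs)) ys"
  using assms
proof (induction xs arbitrary: a)
  case (Cons x xs)
  have "((a y \<noteq> ({x, y} \<in> E)) \<noteq> oddnb E y (set xs)) = (a y \<noteq> oddnb E y (set (x # xs)))" for y
    using Cons.prems by (simp add: oddnb_insert insert_commute) blast
  then show ?case using Cons by simp
qed simp

lemma absorbable_empty [simp]: "absorbable E a {}"
  by (simp add: absorbable_def)

lemma absorbable_insert:
  assumes "a x" "x \<notin> S" "absorbable E (\<lambda>y. a y \<noteq> ({x, y} \<in> E)) S"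
  shows "absorbable E a (insert x S)"
proof -
  obtain xs where "distinct xs" "set xs = S" "absorb E (\<lambda>y. a y \<noteq> ({x, y} \<in> E)) xs"
    using assms(3) by (auto simp: absorbable_def)
  then show ?thesis
    unfolding absorbable_def using assms by (intro exI[of _ "x # xs"]) auto
qed

lemma absorbable_Un:
  assumes "absorbable E a S" "absorbable E (\<lambda>y. a y \<noteq> oddnb E y S) T" "S \<inter> T = {}"
  shows "absorbable E a (S \<union> T)"
proof -
  obtain xs ys where "distinct xs" "set xs = S" "absorb E a xs"
    and "distinct ys" "set ys = T" "absorb E (\<lambda>y. a y \<noteq> oddnb E y S) ys"
    using assms(1,2) by (auto simp: absorbable_def)
  then show ?thesis
    unfolding absorbable_def using assms(3) by (intro exI[of _ "xs @ ys"]) (auto simp: absorb_append)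
qed

text \<open>The renewal step. Once \<open>d\<close> is processed, the parity of another vertex is
  its old parity, given by \<open>\<beta>\<close>, plus its unseen edge to \<open>d\<close>. So the
  new parities are independent of each other and of the edges inside \<open>D - {d}\<close>,
  whatever \<open>\<beta>\<close> is. The set \<open>\<beta> - (- D \<union> {d})\<close> is the
  restriction of \<open>\<beta>\<close> to \<open>D - {d}\<close>.\<close>

lemma bexp_reveal_row:
  assumes "finite D" "d \<in> D" "0 \<le> p" "p \<le> 1"
    and "\<And>\<nu> E. \<nu> \<subseteq> D - {d} \<Longrightarrow> E \<subseteq> nsets (D - {d}) 2 \<Longrightarrow>
      f ((\<lambda>y. {d, y}) ` \<nu> \<union> E) \<le> g (sym_diff \<nu> (\<beta> - (- D \<union> {d}))) E"
  shows "pexp p (nsets D 2) f \<le>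
    bexp (D - {d}) (\<lambda>y. if y \<in> \<beta> then 1 - p else p) (\<lambda>Z. pexp p (nsets (D - {d}) 2) (g Z))"
proof -
  let ?D = "D - {d}" and ?\<beta> = "\<beta> - (- D \<union> {d})"
  have sp: "spread 0 J (\<lambda>_. p)" for J :: "'i set" using assms by (simp add: spread_def)
  have sp': "spread 0 J (\<lambda>_. p)" for J :: "'i set set" using assms by (simp add: spread_def)
  have "D = {d} \<union> ?D" using assms by auto
  then have "nsets D 2 = bip {d} ?D \<union> nsets ?D 2"
    using nsets_Un[of "{d}" ?D] by (simp add: nsets_2_eq)
  then have "pexp p (nsets D 2) f =
      pexp p (bip {d} ?D) (\<lambda>F. pexp p (nsets ?D 2) (\<lambda>E. f (F \<union> E)))"
    using assms(1) by (simp add: bexp_union bip_Int_nsets)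
  also have "\<dots> = pexp p ?D (\<lambda>\<nu>. pexp p (nsets ?D 2) (\<lambda>E. f ((\<lambda>y. {d, y}) ` \<nu> \<union> E)))"
    unfolding bip_singleton using assms(1) by (intro bexp_image inj_on_doubleton) auto
  also have "\<dots> \<le> pexp p ?D (\<lambda>\<nu>. pexp p (nsets ?D 2) (g (sym_diff \<nu> ?\<beta>)))"
    using assms(5) sp sp' by (intro bexp_mono) auto
  also have "\<dots> = bexp ?D (\<lambda>y. if y \<in> ?\<beta> then 1 - p else p) (\<lambda>Z. pexp p (nsets ?D 2) (g Z))"
    by (rule bexp_flip) auto
  also have "\<dots> = bexp ?D (\<lambda>y. if y \<in> \<beta> then 1 - p else p) (\<lambda>Z. pexp p (nsets ?D 2) (g Z))"
    by (intro bexp_cong) auto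
  finally show ?thesis .
qed

lemma spread_edge:
  assumes "q \<le> p" "p \<le> 1 - q"
  shows "spread q I (\<lambda>y. if y \<in> \<beta> then 1 - p else p)"
  using assms by (auto simp: spread_def)

text \<open>As long as some vertex of \<open>D\<close> has odd parity, one is processed and the
  parities of the others are renewed. With \<open>s\<close> vertices left this gets stuck only if
  all parities are even, which has probability at most \<open>(1 - q) ^ s\<close>; being stuck with
  at most \<open>t\<close> vertices is a success.\<close>

lemma leftover_bound:
  assumes "finite D" "spread q D pr" "0 \<le> q" "q \<le> p" "p \<le> 1 - q"
  shows "bexp D pr (\<lambda>Z. pexp p (nsets D 2) (\<lambda>E.
      of_bool (\<not> (\<exists>R'\<subseteq>D. card R' \<le> t \<and> absorbable E (\<lambda>y. y \<in> Z) (D - R')))))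
    \<le> (\<Sum>s\<in>{t<..card D}. (1 - q) ^ s)"
  using assms
proof (induction "card D" arbitrary: D pr)
  case 0
  then show ?case by simp
next
  case (Suc k)
  let ?bad = "\<lambda>D Z E. \<not> (\<exists>R'\<subseteq>D. card R' \<le> t \<and> absorbable E (\<lambda>y. y \<in> Z) (D - R'))"
  have sp: "spread 0 J (\<lambda>_. p)" for J :: "'a set set" using assms by (simp add: spread_def)
  have sp0: "spread 0 D pr" using Suc.prems spread_le by blast
  show ?case
  proof (cases "card D \<le> t")
    case True
    then have good: "\<not> ?bad D Z E" for Z E by (auto intro!: exI[of _ D])
    show ?thesis
      using sp sp0 Suc.prems(1) True by (intro bexp_le) (auto simp: good)
  next
    case False
    define B where "B = (\<Sum>s\<in>{t<..k}. (1 - q) ^ s)"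
    have B0: "0 \<le> B" unfolding B_def using assms by (intro sum_nonneg) auto
    have "{t<..card D} = insert (Suc k) {t<..k}" using False Suc.hyps(2) by auto
    then have sumeq: "(\<Sum>s\<in>{t<..card D}. (1 - q) ^ s) = (1 - q) ^ card D + B"
      using Suc.hyps(2) by (simp add: B_def)
    \<comment> \<open>The parities \<open>Z\<close> are fixed and the edges are still random, so the
      choice of \<open>d\<close> may depend on \<open>Z\<close>.\<close>
    have inner: "pexp p (nsets D 2) (\<lambda>E. of_bool (?bad D Z E)) \<le> of_bool (Z \<inter> D = {}) + B"
      if Z: "Z \<subseteq> D" for Z
    proof (cases "Z = {}")
      case True
      then show ?thesis using Suc.prems(1) sp B0 by (intro bexp_le) auto
    next
      case False
      then obtain d where d: "d \<in> Z" by blast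
      then have dD: "d \<in> D" using Z by blast
      let ?D = "D - {d}"
      have cD: "k = card ?D" using Suc.hyps(2) Suc.prems(1) dD by simp
      have "pexp p (nsets D 2) (\<lambda>E. of_bool (?bad D Z E)) \<le>
          bexp ?D (\<lambda>y. if y \<in> Z then 1 - p else p) (\<lambda>Z. pexp p (nsets ?D 2) (\<lambda>E. of_bool (?bad ?D Z E)))"
      proof (rule bexp_reveal_row)
        fix \<nu> E assume \<nu>: "\<nu> \<subseteq> ?D" and E: "E \<subseteq> nsets ?D 2"
        let ?F = "(\<lambda>y. {d, y}) ` \<nu> \<union> E" and ?Z' = "sym_diff \<nu> (Z - (- D \<union> {d}))"
        have "\<not> ?bad D Z ?F" if "\<not> ?bad ?D ?Z' E"
        proof -
          obtain R' where R': "R' \<subseteq> ?D" "card R' \<le> t" and ab: "absorbable E (\<lambda>y. y \<in> ?Z') (?D - R')"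
            using \<open>\<not> ?bad ?D ?Z' E\<close> by blast
          have "absorbable ?F (\<lambda>y. (y \<in> Z) \<noteq> ({d, y} \<in> ?F)) (?D - R') \<longleftrightarrow> absorbable E (\<lambda>y. y \<in> ?Z') (?D - R')"
          proof (rule absorbable_cong)
            fix x assume "x \<in> ?D - R'"
            moreover have "{d, x} \<notin> E" using E by auto
            ultimately show "((x \<in> Z) \<noteq> ({d, x} \<in> ?F)) = (x \<in> ?Z')"
              by (auto simp: doubleton_eq_iff)
          qed (auto simp: doubleton_eq_iff)
          with ab have "absorbable ?F (\<lambda>y. y \<in> Z) (insert d (?D - R'))"
            using d by (intro absorbable_insert) auto
          moreover have "insert d (?D - R') = D - R'" using dD R' by auto
          ultimately show ?thesis using R' by (auto intro!: exI[of _ R'])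
        qed
        then show "of_bool (?bad D Z ?F) \<le> (of_bool (?bad ?D ?Z' E) :: real)" by auto
      qed (use Suc.prems dD in auto)
      also have "\<dots> \<le> B"
        unfolding B_def cD using Suc.prems by (intro Suc.hyps(1)[OF cD] spread_edge) auto
      finally show ?thesis by simp
    qed
    have "bexp D pr (\<lambda>Z. pexp p (nsets D 2) (\<lambda>E. of_bool (?bad D Z E)))
        \<le> bexp D pr (\<lambda>Z. of_bool (Z \<inter> D = {}) + B)"
      using sp0 inner by (intro bexp_mono) auto
    also have "\<dots> \<le> (1 - q) ^ card D + B"
      unfolding bexp_add using Suc.prems bexp_disjoint_le[of D q pr D] by simp
    finally show ?thesis using sumeq by simp
  qed
qed

lemma of_bool_mono: "(P \<Longrightarrow> Q) \<Longrightarrow> (of_bool P :: real) \<le> of_bool Q"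
  by auto

text \<open>A vertex \<open>r\<close> of \<open>R\<close> with odd parity is processed at once.
  Otherwise a neighbour \<open>d\<close> of \<open>r\<close> in \<open>D\<close> with odd parity
  goes first, which makes the parity of \<open>r\<close> odd; that there is none has probability at
  most \<open>(1 - q) ^ M\<close>. Using up \<open>d\<close> costs every other vertex of
  \<open>R\<close> at most one neighbour in \<open>D\<close>, whence the exponents
  \<open>M - i\<close>. What remains of \<open>D\<close> is left to
  \<open>leftover_bound\<close>.\<close>

lemma absorb_fixed_bound:
  assumes "finite R" "finite D" "R \<inter> D = {}" "spread q D pr" "0 \<le> q" "q \<le> p" "p \<le> 1 - q"
    and "E0 \<inter> nsets D 2 = {}" "\<And>r. r \<in> R \<Longrightarrow> M \<le> card {d \<in> D. {r, d} \<in> E0}"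
  shows "bexp D pr (\<lambda>Z. pexp p (nsets D 2) (\<lambda>E.
      of_bool (\<not> (\<exists>R'\<subseteq>D. card R' \<le> t \<and>
        absorbable (E0 \<union> E) (\<lambda>y. if y \<in> D then y \<in> Z else a y) (R \<union> D - R')))))
    \<le> (\<Sum>i<card R. (1 - q) ^ (M - i)) + (\<Sum>s\<in>{t<..card D}. (1 - q) ^ s)"
  using assms
proof (induction R arbitrary: D pr M a rule: finite_induct)
  case empty
  have "bexp D pr (\<lambda>Z. pexp p (nsets D 2) (\<lambda>E.
      of_bool (\<not> (\<exists>R'\<subseteq>D. card R' \<le> t \<and>
        absorbable (E0 \<union> E) (\<lambda>y. if y \<in> D then y \<in> Z else a y) ({} \<union> D - R'))))) =
    bexp D pr (\<lambda>Z. pexp p (nsets D 2) (\<lambda>E.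
      of_bool (\<not> (\<exists>R'\<subseteq>D. card R' \<le> t \<and> absorbable E (\<lambda>y. y \<in> Z) (D - R')))))"
  proof (intro bexp_cong refl arg_cong[of _ _ of_bool] arg_cong[of _ _ Not] ex_cong1 conj_cong)
    fix Z E R'
    show "absorbable (E0 \<union> E) (\<lambda>y. if y \<in> D then y \<in> Z else a y) ({} \<union> D - R') \<longleftrightarrow>
        absorbable E (\<lambda>y. y \<in> Z) (D - R')"
    proof -
      have "{x, y} \<notin> E0" if "x \<in> D" "y \<in> D" "x \<noteq> y" for x y
        using that empty.prems(7) doubleton_in_nsets_2[of x y D] by blast
      then show ?thesis by (auto intro!: absorbable_cong)
    qed
  qed
  then show ?case using leftover_bound[of D q pr p t] empty.prems by simp
next
  case (insert r R)
  let ?bad = "\<lambda>R D a Z E. \<not> (\<exists>R'\<subseteq>D. card R' \<le> t \<and>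
        absorbable (E0 \<union> E) (\<lambda>y. if y \<in> D then y \<in> Z else a y) (R \<union> D - R'))"
  let ?T = "\<lambda>D. \<Sum>s\<in>{t<..card D}. (1 - q) ^ s"
  let ?N = "{d \<in> D. {r, d} \<in> E0}"
  have sp: "spread 0 J (\<lambda>_. p)" for J :: "'a set set" using insert.prems by (simp add: spread_def)
  have sp0: "spread 0 D pr" using insert.prems spread_le by blast
  have rD: "r \<notin> D" using insert.prems by auto
  have q1: "0 \<le> 1 - q" "1 - q \<le> 1" using insert.prems by auto
  show ?case
  proof (cases "a r")
    case True
    \<comment> \<open>The edges from \<open>r\<close> to \<open>D\<close> are known, so processing
      \<open>r\<close> toggles the random parities on a fixed set.\<close>
    let ?\<sigma> = "?N" and ?a = "\<lambda>y. a y \<noteq> ({r, y} \<in> E0)"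
    have imp: "\<not> ?bad (insert r R) D a Z E" if E: "E \<subseteq> nsets D 2" and good: "\<not> ?bad R D ?a (sym_diff Z ?\<sigma>) E" for Z E
    proof -
      from good obtain R' where R': "R' \<subseteq> D" "card R' \<le> t"
        and ab: "absorbable (E0 \<union> E) (\<lambda>y. if y \<in> D then y \<in> sym_diff Z ?\<sigma> else ?a y) (R \<union> D - R')" by blast
      have "{r, y} \<notin> E" for y using E rD by auto
      then have "absorbable (E0 \<union> E) (\<lambda>y. (if y \<in> D then y \<in> Z else a y) \<noteq> ({r, y} \<in> E0 \<union> E)) (R \<union> D - R')"
        by (intro iffD1[OF absorbable_cong ab]) auto
      then have "absorbable (E0 \<union> E) (\<lambda>y. if y \<in> D then y \<in> Z else a y) (insert r (R \<union> D - R'))"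
        using rD True insert.hyps(2) by (intro absorbable_insert) auto
      moreover have "insert r (R \<union> D - R') = insert r R \<union> D - R'" using R' rD by auto
      ultimately have "absorbable (E0 \<union> E) (\<lambda>y. if y \<in> D then y \<in> Z else a y) (insert r R \<union> D - R')"
        by (simp only:)
      then show ?thesis using R' by blast
    qed
    have "bexp D pr (\<lambda>Z. pexp p (nsets D 2) (\<lambda>E. of_bool (?bad (insert r R) D a Z E)))
      \<le> bexp D pr (\<lambda>Z. pexp p (nsets D 2) (\<lambda>E. of_bool (?bad R D ?a (sym_diff Z ?\<sigma>) E)))"
      by (intro bexp_mono sp sp0 of_bool_mono) (use imp in blast)
    also have "\<dots> = bexp D (\<lambda>i. if i \<in> ?\<sigma> then 1 - pr i else pr i)
        (\<lambda>Z. pexp p (nsets D 2) (\<lambda>E. of_bool (?bad R D ?a Z E)))"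
      by (rule bexp_flip) auto
    also have "\<dots> \<le> (\<Sum>i<card R. (1 - q) ^ (M - i)) + ?T D"
      using insert.prems by (intro insert.IH spread_flip) auto
    also have "\<dots> \<le> (\<Sum>i<card (insert r R). (1 - q) ^ (M - i)) + ?T D"
      using insert.hyps q1 by simp
    finally show ?thesis .
  next
    case False
    define B where "B = (\<Sum>i<card R. (1 - q) ^ (M - 1 - i)) + ?T D"
    have B0: "0 \<le> B" unfolding B_def using q1 by (intro add_nonneg_nonneg sum_nonneg) auto
    have inner: "pexp p (nsets D 2) (\<lambda>E. of_bool (?bad (insert r R) D a Z E)) \<le> of_bool (Z \<inter> ?N = {}) + B"
      if Z: "Z \<subseteq> D" for Z
    proof (cases "Z \<inter> ?N = {}")
      case True
      then show ?thesis using insert.prems(1) sp B0 by (intro bexp_le) auto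
    next
      case False
      then obtain d where d: "d \<in> Z" "d \<in> D" "{r, d} \<in> E0" by blast
      then have dR: "d \<notin> R" using insert.prems by auto
      \<comment> \<open>The flips caused by \<open>r\<close> are already included in
        \<open>?\<beta>\<close> although \<open>r\<close> comes after \<open>d\<close>: flips
        commute.\<close>
      let ?D = "D - {d}" and ?\<beta> = "sym_diff Z ?N"
      let ?a = "\<lambda>y. (a y \<noteq> ({d, y} \<in> E0)) \<noteq> ({r, y} \<in> E0)"
      have "pexp p (nsets D 2) (\<lambda>E. of_bool (?bad (insert r R) D a Z E)) \<le>
          bexp ?D (\<lambda>y. if y \<in> ?\<beta> then 1 - p else p)
            (\<lambda>Z. pexp p (nsets ?D 2) (\<lambda>E. of_bool (?bad R ?D ?a Z E)))"
      proof (rule bexp_reveal_row)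
        fix \<nu> E assume \<nu>: "\<nu> \<subseteq> ?D" and E: "E \<subseteq> nsets ?D 2"
        let ?F = "(\<lambda>y. {d, y}) ` \<nu> \<union> E" and ?Z' = "sym_diff \<nu> (?\<beta> - (- D \<union> {d}))"
        have "\<not> ?bad (insert r R) D a Z ?F" if "\<not> ?bad R ?D ?a ?Z' E"
        proof -
          obtain R' where R': "R' \<subseteq> ?D" "card R' \<le> t"
            and ab: "absorbable (E0 \<union> E) (\<lambda>y. if y \<in> ?D then y \<in> ?Z' else ?a y) (R \<union> ?D - R')"
            using \<open>\<not> ?bad R ?D ?a ?Z' E\<close> by blast
          let ?b = "\<lambda>y. if y \<in> D then y \<in> Z else a y"
          let ?S = "R \<union> ?D - R'"
          have dy: "{d, y} \<notin> E" "{r, y} \<notin> ?F" for y using E rD \<nu> d(2) by (auto simp: doubleton_eq_iff)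
          have dnu: "{d, y} \<in> ?F \<longleftrightarrow> y \<in> \<nu>" if "y \<noteq> d" for y
            using that dy by (auto simp: doubleton_eq_iff)
          have nE0: "{d, y} \<notin> E0" if "y \<in> D" "y \<noteq> d" for y
            using that d(2) insert.prems(7) doubleton_in_nsets_2[of d y D] by blast
          have "absorbable (E0 \<union> ?F) (\<lambda>y. (?b y \<noteq> ({d, y} \<in> E0 \<union> ?F)) \<noteq> ({r, y} \<in> E0 \<union> ?F)) ?S"
          proof (rule iffD1[OF absorbable_cong ab])
            fix y assume y: "y \<in> ?S"
            then have "y \<noteq> d" using dR by auto
            moreover have "y \<notin> D \<Longrightarrow> y \<notin> \<nu>" using \<nu> by auto
            ultimately show "(if y \<in> ?D then y \<in> ?Z' else ?a y) \<longleftrightarrow>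
                ((?b y \<noteq> ({d, y} \<in> E0 \<union> ?F)) \<noteq> ({r, y} \<in> E0 \<union> ?F))"
              using dnu[of y] nE0[of y] dy[of y] by (cases "y \<in> D") auto
          next
            fix x y assume "x \<in> ?S" "y \<in> ?S"
            then show "{x, y} \<in> E0 \<union> E \<longleftrightarrow> {x, y} \<in> E0 \<union> ?F"
              using dR by (auto simp: doubleton_eq_iff)
          qed
          moreover have "?b r \<noteq> ({d, r} \<in> E0 \<union> ?F)"
            using rD \<open>\<not> a r\<close> d(3) by (auto simp: insert_commute)
          moreover have "r \<notin> ?S" using rD insert.hyps by auto
          ultimately have "absorbable (E0 \<union> ?F) (\<lambda>y. ?b y \<noteq> ({d, y} \<in> E0 \<union> ?F)) (insert r ?S)"
            by (intro absorbable_insert)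
          then have "absorbable (E0 \<union> ?F) ?b (insert d (insert r ?S))"
            by (rule absorbable_insert[rotated 2]) (use d dR rD in auto)
          moreover have "insert d (insert r ?S) = insert r R \<union> D - R'" using R' rD d(2) by auto
          ultimately have "absorbable (E0 \<union> ?F) ?b (insert r R \<union> D - R')" by (simp only:)
          moreover have "R' \<subseteq> D" using R' by auto
          ultimately show ?thesis using R' by blast
        qed
        then show "of_bool (?bad (insert r R) D a Z ?F) \<le> (of_bool (?bad R ?D ?a ?Z' E) :: real)"
          by (intro of_bool_mono) blast
      qed (use insert.prems d in auto)
      also have "\<dots> \<le> (\<Sum>i<card R. (1 - q) ^ (M - 1 - i)) + ?T ?D"
      proof (rule insert.IH)
        show "E0 \<inter> nsets ?D 2 = {}" using insert.prems(7) nsets_mono[of ?D D 2] by auto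
      next
        fix r' assume "r' \<in> R"
        then have "M \<le> card {d \<in> D. {r', d} \<in> E0}" using insert.prems by auto
        moreover have "card {d \<in> D. {r', d} \<in> E0} - card {d} \<le> card ({d \<in> D. {r', d} \<in> E0} - {d})"
          by (rule diff_card_le_card_Diff) simp
        moreover have "{d \<in> D. {r', d} \<in> E0} - {d} = {d' \<in> ?D. {r', d'} \<in> E0}" by auto
        ultimately show "M - 1 \<le> card {d' \<in> ?D. {r', d'} \<in> E0}" by simp
      next
        show "spread q ?D (\<lambda>y. if y \<in> ?\<beta> then 1 - p else p)" using insert.prems by (intro spread_edge)
      qed (use insert.prems in auto)
      also have "\<dots> \<le> B"
        unfolding B_def using q1 insert.prems(1)
        by (intro add_left_mono sum_mono2) (auto simp: card_Diff_singleton_if)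
      finally show ?thesis
        using False by (simp only: of_bool_eq add_0_left simp_thms)
    qed
    have "bexp D pr (\<lambda>Z. pexp p (nsets D 2) (\<lambda>E. of_bool (?bad (insert r R) D a Z E)))
        \<le> bexp D pr (\<lambda>Z. of_bool (Z \<inter> ?N = {}) + B)"
      using sp0 inner by (intro bexp_mono) auto
    also have "\<dots> \<le> (1 - q) ^ card ?N + B"
      unfolding bexp_add using insert.prems bexp_disjoint_le[of D q pr ?N] by simp
    also have "\<dots> \<le> (1 - q) ^ M + B"
      using insert.prems q1 by (intro add_right_mono power_decreasing) auto
    also have "\<dots> = (\<Sum>i<card (insert r R). (1 - q) ^ (M - i)) + ?T D"
    proof -
      have "(\<Sum>i<Suc (card R). (1 - q) ^ (M - i)) = (1 - q) ^ M + (\<Sum>i<card R. (1 - q) ^ (M - 1 - i))"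
        by (subst sum.lessThan_Suc_shift) simp
      then show ?thesis using insert.hyps by (simp add: B_def)
    qed
    finally show ?thesis .
  qed
qed

text \<open>The summands are for three failures: one of at most \<open>\<tau>\<close> old vertices
  has fewer than \<open>M\<close> neighbours among \<open>L\<close> fresh ones, the absorption of
  the old vertices gets stuck, or more than \<open>s\<close> fresh vertices are left over.\<close>

definition stage_err :: "real \<Rightarrow> nat \<Rightarrow> nat \<Rightarrow> nat \<Rightarrow> nat \<Rightarrow> real" where
  "stage_err q M \<tau> L s =
     real \<tau> * (2 ^ M * (1 - q / 2) ^ L) + (\<Sum>i<\<tau>. (1 - q) ^ (M - i)) + (\<Sum>r\<in>{s<..L}. (1 - q) ^ r)"

lemma few_neighbours_bound:
  assumes "finite R" "finite D" "R \<inter> D = {}" "0 \<le> q" "q \<le> p" "p \<le> 1 - q" "r \<in> R"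
  shows "pexp p (bip R D) (\<lambda>X. of_bool (card {d \<in> D. {r, d} \<in> X} < M)) \<le> 2 ^ M * (1 - q / 2) ^ card D"
proof (rule bexp_split_le)
  show "bip {r} D \<subseteq> bip R D" using assms by (auto simp: bip_def)
  fix \<eta> assume \<eta>: "\<eta> \<subseteq> bip R D - bip {r} D"
  have rD: "r \<notin> D" using assms by auto
  have eq: "{d \<in> D. {r, d} \<in> (\<lambda>y. {r, y}) ` \<nu> \<union> \<eta>} = \<nu>" if \<nu>: "\<nu> \<subseteq> D" for \<nu>
  proof -
    have "{r, d} \<notin> \<eta>" if "d \<in> D" for d
      using \<eta> that doubleton_in_bip[of r d "{r}" D] by blast
    then show ?thesis using \<nu> rD by (auto simp: doubleton_eq_iff)
  qed
  have "pexp p (bip {r} D) (\<lambda>H. of_bool (card {d \<in> D. {r, d} \<in> H \<union> \<eta>} < M)) =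
      pexp p D (\<lambda>\<nu>. of_bool (card {d \<in> D. {r, d} \<in> (\<lambda>y. {r, y}) ` \<nu> \<union> \<eta>} < M))"
    unfolding bip_singleton using assms rD by (intro bexp_image inj_on_doubleton)
  also have "\<dots> = pexp p D (\<lambda>\<nu>. of_bool (card \<nu> < M))"
    by (intro bexp_cong refl) (simp only: eq)
  also have "\<dots> \<le> 2 ^ M * (1 - p / 2) ^ card D"
    using assms by (intro bexp_card_less) auto
  also have "\<dots> \<le> 2 ^ M * (1 - q / 2) ^ card D"
    using assms by (intro mult_left_mono power_mono) auto
  finally show "pexp p (bip {r} D) (\<lambda>H. of_bool (card {d \<in> D. {r, d} \<in> H \<union> \<eta>} < M))
      \<le> 2 ^ M * (1 - q / 2) ^ card D" .
qed (use assms in \<open>auto simp: spread_def\<close>)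

text \<open>The edges between \<open>R\<close> and \<open>D\<close> are revealed first, so that
  every vertex of \<open>R\<close> can be given \<open>M\<close> neighbours. This does no harm,
  because the randomness used afterwards is that of the parities on \<open>D\<close> and of the
  edges inside \<open>D\<close>.\<close>

lemma stage_bound:
  assumes "finite R" "finite D" "R \<inter> D = {}" "spread q D pr" "0 \<le> q" "q \<le> p" "p \<le> 1 - q"
    and "card R \<le> \<tau>" "E0 \<inter> nsets D 2 = {}"
  shows "bexp D pr (\<lambda>Z. pexp p (pairs_into R D) (\<lambda>F.
      of_bool (\<not> (\<exists>R'\<subseteq>D. card R' \<le> s \<and>
        absorbable (E0 \<union> F) (\<lambda>y. if y \<in> D then y \<in> Z else a y) (R \<union> D - R')))))
    \<le> stage_err q M \<tau> (card D) s"
proof -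
  let ?bad = "\<lambda>Z F. of_bool (\<not> (\<exists>R'\<subseteq>D. card R' \<le> s \<and>
        absorbable (E0 \<union> F) (\<lambda>y. if y \<in> D then y \<in> Z else a y) (R \<union> D - R'))) :: real"
  let ?T = "(\<Sum>i<\<tau>. (1 - q) ^ (M - i)) + (\<Sum>r\<in>{s<..card D}. (1 - q) ^ r)"
  have q1: "0 \<le> 1 - q" "1 - q \<le> 1" using assms by auto
  have T0: "0 \<le> ?T" using q1 by (intro add_nonneg_nonneg sum_nonneg) auto
  have sp: "spread 0 J (\<lambda>_. p)" for J :: "'a set set" using assms by (simp add: spread_def)
  have sp0: "spread 0 D pr" using assms spread_le by blast
  have "bexp D pr (\<lambda>Z. pexp p (pairs_into R D) (?bad Z)) =
      bexp D pr (\<lambda>Z. pexp p (bip R D) (\<lambda>X. pexp p (nsets D 2) (\<lambda>E. ?bad Z (X \<union> E))))"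
    unfolding pairs_into_def using assms by (simp add: bexp_union bip_Int_nsets)
  also have "\<dots> = pexp p (bip R D) (\<lambda>X. bexp D pr (\<lambda>Z. pexp p (nsets D 2) (\<lambda>E. ?bad Z (X \<union> E))))"
    by (rule bexp_swap)
  also have "\<dots> \<le> pexp p (bip R D) (\<lambda>X. (\<Sum>r\<in>R. of_bool (card {d \<in> D. {r, d} \<in> X} < M)) + ?T)"
  proof (rule bexp_mono[OF sp])
    fix X assume X: "X \<subseteq> bip R D"
    show "bexp D pr (\<lambda>Z. pexp p (nsets D 2) (\<lambda>E. ?bad Z (X \<union> E)))
        \<le> (\<Sum>r\<in>R. of_bool (card {d \<in> D. {r, d} \<in> X} < M)) + ?T"
    proof (cases "\<exists>r\<in>R. card {d \<in> D. {r, d} \<in> X} < M")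
      case True
      then obtain r where r: "r \<in> R" "card {d \<in> D. {r, d} \<in> X} < M" by blast
      have "bexp D pr (\<lambda>Z. pexp p (nsets D 2) (\<lambda>E. ?bad Z (X \<union> E))) \<le> 1"
        using assms sp sp0 by (intro bexp_le) auto
      also have "(1::real) \<le> (\<Sum>r\<in>R. of_bool (card {d \<in> D. {r, d} \<in> X} < M))"
        using assms(1) r member_le_sum[of r R "\<lambda>r. of_bool (card {d \<in> D. {r, d} \<in> X} < M) :: real"] by simp
      finally show ?thesis using T0 by simp
    next
      case False
      have "bexp D pr (\<lambda>Z. pexp p (nsets D 2) (\<lambda>E. ?bad Z (X \<union> E))) =
         bexp D pr (\<lambda>Z. pexp p (nsets D 2) (\<lambda>E. of_bool (\<not> (\<exists>R'\<subseteq>D. card R' \<le> s \<and>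
        absorbable ((E0 \<union> X) \<union> E) (\<lambda>y. if y \<in> D then y \<in> Z else a y) (R \<union> D - R')))))"
        by (simp only: Un_assoc)
      also have "\<dots> \<le> (\<Sum>i<card R. (1 - q) ^ (M - i)) + (\<Sum>r\<in>{s<..card D}. (1 - q) ^ r)"
      proof (rule absorb_fixed_bound)
        show "(E0 \<union> X) \<inter> nsets D 2 = {}" using assms X bip_Int_nsets[of R D D] by blast
        fix r assume "r \<in> R"
        then have "M \<le> card {d \<in> D. {r, d} \<in> X}" using False by force
        also have "\<dots> \<le> card {d \<in> D. {r, d} \<in> E0 \<union> X}"
          using assms by (intro card_mono) auto
        finally show "M \<le> card {d \<in> D. {r, d} \<in> E0 \<union> X}" .
      qed (use assms in auto)
      also have "\<dots> \<le> ?T"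
        using assms(8) q1 by (intro add_right_mono sum_mono2) auto
      finally show ?thesis
        by (rule order_trans) (simp add: sum_nonneg)
    qed
  qed
  also have "\<dots> = (\<Sum>r\<in>R. pexp p (bip R D) (\<lambda>X. of_bool (card {d \<in> D. {r, d} \<in> X} < M))) + ?T"
    using assms by (simp only: bexp_add bexp_sum bexp_const finite_bip)
  also have "\<dots> \<le> (\<Sum>r\<in>R. 2 ^ M * (1 - q / 2) ^ card D) + ?T"
    using assms by (intro add_right_mono sum_mono few_neighbours_bound) auto
  also have "\<dots> \<le> real \<tau> * (2 ^ M * (1 - q / 2) ^ card D) + ?T"
    using assms q1 by (auto intro!: mult_right_mono)
  finally show ?thesis by (simp add: stage_err_def)
qed

text \<open>The leftovers have to lie in the current window \<open>Us ! j\<close>, so all earlier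
  ones must have been absorbed. This is what makes the patterns of different cuts concern disjoint
  sets of edges.\<close>

definition stage_bad :: "nat \<Rightarrow> 'a set set \<Rightarrow> ('a \<Rightarrow> bool) \<Rightarrow> 'a set \<Rightarrow> 'a set list \<Rightarrow> nat \<Rightarrow> bool" where
  "stage_bad t E a W Us j \<longleftrightarrow>
    \<not> (\<exists>R'\<subseteq>Us ! j. card R' \<le> t \<and> absorbable E a (W \<union> \<Union>(set (take (Suc j) Us)) - R'))"

text \<open>Once \<open>W - R'\<close> is absorbed, any order for \<open>R'\<close> and the further
  windows can be appended, so the past matters only through its leftovers \<open>R'\<close>. On
  \<open>U\<close> it acts by flips, which keep the parities spread. The edges from
  \<open>W'\<close> into \<open>U\<close> are still random, whereas those from
  \<open>W - W'\<close>, such as revealed vertices, are fixed in \<open>E0\<close>.\<close>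

lemma stage_transition:
  assumes fin: "finite W" "finite U" and WU: "W \<inter> U = {}" and U: "\<Union>(set Us) = U"
    and R': "R' \<subseteq> W'" "W' \<subseteq> W" and ab: "absorbable E0 a (W - R')"
    and E0: "E0 \<inter> pairs_into R' U = {}"
    and sp: "spread q U pr" and q: "0 \<le> q" "q \<le> p" "p \<le> 1 - q" and K: "K \<subseteq> {..<length Us}"
    and nxt: "\<And>pr' E0' a'. spread q U pr' \<Longrightarrow> E0' \<inter> pairs_into R' U = {} \<Longrightarrow>
      bexp U pr' (\<lambda>Z. pexp p (pairs_into R' U) (\<lambda>F.
        of_bool (\<forall>j\<in>K. stage_bad t (E0' \<union> F) (\<lambda>y. if y \<in> U then y \<in> Z else a' y) R' Us j))) \<le> B"
  shows "bexp U pr (\<lambda>Z. pexp p (pairs_into W' U) (\<lambda>F.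
        of_bool (\<forall>j\<in>K. stage_bad t (E0 \<union> F) (\<lambda>y. if y \<in> U then y \<in> Z else a y) W Us j))) \<le> B"
proof -
  let ?aa = "\<lambda>a Z y. if y \<in> U then y \<in> Z else a y"
  let ?f = "\<lambda>E0 a W Z F. of_bool (\<forall>j\<in>K. stage_bad t (E0 \<union> F) (?aa a Z) W Us j) :: real"
  let ?S = "W - R'"
  have spe: "spread 0 J (\<lambda>_. p)" for J :: "'a set set" using q by (simp add: spread_def)
  have sp0: "spread 0 U pr" using q sp spread_le by blast
  have fin2: "finite W'" "finite R'" using fin R' by (auto intro: finite_subset)
  have split: "pairs_into W' U = bip (W' - R') U \<union> pairs_into R' U"
  proof -
    have "W' = (W' - R') \<union> R'" using R' by auto
    then have "bip W' U = bip (W' - R') U \<union> bip R' U" by (metis bip_Un_left)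
    then show ?thesis by (auto simp: pairs_into_def)
  qed
  have disj: "bip (W' - R') U \<inter> pairs_into R' U = {}"
    using WU R' by (auto simp: pairs_into_def bip_def doubleton_eq_iff)
  have fixed: "bexp U pr (\<lambda>Z. pexp p (pairs_into R' U) (\<lambda>F. ?f E0 a W Z (X \<union> F))) \<le> B"
    if X: "X \<subseteq> bip (W' - R') U" for X
  proof -
    let ?E = "E0 \<union> X"
    \<comment> \<open>The joint effect of all vertices of \<open>?S\<close>: on \<open>U\<close>
      random parities are toggled, and on the leftovers \<open>R'\<close> the fixed values
      change.\<close>
    define \<sigma> where "\<sigma> = {y \<in> U. oddnb ?E y ?S}"
    define a' where "a' = (\<lambda>y. a y \<noteq> oddnb ?E y ?S)"
    have imp: "stage_bad t (?E \<union> F) (?aa a' (sym_diff Z \<sigma>)) R' Us j"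
      if bad: "stage_bad t (E0 \<union> (X \<union> F)) (?aa a Z) W Us j" and F: "F \<subseteq> pairs_into R' U" and j: "j < length Us"
      for Z F j
    proof (rule ccontr)
      let ?G = "?E \<union> F" and ?T = "\<Union>(set (take (Suc j) Us))"
      assume "\<not> ?thesis"
      then obtain R'' where R'': "R'' \<subseteq> Us ! j" "card R'' \<le> t"
        and ab'': "absorbable ?G (?aa a' (sym_diff Z \<sigma>)) (R' \<union> ?T - R'')"
        unfolding stage_bad_def by blast
      have T: "?T \<subseteq> U" using U set_take_subset[of "Suc j" Us] by blast
      have UjT: "Us ! j \<subseteq> ?T" using j by (auto simp: take_Suc_conv_app_nth)
      have Fn: "{x, y} \<notin> F" if "x \<in> ?S" "y \<in> R' \<union> U" for x y
        using F that WU R' doubleton_in_pairs_into[of x y R' U] by blast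
      have FX: "{x, y} \<notin> F" "{x, y} \<notin> X" if "x \<in> W" "y \<in> W" for x y
        using F X that WU R' doubleton_in_pairs_into[of x y R' U] doubleton_in_bip[of x y "W' - R'" U] by blast+
      have "absorbable ?G (?aa a Z) ?S"
        by (rule iffD1[OF absorbable_cong ab]) (use FX WU in auto)
      moreover have "absorbable ?G (\<lambda>y. ?aa a Z y \<noteq> oddnb ?G y ?S) (R' \<union> ?T - R'')"
      proof (rule iffD1[OF absorbable_cong ab''])
        fix y assume "y \<in> R' \<union> ?T - R''"
        then have y: "y \<in> R' \<union> U" using T by auto
        have "oddnb ?G y ?S \<longleftrightarrow> oddnb ?E y ?S"
          by (rule oddnb_cong) (use Fn y in \<open>auto simp: insert_commute\<close>)
        then show "?aa a' (sym_diff Z \<sigma>) y = (?aa a Z y \<noteq> oddnb ?G y ?S)"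
          by (auto simp: \<sigma>_def a'_def)
      qed simp
      moreover have "?S \<inter> (R' \<union> ?T - R'') = {}" using T WU by auto
      ultimately have "absorbable ?G (?aa a Z) (?S \<union> (R' \<union> ?T - R''))"
        by (rule absorbable_Un)
      moreover have "?S \<union> (R' \<union> ?T - R'') = W \<union> ?T - R''"
        using R' R'' WU subset_trans[OF subset_trans[OF R''(1) UjT] T] by auto
      ultimately have "absorbable (E0 \<union> (X \<union> F)) (?aa a Z) (W \<union> ?T - R'')"
        by (simp only: Un_assoc)
      then show False using bad R'' unfolding stage_bad_def by blast
    qed
    have "bexp U pr (\<lambda>Z. pexp p (pairs_into R' U) (\<lambda>F. ?f E0 a W Z (X \<union> F))) \<le>
        bexp U pr (\<lambda>Z. pexp p (pairs_into R' U) (\<lambda>F. ?f ?E a' R' (sym_diff Z \<sigma>) F))"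
      by (intro bexp_mono sp0 spe of_bool_mono) (use imp K in blast)
    also have "\<dots> = bexp U (\<lambda>i. if i \<in> \<sigma> then 1 - pr i else pr i)
        (\<lambda>Z. pexp p (pairs_into R' U) (\<lambda>F. ?f ?E a' R' Z F))"
      by (rule bexp_flip) (auto simp: \<sigma>_def)
    also have "\<dots> \<le> B"
      using disj E0 X by (intro nxt spread_flip[OF sp]) blast
    finally show ?thesis .
  qed
  have "bexp U pr (\<lambda>Z. pexp p (pairs_into W' U) (\<lambda>F. ?f E0 a W Z F)) =
      bexp U pr (\<lambda>Z. pexp p (bip (W' - R') U)
        (\<lambda>X. pexp p (pairs_into R' U) (\<lambda>F. ?f E0 a W Z (X \<union> F))))"
    unfolding split using fin fin2 disj by (simp add: bexp_union)
  also have "\<dots> = pexp p (bip (W' - R') U)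
        (\<lambda>X. bexp U pr (\<lambda>Z. pexp p (pairs_into R' U) (\<lambda>F. ?f E0 a W Z (X \<union> F))))"
    by (rule bexp_swap)
  also have "\<dots> \<le> B"
    by (rule bexp_le) (use fin fin2 spe fixed in auto)
  finally show ?thesis .
qed


section \<open>Passing through a sequence of windows\<close>

lemma pairs_into_mono: "X \<subseteq> X' \<Longrightarrow> pairs_into X U \<subseteq> pairs_into X' U"
  by (auto simp: pairs_into_def bip_def)

text \<open>Unlike disjointness of the members of \<open>set Us\<close>, this also excludes that a
  nonempty window occurs twice in the list.\<close>

fun pdisj :: "'a set list \<Rightarrow> bool" where
  "pdisj [] \<longleftrightarrow> True"
| "pdisj (D # Us) \<longleftrightarrow> D \<inter> \<Union>(set Us) = {} \<and> pdisj Us"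

lemma of_bool_le0: "\<not> P \<Longrightarrow> (of_bool P :: real) \<le> 0"
  by simp

lemma of_bool_1: "P \<Longrightarrow> (of_bool P :: real) = 1"
  by simp

lemma stage_bad_0:
  "stage_bad t E a W (D # Us) 0 \<longleftrightarrow> \<not> (\<exists>R'\<subseteq>D. card R' \<le> t \<and> absorbable E a (W \<union> D - R'))"
  by (simp add: stage_bad_def)

lemma stage_bad_Suc: "stage_bad t E a W (D # Us) (Suc j) \<longleftrightarrow> stage_bad t E a (W \<union> D) Us j"
  by (simp add: stage_bad_def Un_assoc)

text \<open>If the preceding window left at most \<open>\<tau>\<close> vertices, then a stage is bad
  with probability at most \<open>\<eta>\<close>, whatever else happened before; so the stages in
  \<open>K\<close> contribute one factor each. Leaving more than \<open>\<tau>\<close> vertices has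
  probability at most \<open>\<epsilon>\<close> per window and enters additively.\<close>

lemma stage_chain:
  assumes q: "0 \<le> q" "q \<le> p" "p \<le> 1 - q"
    and \<eta>: "stage_err q M \<tau> L t \<le> \<eta>" "\<eta> \<le> 1" "t \<le> \<tau>" and \<epsilon>: "stage_err q M \<tau> L \<tau> \<le> \<epsilon>"
    and "pdisj Us" "\<And>D. D \<in> set Us \<Longrightarrow> finite D \<and> card D = L" "U = \<Union>(set Us)"
    and "finite R" "card R \<le> \<tau>" "R \<inter> U = {}" "spread q U pr" "E0 \<inter> pairs_into R U = {}"
    and "K \<subseteq> {..<length Us}"
  shows "bexp U pr (\<lambda>Z. pexp p (pairs_into R U) (\<lambda>F.
      of_bool (\<forall>j\<in>K. stage_bad t (E0 \<union> F) (\<lambda>y. if y \<in> U then y \<in> Z else a y) R Us j)))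
    \<le> \<eta> ^ card K + real (length Us) * \<epsilon>"
  using assms(8-)
proof (induction Us arbitrary: U R pr E0 a K)
  case Nil
  then show ?case by (simp add: pairs_into_def nsets_2_eq)
next
  case (Cons D Us)
  define U' where "U' = \<Union>(set Us)"
  define K' where "K' = {j. Suc j \<in> K}"
  define B' where "B' = \<eta> ^ card K' + real (length Us) * \<epsilon>"
  have q1: "0 \<le> 1 - q" "1 - q \<le> 1" using q by auto
  have err0: "0 \<le> stage_err q M \<tau> L s" for s
    unfolding stage_err_def using q1 q by (intro add_nonneg_nonneg sum_nonneg mult_nonneg_nonneg) auto
  have \<eta>0: "0 \<le> \<eta>" "0 \<le> \<epsilon>" using err0[of t] err0[of \<tau>] \<eta> \<epsilon> by auto
  have B0: "0 \<le> B'" unfolding B'_def using \<eta>0 by simp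
  have U: "U = D \<union> U'" and DU': "D \<inter> U' = {}" using Cons.prems by (auto simp: U'_def)
  have fin: "finite D" "finite U'" "finite R" "card D = L" using Cons.prems by (auto simp: U'_def)
  have RD: "R \<inter> D = {}" "R \<inter> U' = {}" using Cons.prems(6) U by auto
  have spe: "spread 0 J (\<lambda>_. p)" for J :: "'a set set" using q by (simp add: spread_def)
  have spD: "spread q D pr" and spU': "spread q U' pr"
    using Cons.prems(7) U by (auto intro: spread_subset)
  have sp0: "spread 0 D pr" "spread 0 U' pr" using spD spU' q spread_le by blast+
  have E0D: "E0 \<inter> pairs_into R D = {}" "E0 \<inter> pairs_into (R \<union> D) U' = {}"
    using Cons.prems(8) unfolding U pairs_into_def bip_Un_right bip_Un_left nsets_Un[OF DU'] by auto
  let ?bad = "\<lambda>Z F j. stage_bad t (E0 \<union> F) (\<lambda>y. if y \<in> U then y \<in> Z else a y) R (D # Us) j"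
  let ?good = "\<lambda>s Z F. \<exists>R'\<subseteq>D. card R' \<le> s \<and>
        absorbable (E0 \<union> F) (\<lambda>y. if y \<in> D then y \<in> Z else a y) (R \<union> D - R')"
  have split: "pairs_into R U = pairs_into R D \<union> pairs_into (R \<union> D) U'"
    unfolding U pairs_into_def bip_Un_right bip_Un_left nsets_Un[OF DU'] by auto
  have disj: "pairs_into R D \<inter> pairs_into (R \<union> D) U' = {}"
    using RD DU' Cons.prems(6) by (auto simp: pairs_into_def bip_def nsets_2_eq doubleton_eq_iff)
  have inner: "bexp U' pr (\<lambda>Z'. pexp p (pairs_into (R \<union> D) U') (\<lambda>F. of_bool (\<forall>j\<in>K. ?bad (Z \<union> Z') (F1 \<union> F) j)))
      \<le> of_bool (0 \<in> K \<longrightarrow> \<not> ?good t Z F1) * B' + of_bool (\<not> ?good \<tau> Z F1)"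
    if Z: "Z \<subseteq> D" and F1: "F1 \<subseteq> pairs_into R D" for Z F1
  proof -
    let ?E = "E0 \<union> F1" and ?a = "\<lambda>y. if y \<in> D then y \<in> Z else a y"
    let ?L = "bexp U' pr (\<lambda>Z'. pexp p (pairs_into (R \<union> D) U') (\<lambda>F. of_bool (\<forall>j\<in>K. ?bad (Z \<union> Z') (F1 \<union> F) j)))"
    have aeq: "(\<lambda>y. if y \<in> U then y \<in> Z \<union> Z' else a y) = (\<lambda>y. if y \<in> U' then y \<in> Z' else ?a y)" if "Z' \<subseteq> U'" for Z'
      using that Z DU' U by (auto simp: fun_eq_iff)
    have step: "?L \<le> B'" if R': "R' \<subseteq> D" "card R' \<le> \<tau>" and ab: "absorbable ?E ?a (R \<union> D - R')" for R'
    proof -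
      have "?L \<le> bexp U' pr (\<lambda>Z'. pexp p (pairs_into (R \<union> D) U') (\<lambda>F.
          of_bool (\<forall>j\<in>K'. stage_bad t (?E \<union> F) (\<lambda>y. if y \<in> U' then y \<in> Z' else ?a y) (R \<union> D) Us j)))"
      proof (intro bexp_mono sp0 spe of_bool_mono ballI)
        fix Z' F j
        assume "Z' \<subseteq> U'" and all: "\<forall>j\<in>K. ?bad (Z \<union> Z') (F1 \<union> F) j" and "j \<in> K'"
        then have "?bad (Z \<union> Z') (F1 \<union> F) (Suc j)" by (auto simp: K'_def)
        then show "stage_bad t (?E \<union> F) (\<lambda>y. if y \<in> U' then y \<in> Z' else ?a y) (R \<union> D) Us j"
          unfolding stage_bad_Suc aeq[OF \<open>Z' \<subseteq> U'\<close>] Un_assoc .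
      qed
      also have "\<dots> \<le> B'"
      proof (rule stage_transition[where R' = R'])
        show "?E \<inter> pairs_into R' U' = {}"
          using E0D(2) F1 disj pairs_into_mono[of R' "R \<union> D" U'] R'(1) by blast
        show "K' \<subseteq> {..<length Us}" using Cons.prems(9) by (auto simp: K'_def)
        fix pr' E0' a'
        assume "spread q U' pr'" "E0' \<inter> pairs_into R' U' = {}"
        then show "bexp U' pr' (\<lambda>Z. pexp p (pairs_into R' U') (\<lambda>F.
            of_bool (\<forall>j\<in>K'. stage_bad t (E0' \<union> F) (\<lambda>y. if y \<in> U' then y \<in> Z else a' y) R' Us j))) \<le> B'"
          unfolding B'_def using Cons.prems(1-3) Cons.prems(9) R' fin DU'
          by (intro Cons.IH) (auto simp: U'_def K'_def intro: finite_subset)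
      qed (use fin RD DU' R' ab spU' q in \<open>auto simp: U'_def\<close>)
      finally show ?thesis .
    qed
    have one: "?L \<le> 1"
      using fin spe sp0 by (intro bexp_le) auto
    \<comment> \<open>In the first case stage 0 is not bad, so the event is impossible. In the
      second the leftovers, at most \<open>\<tau>\<close>, take the place of \<open>R\<close> for
      the remaining windows. In the third the probability is bounded by 1.\<close>
    consider (a) "?good t Z F1" "0 \<in> K" | (b) "?good \<tau> Z F1" "0 \<in> K \<longrightarrow> \<not> ?good t Z F1" | (c) "\<not> ?good \<tau> Z F1"
      using \<eta>(3) le_trans by blast
    then show ?thesis
    proof cases
      case a
      then obtain R' where R': "R' \<subseteq> D" "card R' \<le> t" "absorbable ?E ?a (R \<union> D - R')" by blast
      have nb: "\<not> (\<forall>j\<in>K. ?bad (Z \<union> Z') (F1 \<union> F) j)" if "Z' \<subseteq> U'" "F \<subseteq> pairs_into (R \<union> D) U'" for Z' F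
      proof -
        have "absorbable (E0 \<union> (F1 \<union> F)) (\<lambda>y. if y \<in> U then y \<in> Z \<union> Z' else a y) (R \<union> D - R')"
        proof (rule iffD1[OF absorbable_cong R'(3)])
          fix x assume "x \<in> R \<union> D - R'"
          then show "?a x = (if x \<in> U then x \<in> Z \<union> Z' else a x)"
            using RD DU' U Z that(1) by auto
        next
          fix x y assume "x \<in> R \<union> D - R'" "y \<in> R \<union> D - R'"
          then have "{x, y} \<notin> F" using that(2) RD DU' doubleton_in_pairs_into[of x y "R \<union> D" U'] by blast
          then show "{x, y} \<in> E0 \<union> F1 \<longleftrightarrow> {x, y} \<in> E0 \<union> (F1 \<union> F)" by auto
        qed
        then have "\<not> ?bad (Z \<union> Z') (F1 \<union> F) 0"
          unfolding stage_bad_0 using R'(1,2) by blast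
        then show ?thesis using a(2) by blast
      qed
      have "?L \<le> 0"
        by (intro bexp_le of_bool_le0 nb sp0 spe) (use fin in auto)
      moreover have "0 \<le> of_bool (0 \<in> K \<longrightarrow> \<not> ?good t Z F1) * B'" using B0 by (intro mult_nonneg_nonneg) simp_all
      moreover have "(0::real) \<le> of_bool (\<not> ?good \<tau> Z F1)" by simp
      ultimately show ?thesis by linarith
    next
      case b
      then obtain R' where "R' \<subseteq> D" "card R' \<le> \<tau>" "absorbable ?E ?a (R \<union> D - R')" by blast
      then have "?L \<le> B'" by (rule step)
      moreover have "of_bool (0 \<in> K \<longrightarrow> \<not> ?good t Z F1) = (1::real)"
        by (rule of_bool_1[OF b(2)])
      moreover have "(0::real) \<le> of_bool (\<not> ?good \<tau> Z F1)" by simp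
      ultimately show ?thesis by (simp only: mult_1)
    next
      case c
      have "of_bool (\<not> ?good \<tau> Z F1) = (1::real)" by (rule of_bool_1[OF c])
      moreover have "0 \<le> of_bool (0 \<in> K \<longrightarrow> \<not> ?good t Z F1) * B'" using B0 by (intro mult_nonneg_nonneg) simp_all
      ultimately show ?thesis using one by linarith
    qed
  qed
  have stage: "bexp D pr (\<lambda>Z. pexp p (pairs_into R D) (\<lambda>F. of_bool (\<not> ?good s Z F))) \<le> stage_err q M \<tau> L s" for s
  proof -
    have "E0 \<inter> nsets D 2 = {}" using E0D by (auto simp: pairs_into_def)
    then show ?thesis
      using stage_bound[of R D q pr p \<tau> E0 s a M] fin RD spD q Cons.prems(5) by simp
  qed
  let ?\<Phi> = "\<lambda>Z F. of_bool (\<forall>j\<in>K. ?bad Z F j) :: real"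
  have "bexp U pr (\<lambda>Z. pexp p (pairs_into R U) (\<lambda>F. ?\<Phi> Z F)) =
      bexp D pr (\<lambda>Z. bexp U' pr (\<lambda>Z'. pexp p (pairs_into R D) (\<lambda>F1.
        pexp p (pairs_into (R \<union> D) U') (\<lambda>F. ?\<Phi> (Z \<union> Z') (F1 \<union> F)))))"
  proof -
    have e: "bexp U pr f = bexp D pr (\<lambda>Z. bexp U' pr (\<lambda>Z'. f (Z \<union> Z')))" for f
      unfolding U using fin DU' by (intro bexp_union) auto
    have e': "pexp p (pairs_into R U) f =
        pexp p (pairs_into R D) (\<lambda>F1. pexp p (pairs_into (R \<union> D) U') (\<lambda>F. f (F1 \<union> F)))" for f
      unfolding split using fin disj by (intro bexp_union) auto
    show ?thesis unfolding e e' ..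
  qed
  also have "\<dots> = bexp D pr (\<lambda>Z. pexp p (pairs_into R D) (\<lambda>F1. bexp U' pr (\<lambda>Z'.
        pexp p (pairs_into (R \<union> D) U') (\<lambda>F. ?\<Phi> (Z \<union> Z') (F1 \<union> F)))))"
    by (intro bexp_cong bexp_swap refl)
  also have "\<dots> \<le> bexp D pr (\<lambda>Z. pexp p (pairs_into R D) (\<lambda>F1.
        B' * of_bool (0 \<in> K \<longrightarrow> \<not> ?good t Z F1) + of_bool (\<not> ?good \<tau> Z F1)))"
    by (intro bexp_mono sp0 spe) (use inner in \<open>simp only: mult.commute[of B']\<close>)
  also have "\<dots> = B' * bexp D pr (\<lambda>Z. pexp p (pairs_into R D) (\<lambda>F1. of_bool (0 \<in> K \<longrightarrow> \<not> ?good t Z F1)))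
      + bexp D pr (\<lambda>Z. pexp p (pairs_into R D) (\<lambda>F1. of_bool (\<not> ?good \<tau> Z F1)))"
    by (simp only: bexp_add bexp_cmult)
  also have "\<dots> \<le> B' * (if 0 \<in> K then \<eta> else 1) + \<epsilon>"
  proof (intro add_mono mult_left_mono B0)
    show "bexp D pr (\<lambda>Z. pexp p (pairs_into R D) (\<lambda>F1. of_bool (\<not> ?good \<tau> Z F1))) \<le> \<epsilon>"
      using stage[of \<tau>] \<epsilon> by linarith
    show "bexp D pr (\<lambda>Z. pexp p (pairs_into R D) (\<lambda>F1. of_bool (0 \<in> K \<longrightarrow> \<not> ?good t Z F1))) \<le> (if 0 \<in> K then \<eta> else 1)"
    proof (cases "0 \<in> K")
      case True
      have "bexp D pr (\<lambda>Z. pexp p (pairs_into R D) (\<lambda>F1. of_bool (\<not> ?good t Z F1))) \<le> \<eta>"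
        using stage[of t] \<eta>(1) by linarith
      then show ?thesis using True by (simp only: simp_thms if_True)
    next
      case False
      then show ?thesis using fin by (simp only: simp_thms if_False of_bool_eq bexp_const finite_pairs_into order_refl)
    qed
  qed
  also have "\<dots> \<le> \<eta> ^ card K + real (length (D # Us)) * \<epsilon>"
  proof -
    have Kfin: "finite K" using Cons.prems(9) finite_subset by blast
    have Keq: "K = (if 0 \<in> K then {0} else {}) \<union> Suc ` K'"
      unfolding K'_def using old.nat.exhaust by auto (metis image_eqI mem_Collect_eq old.nat.exhaust)+
    have fK': "finite K'"
      by (rule finite_imageD[of Suc]) (use Kfin Keq in \<open>auto intro: finite_subset\<close>)
    have cK: "card K = (if 0 \<in> K then Suc (card K') else card K')"
    proof (cases "0 \<in> K")
      case True
      then have "K = insert 0 (Suc ` K')" using Keq by auto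
      then have "card K = Suc (card (Suc ` K'))" using fK' by (metis card_insert_disjoint finite_imageI image_iff nat.distinct(1))
      then show ?thesis using True by (simp add: card_image)
    next
      case False
      then have "K = Suc ` K'" using Keq by auto
      then show ?thesis using False by (metis card_image inj_Suc)
    qed
    have "B' * (if 0 \<in> K then \<eta> else 1) \<le> \<eta> ^ card K + real (length Us) * \<epsilon>"
    proof (cases "0 \<in> K")
      case True
      have "real (length Us) * \<epsilon> * \<eta> \<le> real (length Us) * \<epsilon> * 1"
        using \<eta>0 \<eta>(2) by (intro mult_left_mono) auto
      then show ?thesis using True by (simp add: B'_def cK algebra_simps)
    qed (simp add: B'_def cK)
    then show ?thesis by (simp add: algebra_simps)
  qed
  finally show ?case .
qed

section \<open>Postponing odd vertices\<close>

fun reduces :: "'a set set \<Rightarrow> 'a set \<Rightarrow> 'a list \<Rightarrow> bool" where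
  "reduces E T [] \<longleftrightarrow> True"
| "reduces E T (x # xs) \<longleftrightarrow> \<not> oddnb E x (set xs \<union> T) \<and> reduces E T xs"

lemma reduces_append: "reduces E T (xs @ ys) \<longleftrightarrow> reduces E (set ys \<union> T) xs \<and> reduces E T ys"
  by (induction xs) (auto simp: Un_assoc)

lemma reduces_nth:
  "reduces E T xs \<Longrightarrow> i < length xs \<Longrightarrow> \<not> oddnb E (xs ! i) (set (drop (Suc i) xs) \<union> T)"
proof (induction xs arbitrary: i)
  case (Cons x xs)
  then show ?case by (cases i) auto
qed simp

lemma even_degenerate_if_reduces:
  assumes "distinct (xs @ [u, v])" "set (xs @ [u, v]) = V" "reduces E {u, v} xs"
  shows "even_degenerate V E"
  unfolding even_degenerate_def
proof (intro exI[of _ "xs @ [u, v]"] conjI allI impI)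
  fix i assume "i + 2 < length (xs @ [u, v])"
  then have i: "i < length xs" by simp
  let ?S = "set (drop (Suc i) xs) \<union> {u, v}"
  have "neighbours E (xs ! i) \<inter> ?S = {y \<in> ?S. {xs ! i, y} \<in> E}"
    by (auto simp: neighbours_def)
  then have "even (card (neighbours E (xs ! i) \<inter> ?S))"
    using reduces_nth[OF assms(3) i] by (simp add: oddnb_def)
  then show "even (card (neighbours E ((xs @ [u, v]) ! i) \<inter> set (drop (Suc i) (xs @ [u, v]))))"
    using i by (simp add: nth_append)
qed (use assms in auto)

text \<open>Here \<open>T\<close> holds the final vertices and those postponed so far. If the total
  is odd and the number of neighbours in \<open>xs\<close> is odd, then the number in
  \<open>T\<close> is even, and this is the degree of \<open>x\<close> when it is taken from the
  stack.\<close>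

fun clears :: "'a set set \<Rightarrow> 'a set \<Rightarrow> 'a list \<Rightarrow> bool" where
  "clears E T [] \<longleftrightarrow> True"
| "clears E T (x # xs) \<longleftrightarrow>
    (if oddnb E x (set xs \<union> T) then xs = [] \<or> oddnb E x (set xs) \<and> clears E (insert x T) xs
     else clears E T xs)"

text \<open>An invariant: removing a vertex of even degree does not change it. If it agrees for the
  whole set and for the final \<open>T\<close>, then the degree of the last vertex is even as
  well.\<close>

definition odd_size :: "'a set set \<Rightarrow> 'a set \<Rightarrow> bool" where
  "odd_size E S \<longleftrightarrow> odd (card (induced_edges E S))"

lemma odd_size_insert:
  assumes "E \<subseteq> nsets UNIV 2" "finite S" "x \<notin> S"
  shows "odd_size E (insert x S) \<longleftrightarrow> odd_size E S \<noteq> oddnb E x S"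
proof -
  let ?N = "{y \<in> S. {x, y} \<in> E}"
  have "induced_edges E (insert x S) = induced_edges E S \<union> (\<lambda>y. {x, y}) ` ?N"
  proof (intro set_eqI iffI)
    fix e assume e: "e \<in> induced_edges E (insert x S)"
    then have "e \<in> E" "e \<subseteq> insert x S" by (auto simp: induced_edges_def)
    moreover obtain y z where "e = {y, z}" "y \<noteq> z"
      using \<open>e \<in> E\<close> assms(1) by (auto simp: nsets_def card_2_iff subset_iff)
    ultimately show "e \<in> induced_edges E S \<union> (\<lambda>y. {x, y}) ` ?N"
      by (auto simp: induced_edges_def insert_commute)
  qed (auto simp: induced_edges_def)
  moreover have "induced_edges E S \<inter> (\<lambda>y. {x, y}) ` ?N = {}"
    using assms(3) by (auto simp: induced_edges_def)
  moreover have "finite (induced_edges E S)"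
    using assms(2) by (auto simp: induced_edges_def intro: finite_subset[of _ "Pow S"])
  moreover have "card ((\<lambda>y. {x, y}) ` ?N) = card ?N"
    using assms(3) by (intro card_image inj_on_subset[OF inj_on_doubleton]) auto
  ultimately have "card (induced_edges E (insert x S)) = card (induced_edges E S) + card ?N"
    using assms(2) by (simp add: card_Un_disjoint)
  then show ?thesis by (auto simp: odd_size_def oddnb_def)
qed

text \<open>A vertex \<open>x\<close> of odd degree can be postponed if it has an odd number of neighbours among the
  vertices removed in the meantime. The last vertex needs no condition, as its parity
  is determined by the parity of the number of edges.\<close>

lemma reduces_if_clears:
  assumes "E \<subseteq> nsets UNIV 2" "finite T" "distinct xs" "set xs \<inter> T = {}" "clears E T xs"
    and "odd_size E (set xs \<union> T) \<longleftrightarrow> odd_size E T"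
  shows "\<exists>ys. distinct ys \<and> set ys = set xs \<and> reduces E T ys"
  using assms(2-)
proof (induction xs arbitrary: T)
  case (Cons x xs)
  have fin: "finite (set xs \<union> T)" and x: "x \<notin> set xs \<union> T" using Cons.prems by auto
  have size: "odd_size E (set (x # xs) \<union> T) \<longleftrightarrow> odd_size E (set xs \<union> T) \<noteq> oddnb E x (set xs \<union> T)"
    using odd_size_insert[OF assms(1) fin x] by simp
  have sizeT: "odd_size E (insert x T) \<longleftrightarrow> odd_size E T \<noteq> oddnb E x T"
    using x Cons.prems(1) by (intro odd_size_insert assms(1)) auto
  have odd_Un: "oddnb E x (set xs \<union> T) \<longleftrightarrow> oddnb E x (set xs) \<noteq> oddnb E x T"
    using Cons.prems by (intro oddnb_Un) auto
  show ?case
  proof (cases "oddnb E x (set xs \<union> T)")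
    case False
    then obtain ys where "distinct ys" "set ys = set xs" "reduces E T ys"
      using Cons.IH[of T] Cons.prems size by auto
    then show ?thesis using False x by (intro exI[of _ "x # ys"]) auto
  next
    case True
    \<comment> \<open>If \<open>x\<close> were the last vertex, the parity of the number of edges
      would make its degree even.\<close>
    then have ne: "xs \<noteq> []" using Cons.prems(5) size by auto
    then have xs: "oddnb E x (set xs)" "clears E (insert x T) xs" using Cons.prems(4) True by auto
    then have xT: "\<not> oddnb E x T" using True odd_Un by simp
    have "odd_size E (set xs \<union> insert x T) \<longleftrightarrow> odd_size E (insert x T)"
      using Cons.prems(5) sizeT xT by simp
    then obtain ys where ys: "distinct ys" "set ys = set xs" "reduces E (insert x T) ys"
      using Cons.IH[of "insert x T"] Cons.prems xs(2) by auto
    \<comment> \<open>The stack discipline: \<open>x\<close> is removed after all vertices processed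
      later, with only \<open>T\<close> remaining.\<close>
    then show ?thesis using xT x by (intro exI[of _ "ys @ [x]"]) (auto simp: reduces_append)
  qed
qed simp

fun free_order :: "'a set set \<Rightarrow> 'a set \<Rightarrow> 'a list \<Rightarrow> bool" where
  "free_order E R [] \<longleftrightarrow> True"
| "free_order E R (x # xs) \<longleftrightarrow> oddnb E x (set xs \<union> R) \<and> free_order E R xs"

text \<open>That a free order succeeds does not depend on the edges at the final vertices, but which
  vertices it postpones does. The stack is recorded because it counts in the degrees of the
  leftovers that come next.\<close>

fun stack_after :: "'a set set \<Rightarrow> 'a set \<Rightarrow> 'a set \<Rightarrow> 'a list \<Rightarrow> 'a set" where
  "stack_after E T R [] = T"
| "stack_after E T R (x # xs) =
    (if oddnb E x (set xs \<union> R \<union> T) then stack_after E (insert x T) R xs else stack_after E T R xs)"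

lemma free_order_append:
  "free_order E R (xs @ ys) \<longleftrightarrow> free_order E (set ys \<union> R) xs \<and> free_order E R ys"
  by (induction xs) (auto simp: Un_assoc)

lemma free_order_cong:
  assumes "\<And>x y. x \<in> set xs \<Longrightarrow> y \<in> set xs \<union> R \<Longrightarrow> {x, y} \<in> E \<longleftrightarrow> {x, y} \<in> E'"
  shows "free_order E R xs \<longleftrightarrow> free_order E' R xs"
  using assms
proof (induction xs)
  case (Cons x xs)
  have "oddnb E x (set xs \<union> R) \<longleftrightarrow> oddnb E' x (set xs \<union> R)"
    by (rule oddnb_cong) (use Cons.prems in auto)
  then show ?case using Cons by auto
qed simp

lemma free_order_add_row:
  "u \<notin> set xs \<union> R \<Longrightarrow> free_order (E \<union> (\<lambda>w. {u, w}) ` \<beta>) R xs \<longleftrightarrow> free_order E R xs"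
  by (rule free_order_cong) (auto simp: doubleton_eq_iff)

lemma stack_after_cong:
  assumes "\<And>x y. x \<in> set xs \<Longrightarrow> y \<in> set xs \<union> R \<union> T \<Longrightarrow> {x, y} \<in> E \<longleftrightarrow> {x, y} \<in> E'"
  shows "stack_after E T R xs = stack_after E' T R xs"
  using assms
proof (induction xs arbitrary: T)
  case (Cons x xs)
  have "oddnb E x (set xs \<union> R \<union> T) \<longleftrightarrow> oddnb E' x (set xs \<union> R \<union> T)"
    by (rule oddnb_cong) (use Cons.prems in auto)
  moreover have "stack_after E T R xs = stack_after E' T R xs"
    "stack_after E (insert x T) R xs = stack_after E' (insert x T) R xs"
    using Cons.prems by (auto intro!: Cons.IH)
  ultimately show ?case by simp
qed simp

lemma stack_after_bounds: "T \<subseteq> stack_after E T R xs \<and> stack_after E T R xs \<subseteq> T \<union> set xs"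
proof (induction xs arbitrary: T)
  case (Cons x xs)
  show ?case using Cons.IH[of T] Cons.IH[of "insert x T"] by auto
qed simp

lemma clears_append_free:
  "free_order E (set ys) xs \<Longrightarrow> clears E (stack_after E T (set ys) xs) ys \<Longrightarrow> clears E T (xs @ ys)"
  by (induction xs arbitrary: T) (auto simp: Un_assoc split: if_splits)

lemma clears_append_reduces:
  "reduces E (set ys \<union> T) xs \<Longrightarrow> clears E T ys \<Longrightarrow> clears E T (xs @ ys)"
  by (induction xs) (auto simp: Un_assoc)

text \<open>The greedy choice from the front: taking \<open>x\<close> out of \<open>X\<close>
  toggles the parities of its neighbours, so the current parities are the degrees into what
  remains.\<close>

lemma free_order_if_absorb:
  assumes "finite X" "distinct xs" "set xs \<subseteq> X" "absorb E (\<lambda>y. oddnb E y (X - {y})) xs"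
  shows "free_order E (X - set xs) xs"
  using assms
proof (induction xs arbitrary: X)
  case (Cons x xs)
  have "absorb E (\<lambda>y. oddnb E y (X - {y}) \<noteq> ({x, y} \<in> E)) xs" using Cons.prems by simp
  moreover have "oddnb E y (X - {y}) \<noteq> ({x, y} \<in> E) \<longleftrightarrow> oddnb E y (X - {x} - {y})" if "y \<in> set xs" for y
  proof -
    have "X - {y} = insert x (X - {x} - {y})" using Cons.prems that by auto
    then show ?thesis
      using oddnb_insert[of "X - {x} - {y}" x E y] Cons.prems(1) by (auto simp: insert_commute)
  qed
  ultimately have "absorb E (\<lambda>y. oddnb E y (X - {x} - {y})) xs"
    using Cons.prems(2) by (subst (asm) absorb_cong[where E' = E and a' = "\<lambda>y. oddnb E y (X - {x} - {y})"]) auto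
  then have "free_order E (X - {x} - set xs) xs"
    using Cons.prems by (intro Cons.IH) auto
  moreover have "X - {x} - set xs = X - set (x # xs)" by auto
  moreover have "set xs \<union> (X - set (x # xs)) = X - {x}" using Cons.prems by auto
  ultimately show ?case using Cons.prems(4) by simp
qed simp

text \<open>The greedy choice from the back: \<open>x\<close> is put in front of \<open>B\<close>
  and joins it, so the order of absorption is opposite to the order of processing.\<close>

lemma free_order_rev_if_absorb:
  assumes "finite B" "distinct xs" "set xs \<inter> B = {}" "absorb E (\<lambda>y. oddnb E y B) xs"
  shows "free_order E B (rev xs)"
  using assms
proof (induction xs arbitrary: B)
  case (Cons x xs)
  have "absorb E (\<lambda>y. oddnb E y B \<noteq> ({x, y} \<in> E)) xs" using Cons.prems by simp
  moreover have "oddnb E y B \<noteq> ({x, y} \<in> E) \<longleftrightarrow> oddnb E y (insert x B)" for y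
    using oddnb_insert[of B x E y] Cons.prems by (auto simp: insert_commute)
  ultimately have "free_order E (insert x B) (rev xs)"
    using Cons.prems by (intro Cons.IH) auto
  then show ?case using Cons.prems by (simp add: free_order_append)
qed simp

text \<open>The edge from \<open>u\<close> to \<open>j\<close> counts in the degree of
  \<open>j\<close> only, as \<open>u\<close> stays to the end. So these edges can be prescribed from
  the last vertex of \<open>js\<close> to the first, each making one degree even.\<close>

lemma joker_pattern:
  assumes "finite W" "u \<in> W" "set js \<inter> W = {}" "distinct js" "\<And>j. j \<in> set js \<Longrightarrow> {u, j} \<notin> E"
  shows "\<exists>\<phi>\<subseteq>set js. \<forall>\<beta>. \<beta> \<inter> set js = \<phi> \<longrightarrow> reduces (E \<union> (\<lambda>w. {u, w}) ` \<beta>) W js"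
  using assms
proof (induction js)
  case (Cons j js)
  then obtain \<phi> where \<phi>: "\<phi> \<subseteq> set js"
    and red: "\<And>\<beta>. \<beta> \<inter> set js = \<phi> \<Longrightarrow> reduces (E \<union> (\<lambda>w. {u, w}) ` \<beta>) W js"
    by auto
  let ?S = "set js \<union> W"
  let ?\<psi> = "if oddnb E j ?S then insert j \<phi> else \<phi>"
  have main: "reduces (E \<union> (\<lambda>w. {u, w}) ` \<beta>) W (j # js)" if \<beta>: "\<beta> \<inter> set (j # js) = ?\<psi>" for \<beta>
  proof -
    let ?G = "E \<union> (\<lambda>w. {u, w}) ` \<beta>"
    have "\<beta> \<inter> set js = \<phi>" using \<beta> \<phi> Cons.prems(4) by (auto split: if_splits)
    moreover have jb: "j \<in> \<beta> \<longleftrightarrow> oddnb E j ?S" using \<beta> \<phi> Cons.prems(4) by (auto split: if_splits)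
    have ju: "j \<noteq> u" "{j, u} \<notin> E" using Cons.prems by (auto simp: insert_commute)
    have S: "?S = insert u (?S - {u})" using Cons.prems(2) by auto
    have "oddnb ?G j (?S - {u}) \<longleftrightarrow> oddnb E j (?S - {u})"
      by (rule oddnb_cong) (use ju in \<open>auto simp: doubleton_eq_iff\<close>)
    then have "oddnb ?G j ?S \<longleftrightarrow> oddnb E j ?S \<noteq> (j \<in> \<beta>)"
      using oddnb_insert[of "?S - {u}" u ?G j] oddnb_insert[of "?S - {u}" u E j] S ju Cons.prems(1)
      by (auto simp: doubleton_eq_iff)
    ultimately show ?thesis using red jb by simp
  qed
  have "?\<psi> \<subseteq> set (j # js)" using \<phi> by auto
  then show ?case using main by (intro exI[of _ ?\<psi>] conjI allI impI)
qed simp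

text \<open>The leftovers \<open>js\<close> come between the front part \<open>xs\<close> and the
  back part. Their degrees involve the stack built by \<open>xs\<close>, and this depends on the
  edges from \<open>u\<close> to \<open>xs\<close>. This is why the pattern is a function of
  \<open>\<beta> \<inter> set xs\<close>; no further edge at \<open>u\<close> has an influence on
  it.\<close>

lemma cut_pattern:
  assumes "finite X" "u \<notin> X" "v \<notin> X" "distinct (xs @ js @ ys @ [b])" "X = set (xs @ js @ ys @ [b])"
    and "absorb E (\<lambda>y. oddnb E y (X - {y})) xs" "absorb E (\<lambda>y. {b, y} \<in> E) ys"
    and "\<And>w. w \<in> set xs \<union> set js \<Longrightarrow> {u, w} \<notin> E"
  shows "\<exists>\<phi>. (\<forall>\<gamma>. \<phi> \<gamma> \<subseteq> set js) \<and> (\<forall>\<beta>. \<beta> \<inter> set js = \<phi> (\<beta> \<inter> set xs) \<longrightarrow>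
    clears (E \<union> (\<lambda>w. {u, w}) ` \<beta>) {u, v} (xs @ js @ rev ys @ [b]))"
proof -
  let ?G = "\<lambda>\<beta>. E \<union> (\<lambda>w. {u, w}) ` \<beta>"
  let ?R = "set (js @ rev ys @ [b])" and ?zs = "rev ys @ [b]"
  let ?S = "\<lambda>\<beta>. stack_after (?G \<beta>) {u, v} ?R xs"
  have nu: "u \<notin> set xs" "u \<notin> ?R" using assms(2,5) by auto
  have "\<exists>\<phi>\<subseteq>set js. \<forall>\<beta>. \<beta> \<inter> set js = \<phi> \<longrightarrow> reduces (?G \<beta>) (set ?zs \<union> ?S \<gamma>) js" for \<gamma>
  proof (rule joker_pattern)
    have "?S \<gamma> \<subseteq> {u, v} \<union> set xs" "u \<in> ?S \<gamma>" using stack_after_bounds[of "{u, v}" "?G \<gamma>" ?R xs] by auto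
    then show "finite (set ?zs \<union> ?S \<gamma>)" "u \<in> set ?zs \<union> ?S \<gamma>" "set js \<inter> (set ?zs \<union> ?S \<gamma>) = {}"
      using assms(2-5) by (auto intro: finite_subset)
  qed (use assms in auto)
  then obtain \<phi> where \<phi>: "\<And>\<gamma>. \<phi> \<gamma> \<subseteq> set js"
    and red: "\<And>\<gamma> \<beta>. \<beta> \<inter> set js = \<phi> \<gamma> \<Longrightarrow> reduces (?G \<beta>) (set ?zs \<union> ?S \<gamma>) js"
    by metis
  have "clears (?G \<beta>) {u, v} (xs @ js @ ?zs)" if \<beta>: "\<beta> \<inter> set js = \<phi> (\<beta> \<inter> set xs)" for \<beta>
  proof -
    have "?S \<beta> = ?S (\<beta> \<inter> set xs)"
    proof (rule stack_after_cong)
      fix x y assume "x \<in> set xs" "y \<in> set xs \<union> ?R \<union> {u, v}"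
      then have "x \<noteq> u" using nu by auto
      then show "{x, y} \<in> ?G \<beta> \<longleftrightarrow> {x, y} \<in> ?G (\<beta> \<inter> set xs)"
        using \<open>x \<in> set xs\<close> by (auto simp: doubleton_eq_iff)
    qed
    then have r: "reduces (?G \<beta>) (set ?zs \<union> ?S \<beta>) js" using red[OF \<beta>] by simp
    have "absorb E (\<lambda>y. oddnb E y {b}) ys"
      using assms(7) oddnb_insert[of "{}" b E] by (simp add: insert_commute)
    then have "free_order E {b} (rev ys)"
      using assms(4) by (intro free_order_rev_if_absorb) auto
    then have "free_order (?G \<beta>) {b} (rev ys)"
      using nu by (subst free_order_add_row) auto
    then have "clears (?G \<beta>) T ?zs" for T
      by (intro clears_append_free) simp_all
    with r have cl: "clears (?G \<beta>) (?S \<beta>) (js @ ?zs)"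
      by (rule clears_append_reduces)
    have "X = set xs \<union> ?R" "set xs \<inter> ?R = {}" using assms(4,5) by (simp_all add: Un_assoc Int_Un_distrib)
    then have XR: "X - set xs = ?R" by blast
    have "free_order E (X - set xs) xs"
      by (rule free_order_if_absorb[OF assms(1) _ _ assms(6)]) (use assms(4,5) in auto)
    then have "free_order E ?R xs" unfolding XR .
    then have "free_order (?G \<beta>) ?R xs"
      using nu by (subst free_order_add_row) auto
    from this cl show ?thesis by (rule clears_append_free)
  qed
  then show ?thesis by (intro exI[of _ \<phi>] conjI allI impI \<phi>)
qed

section \<open>Hitting one of many patterns\<close>

lemma bexp_point:
  assumes "finite J" "spread q J pr" "0 \<le> q" "q \<le> 1" "\<phi> \<subseteq> J" "card J \<le> c"
  shows "bexp J pr (\<lambda>\<eta>. of_bool (\<eta> \<noteq> \<phi>)) \<le> 1 - q ^ c"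
proof -
  have sp0: "spread 0 J pr" using assms spread_le by blast
  have "q ^ c \<le> q ^ card J" using assms by (intro power_decreasing) auto
  also have "\<dots> = (\<Prod>i\<in>J. q)" by simp
  also have "\<dots> \<le> (\<Prod>i\<in>J. if i \<in> \<phi> then pr i else 1 - pr i)"
    using assms by (intro prod_mono) (force simp: spread_def)
  also have "\<dots> = (\<Sum>\<eta>\<in>{\<phi>}. (\<Prod>i\<in>J. if i \<in> \<eta> then pr i else 1 - pr i) * of_bool (\<eta> = \<phi>))" by simp
  also have "\<dots> \<le> bexp J pr (\<lambda>\<eta>. of_bool (\<eta> = \<phi>))"
    unfolding bexp_def using assms sp0
    by (intro sum_mono2) (auto simp: spread_def intro!: prod_nonneg)
  finally have "q ^ c \<le> bexp J pr (\<lambda>\<eta>. of_bool (\<eta> = \<phi>))" .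
  moreover have "bexp J pr (\<lambda>\<eta>. of_bool (\<eta> = \<phi>)) + bexp J pr (\<lambda>\<eta>. of_bool (\<eta> \<noteq> \<phi>)) = 1"
  proof -
    have "bexp J pr (\<lambda>\<eta>. of_bool (\<eta> = \<phi>) + of_bool (\<eta> \<noteq> \<phi>)) = bexp J pr (\<lambda>_. 1)"
      by (intro bexp_cong) auto
    then show ?thesis using assms(1) by (simp add: bexp_add)
  qed
  ultimately show ?thesis by linarith
qed

text \<open>The block with the largest index is averaged while everything else is fixed. It meets
  neither the other blocks nor any of the sets \<open>T i\<close>, so the other events and its own
  pattern are determined, and the pattern is hit with probability at least
  \<open>q ^ c\<close>.\<close>

lemma pattern_bound:
  fixes m :: nat
  assumes "finite U" "spread q U pr" "0 \<le> q" "q \<le> 1" "K \<subseteq> {..<m}"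
    and "\<And>i. i \<in> K \<Longrightarrow> J i \<subseteq> U \<and> card (J i) \<le> c \<and> (\<forall>\<gamma>. \<phi> i \<gamma> \<subseteq> J i)"
    and "\<And>i j. i \<in> K \<Longrightarrow> j \<in> K \<Longrightarrow> i < j \<Longrightarrow> J i \<inter> J j = {}"
    and "\<And>i j. i \<in> K \<Longrightarrow> j \<in> K \<Longrightarrow> i \<le> j \<Longrightarrow> T i \<inter> J j = {}"
  shows "bexp U pr (\<lambda>\<beta>. of_bool (\<forall>i\<in>K. \<beta> \<inter> J i \<noteq> \<phi> i (\<beta> \<inter> T i))) \<le> (1 - q ^ c) ^ card K"
  using assms
proof (induction m arbitrary: U K)
  case (Suc m)
  show ?case
  proof (cases "m \<in> K")
    case False
    then have "K \<subseteq> {..<m}" using Suc.prems(5) less_Suc_eq by auto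
    then show ?thesis using Suc.IH[of U K] Suc.prems by auto
  next
    case True
    let ?K = "K - {m}" and ?U = "U - J m"
    let ?P = "\<lambda>\<beta>. \<forall>i\<in>?K. \<beta> \<inter> J i \<noteq> \<phi> i (\<beta> \<inter> T i)"
    have K: "?K \<subseteq> {..<m}" using Suc.prems(5) by auto
    have Jm: "J m \<subseteq> U" "finite (J m)" using Suc.prems(1) Suc.prems(6)[OF True] finite_subset by blast+
    have qc: "0 \<le> 1 - q ^ c" using Suc.prems(3,4) by (simp add: power_le_one)
    have sp: "spread 0 ?U pr" "spread 0 (J m) pr" "spread q (J m) pr" "spread q ?U pr"
      using spread_le[OF Suc.prems(2,3)] Suc.prems(2) Jm(1) by (auto intro: spread_subset)
    have U: "?U \<union> J m = U" using Jm by auto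
    have bexp_U: "bexp U pr f = bexp ?U pr (\<lambda>H. bexp (J m) pr (\<lambda>\<eta>. f (H \<union> \<eta>)))" for f
      using bexp_union[of ?U "J m" pr f] Suc.prems(1) Jm(2) unfolding U by blast
    have "bexp U pr (\<lambda>\<beta>. of_bool (\<forall>i\<in>K. \<beta> \<inter> J i \<noteq> \<phi> i (\<beta> \<inter> T i))) =
       bexp ?U pr (\<lambda>H. bexp (J m) pr (\<lambda>\<eta>. of_bool (\<forall>i\<in>K. (H \<union> \<eta>) \<inter> J i \<noteq> \<phi> i ((H \<union> \<eta>) \<inter> T i))))"
      unfolding bexp_U ..
    also have "\<dots> \<le> bexp ?U pr (\<lambda>H. (1 - q ^ c) * of_bool (?P H))"
    proof (rule bexp_mono[OF sp(1)])
      fix H assume H: "H \<subseteq> ?U"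
      have eq: "of_bool (\<forall>i\<in>K. (H \<union> \<eta>) \<inter> J i \<noteq> \<phi> i ((H \<union> \<eta>) \<inter> T i)) =
          of_bool (?P H) * (of_bool (\<eta> \<noteq> \<phi> m (H \<inter> T m)) :: real)" if \<eta>: "\<eta> \<subseteq> J m" for \<eta>
      proof -
        have "(H \<union> \<eta>) \<inter> J i = H \<inter> J i" "(H \<union> \<eta>) \<inter> T i = H \<inter> T i" if "i \<in> ?K" for i
        proof -
          have "i \<in> K" "i < m" using that K by auto
          then have "J i \<inter> J m = {}" "T i \<inter> J m = {}" using Suc.prems(7,8) True by auto
          then show "(H \<union> \<eta>) \<inter> J i = H \<inter> J i" "(H \<union> \<eta>) \<inter> T i = H \<inter> T i" using \<eta> by auto
        qed
        moreover have "(H \<union> \<eta>) \<inter> J m = \<eta>" "(H \<union> \<eta>) \<inter> T m = H \<inter> T m"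
          using H \<eta> Suc.prems(8)[OF True True] by auto
        ultimately have "(\<forall>i\<in>K. (H \<union> \<eta>) \<inter> J i \<noteq> \<phi> i ((H \<union> \<eta>) \<inter> T i)) \<longleftrightarrow> ?P H \<and> \<eta> \<noteq> \<phi> m (H \<inter> T m)"
          using True by (metis Diff_iff insertE insertCI empty_iff)
        then show ?thesis by (simp only: of_bool_conj)
      qed
      have "bexp (J m) pr (\<lambda>\<eta>. of_bool (\<forall>i\<in>K. (H \<union> \<eta>) \<inter> J i \<noteq> \<phi> i ((H \<union> \<eta>) \<inter> T i))) =
          of_bool (?P H) * bexp (J m) pr (\<lambda>\<eta>. of_bool (\<eta> \<noteq> \<phi> m (H \<inter> T m)))"
        unfolding bexp_cmult[symmetric] by (intro bexp_cong eq refl)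
      also have "\<dots> \<le> of_bool (?P H) * (1 - q ^ c)"
        using Suc.prems(3,4) Suc.prems(6)[OF True] Jm sp by (intro mult_left_mono bexp_point[where q = q]) auto
      finally show "bexp (J m) pr (\<lambda>\<eta>. of_bool (\<forall>i\<in>K. (H \<union> \<eta>) \<inter> J i \<noteq> \<phi> i ((H \<union> \<eta>) \<inter> T i))) \<le> (1 - q ^ c) * of_bool (?P H)"
        by (simp only: mult.commute)
    qed
    also have "\<dots> \<le> (1 - q ^ c) * (1 - q ^ c) ^ card ?K"
      unfolding bexp_cmult
    proof (intro mult_left_mono qc Suc.IH K)
      fix i assume i: "i \<in> ?K"
      then have "J i \<inter> J m = {}" using Suc.prems(7)[of i m] True K by auto
      then show "J i \<subseteq> ?U \<and> card (J i) \<le> c \<and> (\<forall>\<gamma>. \<phi> i \<gamma> \<subseteq> J i)" using Suc.prems(6)[of i] i by auto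
    qed (use Suc.prems sp in auto)
    also have "\<dots> = (1 - q ^ c) ^ card K"
    proof -
      have "finite K" using Suc.prems(5) finite_subset by blast
      then show ?thesis using True by (subst card.remove[of K m]) simp_all
    qed
    finally show ?thesis .
  qed
qed simp

section \<open>Parities of random sets\<close>

lemma bexp_parity:
  assumes "finite L"
  shows "pexp p L (\<lambda>\<nu>. g (odd (card \<nu>))) =
    (1 - (1 - 2 * p) ^ card L) / 2 * g True + (1 + (1 - 2 * p) ^ card L) / 2 * g False"
  using assms
proof (induction L arbitrary: g rule: finite_induct)
  case (insert x L)
  have "pexp p L (\<lambda>\<nu>. g (odd (card (insert x \<nu>)))) = pexp p L (\<lambda>\<nu>. (\<lambda>b. g (\<not> b)) (odd (card \<nu>)))"
  proof (intro bexp_cong refl)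
    fix \<nu> assume "\<nu> \<subseteq> L"
    then have "finite \<nu>" "x \<notin> \<nu>" using insert.hyps finite_subset by auto
    then show "g (odd (card (insert x \<nu>))) = (\<lambda>b. g (\<not> b)) (odd (card \<nu>))" by simp
  qed
  also have "\<dots> = (1 - (1 - 2 * p) ^ card L) / 2 * g False + (1 + (1 - 2 * p) ^ card L) / 2 * g True"
    by (subst insert.IH) simp
  finally have "pexp p (insert x L) (\<lambda>\<nu>. g (odd (card \<nu>))) =
      p * ((1 - (1 - 2 * p) ^ card L) / 2 * g False + (1 + (1 - 2 * p) ^ card L) / 2 * g True) +
      (1 - p) * ((1 - (1 - 2 * p) ^ card L) / 2 * g True + (1 + (1 - 2 * p) ^ card L) / 2 * g False)"
    unfolding bexp_insert[OF insert.hyps] by (simp only: insert.IH[of g])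
  then show ?case using insert.hyps by (simp add: field_simps)
qed simp

lemma bexp_parity_le:
  assumes "finite L" "y \<notin> L" "0 \<le> g True" "0 \<le> g False"
  shows "pexp p (bip L {y}) (\<lambda>F. g (oddnb F y L)) \<le>
    (1 + \<bar>1 - 2 * p\<bar> ^ card L) / 2 * (g True + g False)"
proof -
  have "pexp p (bip L {y}) (\<lambda>F. g (oddnb F y L)) =
      pexp p L (\<lambda>\<nu>. g (oddnb ((\<lambda>x. {y, x}) ` \<nu>) y L))"
    unfolding bip_commute[of L] bip_singleton using assms by (intro bexp_image inj_on_doubleton)
  also have "\<dots> = pexp p L (\<lambda>\<nu>. g (odd (card \<nu>)))"
  proof (intro bexp_cong refl)
    fix \<nu> assume "\<nu> \<subseteq> L"
    then have "{x \<in> L. {y, x} \<in> (\<lambda>x. {y, x}) ` \<nu>} = \<nu>" using assms(2) by (auto simp: doubleton_eq_iff)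
    then show "g (oddnb ((\<lambda>x. {y, x}) ` \<nu>) y L) = g (odd (card \<nu>))" by (simp add: oddnb_def)
  qed
  also have "\<dots> = (1 - (1 - 2 * p) ^ card L) / 2 * g True + (1 + (1 - 2 * p) ^ card L) / 2 * g False"
    by (rule bexp_parity[OF assms(1)])
  also have "\<dots> \<le> (1 + \<bar>1 - 2 * p\<bar> ^ card L) / 2 * g True + (1 + \<bar>1 - 2 * p\<bar> ^ card L) / 2 * g False"
  proof -
    have "(1 - x) / 2 \<le> (1 + y) / 2 \<and> (1 + x) / 2 \<le> (1 + y) / 2" if "\<bar>x\<bar> = y" for x y :: real
      using that by (auto simp: abs_if split: if_splits)
    note this[OF power_abs[of "1 - 2 * p" "card L"]]
    from this[THEN conjunct1] this[THEN conjunct2] show ?thesis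
      by (intro add_mono mult_right_mono assms(3,4))
  qed
  finally show ?thesis by (simp only: distrib_left)
qed

text \<open>The parities of different \<open>y\<close> depend on disjoint sets of edges, and each
  takes either value with probability at most
  \<open>(1 + \<bar>1 - 2 * p\<bar> ^ card L) / 2\<close>. The offsets \<open>c\<close>, which may
  come from any other edges, disappear from the bound.\<close>

lemma bexp_nearly_fair:
  assumes "finite U" "finite L" "U \<inter> L = {}" "0 \<le> p" "p \<le> 1" "\<And>A. 0 \<le> f A"
  shows "pexp p (bip L U) (\<lambda>F. f {y \<in> U. oddnb F y L \<noteq> c y}) \<le>
    (1 + \<bar>1 - 2 * p\<bar> ^ card L) ^ card U * bexp U (\<lambda>_. 1 / 2) f"
  using assms
proof (induction U arbitrary: f rule: finite_induct)
  case (insert y U)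
  let ?\<epsilon> = "\<bar>1 - 2 * p\<bar> ^ card L"
  let ?A = "\<lambda>F. {y \<in> U. oddnb F y L \<noteq> c y}"
  let ?g = "\<lambda>F b. f (if b \<noteq> c y then insert y (?A F) else ?A F)"
  have sp: "spread 0 J (\<lambda>_. p)" for J :: "'a set set" using assms(4,5) by (simp add: spread_def)
  have yL: "y \<notin> L" "U \<inter> L = {}" using insert.prems by auto
  have "pexp p (bip L (insert y U)) (\<lambda>F. f {y' \<in> insert y U. oddnb F y' L \<noteq> c y'}) =
      pexp p (bip L U) (\<lambda>F. pexp p (bip L {y})
        (\<lambda>F'. f {y' \<in> insert y U. oddnb (F \<union> F') y' L \<noteq> c y'}))"
  proof -
    have "bip L (insert y U) = bip L U \<union> bip L {y}" by (auto simp: bip_def)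
    moreover have "bip L U \<inter> bip L {y} = {}"
      using insert.hyps yL by (auto simp: bip_def doubleton_eq_iff)
    ultimately show ?thesis using insert.hyps insert.prems by (simp add: bexp_union)
  qed
  also have "\<dots> = pexp p (bip L U) (\<lambda>F. pexp p (bip L {y}) (\<lambda>F'. ?g F (oddnb F' y L)))"
  proof (intro bexp_cong refl arg_cong[of _ _ f])
    fix F F' assume F: "F \<subseteq> bip L U" and F': "F' \<subseteq> bip L {y}"
    have "{y, x} \<notin> F" if "x \<in> L" for x
      using F that yL insert.hyps doubleton_in_bip[of y x L U] by blast
    then have "oddnb (F \<union> F') y L \<longleftrightarrow> oddnb F' y L" by (intro oddnb_cong) auto
    moreover have "oddnb (F \<union> F') y' L \<longleftrightarrow> oddnb F y' L" if y': "y' \<in> U" for y'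
    proof (rule oddnb_cong)
      fix x assume "x \<in> L"
      then have "{y', x} \<notin> F'" using F' y' yL insert.hyps doubleton_in_bip[of y' x L "{y}"] by blast
      then show "{y', x} \<in> F \<union> F' \<longleftrightarrow> {y', x} \<in> F" by simp
    qed
    ultimately show "{y' \<in> insert y U. oddnb (F \<union> F') y' L \<noteq> c y'} =
        (if oddnb F' y L \<noteq> c y then insert y (?A F) else ?A F)"
      by auto
  qed
  also have "\<dots> \<le> pexp p (bip L U) (\<lambda>F. (1 + ?\<epsilon>) / 2 * (f (insert y (?A F)) + f (?A F)))"
  proof (rule bexp_mono[OF sp])
    fix F
    have "pexp p (bip L {y}) (\<lambda>F'. ?g F (oddnb F' y L)) \<le> (1 + ?\<epsilon>) / 2 * (?g F True + ?g F False)"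
      using insert.prems yL by (intro bexp_parity_le) auto
    also have "?g F True + ?g F False = f (insert y (?A F)) + f (?A F)" by simp
    finally show "pexp p (bip L {y}) (\<lambda>F'. ?g F (oddnb F' y L)) \<le> (1 + ?\<epsilon>) / 2 * (f (insert y (?A F)) + f (?A F))" .
  qed
  also have "\<dots> = (1 + ?\<epsilon>) / 2 * pexp p (bip L U) (\<lambda>F. (\<lambda>A. f (insert y A) + f A) (?A F))"
    by (simp only: bexp_cmult)
  also have "\<dots> \<le> (1 + ?\<epsilon>) / 2 * ((1 + ?\<epsilon>) ^ card U * bexp U (\<lambda>_. 1 / 2) (\<lambda>A. f (insert y A) + f A))"
    using insert.prems yL by (intro mult_left_mono insert.IH) auto
  also have "\<dots> = (1 + ?\<epsilon>) ^ card (insert y U) * bexp (insert y U) (\<lambda>_. 1 / 2) f"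
  proof -
    have "a / 2 * (b * (x + y)) = (a * b) * (1 / 2 * x + (1 - 1 / 2) * y)" for a b x y :: real
      by (simp add: algebra_simps)
    then show ?thesis
      unfolding bexp_insert[OF insert.hyps] bexp_add using insert.hyps by simp
  qed
  finally show ?case .
qed simp

section \<open>Windows and cuts\<close>

lemma stage_bad_cong:
  assumes "\<And>x. x \<in> W \<union> \<Union>(set Us) \<Longrightarrow> a x = a' x"
    and "\<And>x y. x \<in> W \<union> \<Union>(set Us) \<Longrightarrow> y \<in> W \<union> \<Union>(set Us) \<Longrightarrow> x \<noteq> y \<Longrightarrow> {x, y} \<in> E \<longleftrightarrow> {x, y} \<in> E'"
  shows "stage_bad t E a W Us j \<longleftrightarrow> stage_bad t E' a' W Us j"
proof -
  have "absorbable E a (W \<union> \<Union>(set (take (Suc j) Us)) - R') \<longleftrightarrow>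
      absorbable E' a' (W \<union> \<Union>(set (take (Suc j) Us)) - R')" for R'
    using assms set_take_subset[of "Suc j" Us] by (intro absorbable_cong) blast+
  then show ?thesis unfolding stage_bad_def by simp
qed

lemma ball_image: "(\<forall>j\<in>f ` K. P j) \<longleftrightarrow> (\<forall>i\<in>K. P (f i))"
  by blast

lemma pdisj_append: "pdisj (Us @ Ws) \<longleftrightarrow> pdisj Us \<and> pdisj Ws \<and> \<Union>(set Us) \<inter> \<Union>(set Ws) = {}"
  by (induction Us) auto

lemma pdisj_rev: "pdisj (rev Us) \<longleftrightarrow> pdisj Us"
  by (induction Us) (auto simp: pdisj_append)

lemma pdisj_nth: "pdisj Us \<Longrightarrow> i < j \<Longrightarrow> j < length Us \<Longrightarrow> Us ! i \<inter> Us ! j = {}"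
proof (induction Us arbitrary: i j)
  case (Cons D Us)
  then obtain j' where j: "j = Suc j'" by (cases j) auto
  have "Us ! j' \<subseteq> \<Union>(set Us)" using Cons.prems j nth_mem[of j' Us] by auto
  then show ?case using Cons j by (cases i) auto
qed simp

lemma Union_take_nth: "\<Union>(set (take k Us)) = (\<Union>i\<in>{..<min k (length Us)}. Us ! i)"
  by (force simp: set_conv_nth)

text \<open>\<open>A\<close> is the revealed set, \<open>u\<close> and \<open>v\<close> are the final two vertices, \<open>b\<close> is the last vertex
  processed before them, and the rest is split into the windows \<open>Ds\<close> and a large set \<open>L\<close>, whose
  edges to the windows make the parities there nearly fair.\<close>

locale windows =
  fixes A L :: "'a set" and Ds :: "'a set list" and u v b :: 'a and EA :: "'a set set"
    and p q :: real and t \<tau> M len N :: nat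
  assumes finA: "finite A" and finL: "finite L"
    and pd: "pdisj Ds" and Ds: "\<And>D. D \<in> set Ds \<Longrightarrow> finite D \<and> card D = len" and lenDs: "length Ds = 2 * N"
    and disj: "A \<inter> L = {}" "(A \<union> L) \<inter> \<Union>(set Ds) = {}"
      "u \<notin> A \<union> L \<union> \<Union>(set Ds)" "v \<notin> A \<union> L \<union> \<Union>(set Ds)" "b \<notin> A \<union> L \<union> \<Union>(set Ds)"
      "u \<noteq> v" "u \<noteq> b" "v \<noteq> b"
    and q: "0 < q" "q \<le> p" "p \<le> 1 - q" and t\<tau>: "t \<le> \<tau>"
begin

definition "U = \<Union>(set Ds)"
definition "X = A \<union> L \<union> U \<union> {b}"
definition "V = X \<union> {u, v}"
definition "I = nsets (V - A) 2"
text \<open>The random pairs without those from \<open>u\<close> to the windows, which are kept for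
  the patterns. Pairs meeting \<open>A\<close> belong to neither \<open>I\<close> nor
  \<open>J\<close>; their edges are fixed in \<open>EA\<close>.\<close>

definition "J = I - bip {u} U"

text \<open>The degrees are taken in \<open>X\<close>, which omits \<open>u\<close> and
  \<open>v\<close>; so this event ignores the edges kept for the patterns.\<close>

definition top_bad :: "nat \<Rightarrow> 'a set set \<Rightarrow> bool" where
  "top_bad i E \<longleftrightarrow> stage_bad t E (\<lambda>y. oddnb E y (X - {y})) {} Ds (2 * i)"

text \<open>The window \<open>rev Ds ! (2 * N - 2 - 2 * i)\<close> is
  \<open>Ds ! (2 * i + 1)\<close>, so the two parts of cut \<open>i\<close> together exhaust the
  windows. From the back, \<open>b\<close> is the first vertex in place, whence the initial
  parities, and \<open>A \<union> L\<close> precedes all windows.\<close>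

definition bot_bad :: "nat \<Rightarrow> 'a set set \<Rightarrow> bool" where
  "bot_bad i E \<longleftrightarrow> stage_bad t E (\<lambda>y. {b, y} \<in> E) (A \<union> L) (rev Ds) (2 * N - 2 - 2 * i)"

lemma finU [simp]: "finite U" using Ds by (auto simp: U_def)
lemma finX [simp]: "finite X" using finA finL by (simp add: X_def)
lemma finV [simp]: "finite V" by (simp add: V_def)
lemma finI [simp]: "finite I" by (simp add: I_def)
lemma finJ [simp]: "finite J" by (simp add: J_def)

lemma spread_const: "spread 0 S (\<lambda>_. p)"
  using q by (simp add: spread_def)

lemma disjU: "A \<inter> U = {}" "L \<inter> U = {}" "u \<notin> U" "v \<notin> U" "b \<notin> U"
  using disj by (auto simp: U_def)

lemma uvX: "u \<notin> X" "v \<notin> X" using disj by (auto simp: X_def U_def)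

lemma nsets_subset_J: "S \<subseteq> V - A \<Longrightarrow> u \<notin> S \<Longrightarrow> nsets S 2 \<subseteq> J"
  unfolding J_def I_def by (auto simp: bip_def nsets_def)

text \<open>The initial parities are degrees and thus also count edges inside the windows, which
  have to be unseen for the absorption. The edges to \<open>L\<close> decouple the two: given all
  else, the parities are dominated by twice a fair product measure.\<close>

lemma top_bound:
  assumes fair: "(1 + \<bar>1 - 2 * p\<bar> ^ card L) ^ card U \<le> 2"
    and err: "stage_err q M \<tau> len t \<le> \<eta>" "\<eta> \<le> 1" "stage_err q M \<tau> len \<tau> \<le> \<epsilon>"
    and K: "K \<subseteq> {..<N}" and EA: "EA \<inter> I = {}"
  shows "pexp p J (\<lambda>H. of_bool (\<forall>i\<in>K. top_bad i (EA \<union> H))) \<le> 2 * (\<eta> ^ card K + real (2 * N) * \<epsilon>)"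
proof (rule bexp_split_le)
  have "bip L U \<union> nsets U 2 \<subseteq> nsets (L \<union> U) 2"
    using disjU nsets_Un[of L U] by auto
  also have "\<dots> \<subseteq> J"
    using disj disjU by (intro nsets_subset_J) (auto simp: V_def X_def)
  finally show sub: "bip L U \<union> nsets U 2 \<subseteq> J" .
  fix H2 assume H2: "H2 \<subseteq> J - (bip L U \<union> nsets U 2)"
  let ?E = "EA \<union> H2"
  let ?B = "2 * (\<eta> ^ card K + real (2 * N) * \<epsilon>)"
  \<comment> \<open>The part of the degree that does not come from \<open>L\<close>. It depends on
    the edges \<open>E'\<close> inside \<open>U\<close>, and this dependence is lost in the passage
    to fair parities.\<close>
  let ?c = "\<lambda>E' y. oddnb ?E y (A \<union> {b}) \<noteq> oddnb E' y (U - {y})"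
  let ?\<Phi> = "\<lambda>E' Z. of_bool (\<forall>i\<in>K. stage_bad t E' (\<lambda>y. y \<in> Z) {} Ds (2 * i)) :: real"
  have E: "?E \<inter> (bip L U \<union> nsets U 2) = {}" using EA H2 sub by (auto simp: J_def)
  have bN: "bip L U \<inter> nsets U 2 = {}" using disjU by (intro bip_Int_nsets)
  have eq: "of_bool (\<forall>i\<in>K. top_bad i (EA \<union> ((F \<union> E') \<union> H2))) = ?\<Phi> E' {y \<in> U. oddnb F y L \<noteq> ?c E' y}"
    if F: "F \<subseteq> bip L U" and E': "E' \<subseteq> nsets U 2" for F E'
  proof -
    let ?G = "EA \<union> ((F \<union> E') \<union> H2)"
    have "top_bad i ?G \<longleftrightarrow> stage_bad t E' (\<lambda>y. y \<in> {y \<in> U. oddnb F y L \<noteq> ?c E' y}) {} Ds (2 * i)" for i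
      unfolding top_bad_def
    proof (rule stage_bad_cong)
      fix y assume "y \<in> {} \<union> \<Union>(set Ds)"
      then have y: "y \<in> U" by (simp add: U_def)
      have "X - {y} = (A \<union> {b}) \<union> (L \<union> (U - {y}))" using y disj disjU by (auto simp: X_def)
      moreover have "(A \<union> {b}) \<inter> (L \<union> (U - {y})) = {}" "L \<inter> (U - {y}) = {}"
        using disj disjU by (auto simp: U_def)
      ultimately have "oddnb ?G y (X - {y}) \<longleftrightarrow> oddnb ?G y (A \<union> {b}) \<noteq> (oddnb ?G y L \<noteq> oddnb ?G y (U - {y}))"
        using finA finL
        by (simp only: oddnb_Un[of "A \<union> {b}" "L \<union> (U - {y})"] oddnb_Un[of L "U - {y}"]
          finite_Un finite_insert finite.emptyI finite_Diff finU simp_thms)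
      moreover have "oddnb ?G y (A \<union> {b}) \<longleftrightarrow> oddnb ?E y (A \<union> {b})"
      proof (rule oddnb_cong)
        fix x assume "x \<in> A \<union> {b}"
        then have "x \<notin> L \<union> U" using disj disjU by auto
        then have "{y, x} \<notin> F" "{y, x} \<notin> E'"
          using F E' y disjU doubleton_in_bip[of y x L U] doubleton_in_nsets_2[of y x U] by blast+
        then show "{y, x} \<in> ?G \<longleftrightarrow> {y, x} \<in> ?E" by blast
      qed
      moreover have "oddnb ?G y L \<longleftrightarrow> oddnb F y L"
      proof (rule oddnb_cong)
        fix x assume x: "x \<in> L"
        then have "{y, x} \<notin> E'" "{y, x} \<notin> ?E"
          using E E' y disjU doubleton_in_bip[of y x L U] doubleton_in_nsets_2[of y x U] by blast+
        then show "{y, x} \<in> ?G \<longleftrightarrow> {y, x} \<in> F" by blast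
      qed
      moreover have "oddnb ?G y (U - {y}) \<longleftrightarrow> oddnb E' y (U - {y})"
      proof (rule oddnb_cong)
        fix x assume x: "x \<in> U - {y}"
        then have "{y, x} \<notin> F" "{y, x} \<notin> ?E"
          using E F y disjU doubleton_in_bip[of y x L U] doubleton_in_nsets_2[of y x U] by blast+
        then show "{y, x} \<in> ?G \<longleftrightarrow> {y, x} \<in> E'" by blast
      qed
      ultimately show "oddnb ?G y (X - {y}) = (y \<in> {y \<in> U. oddnb F y L \<noteq> ?c E' y})"
        using y by auto
    next
      fix x y assume "x \<in> {} \<union> \<Union>(set Ds)" "y \<in> {} \<union> \<Union>(set Ds)" "x \<noteq> y"
      then have "x \<in> U" "y \<in> U" "x \<noteq> y" by (auto simp: U_def)
      then have "{x, y} \<notin> F" "{x, y} \<notin> ?E"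
        using E F disjU doubleton_in_bip[of x y L U] doubleton_in_nsets_2[of x y U] by blast+
      then show "{x, y} \<in> ?G \<longleftrightarrow> {x, y} \<in> E'" by blast
    qed
    then show ?thesis by presburger
  qed
  have "pexp p (bip L U \<union> nsets U 2) (\<lambda>H. of_bool (\<forall>i\<in>K. top_bad i (EA \<union> (H \<union> H2)))) =
     pexp p (bip L U) (\<lambda>F. pexp p (nsets U 2)
       (\<lambda>E'. of_bool (\<forall>i\<in>K. top_bad i (EA \<union> ((F \<union> E') \<union> H2)))))"
    using finL bN by (intro bexp_union) auto
  also have "\<dots> = pexp p (bip L U) (\<lambda>F. pexp p (nsets U 2)
       (\<lambda>E'. ?\<Phi> E' {y \<in> U. oddnb F y L \<noteq> ?c E' y}))"
    by (intro bexp_cong eq refl)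
  also have "\<dots> = pexp p (nsets U 2) (\<lambda>E'. pexp p (bip L U)
       (\<lambda>F. ?\<Phi> E' {y \<in> U. oddnb F y L \<noteq> ?c E' y}))"
    by (rule bexp_swap)
  also have "\<dots> \<le> pexp p (nsets U 2) (\<lambda>E'. 2 * bexp U (\<lambda>_. 1 / 2) (?\<Phi> E'))"
  proof (rule bexp_mono[OF spread_const])
    fix E'
    have "pexp p (bip L U) (\<lambda>F. ?\<Phi> E' {y \<in> U. oddnb F y L \<noteq> ?c E' y}) \<le>
        (1 + \<bar>1 - 2 * p\<bar> ^ card L) ^ card U * bexp U (\<lambda>_. 1 / 2) (?\<Phi> E')"
      by (rule bexp_nearly_fair) (use finL disjU q in auto)
    also have "\<dots> \<le> 2 * bexp U (\<lambda>_. 1 / 2) (?\<Phi> E')"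
      using fair by (intro mult_right_mono bexp_nonneg) (auto simp: spread_def)
    finally show "pexp p (bip L U) (\<lambda>F. ?\<Phi> E' {y \<in> U. oddnb F y L \<noteq> ?c E' y}) \<le> 2 * bexp U (\<lambda>_. 1 / 2) (?\<Phi> E')" .
  qed
  also have "\<dots> = 2 * bexp U (\<lambda>_. 1 / 2) (\<lambda>Z. pexp p (nsets U 2) (\<lambda>E'. ?\<Phi> E' Z))"
    by (simp only: bexp_cmult bexp_swap[of "nsets U 2"])
  also have "bexp U (\<lambda>_. 1 / 2) (\<lambda>Z. pexp p (nsets U 2) (\<lambda>E'. ?\<Phi> E' Z)) =
      bexp U (\<lambda>_. 1 / 2) (\<lambda>Z. pexp p (pairs_into {} U) (\<lambda>F.
        of_bool (\<forall>j\<in>(*) 2 ` K. stage_bad t ({} \<union> F) (\<lambda>y. if y \<in> U then y \<in> Z else False) {} Ds j)))"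
  proof (intro bexp_cong refl)
    fix Z assume "Z \<subseteq> U"
    then have "(\<lambda>y. if y \<in> U then y \<in> Z else False) = (\<lambda>y. y \<in> Z)" by auto
    then show "pexp p (nsets U 2) (\<lambda>E'. ?\<Phi> E' Z) = pexp p (pairs_into {} U) (\<lambda>F.
        of_bool (\<forall>j\<in>(*) 2 ` K. stage_bad t ({} \<union> F) (\<lambda>y. if y \<in> U then y \<in> Z else False) {} Ds j))"
      by (simp only: pairs_into_empty Un_empty_left ball_image)
  qed
  also have "\<dots> \<le> \<eta> ^ card ((*) 2 ` K) + real (length Ds) * \<epsilon>"
    by (rule stage_chain[where M = M and \<tau> = \<tau> and q = q and L = len])
       (use q err t\<tau> pd Ds K lenDs in \<open>auto simp: U_def spread_def\<close>)
  also have "card ((*) 2 ` K) = card K" by (intro card_image) (auto simp: inj_on_def)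
  finally show "pexp p (bip L U \<union> nsets U 2) (\<lambda>H. of_bool (\<forall>i\<in>K. top_bad i (EA \<union> (H \<union> H2)))) \<le> ?B"
    using lenDs by simp
qed (auto simp: spread_const)

text \<open>The set \<open>A\<close> is absorbed first with the help of \<open>L\<close>, using the
  \<open>M0\<close> known neighbours there; this costs \<open>\<epsilon>\<^sub>0\<close> once. Then
  \<open>stage_transition\<close>, with \<open>A \<union> L\<close> for \<open>W\<close> and
  \<open>L\<close> for \<open>W'\<close>, passes at most \<open>\<tau>\<close> leftovers in
  \<open>L\<close> on to the windows. The initial parities on \<open>L\<close> and on the windows
  are edges at \<open>b\<close>, hence independent from the start.\<close>

lemma bot_bound:
  assumes err: "stage_err q M \<tau> len t \<le> \<eta>" "\<eta> \<le> 1" "stage_err q M \<tau> len \<tau> \<le> \<epsilon>"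
    and err0: "(\<Sum>i<card A. (1 - q) ^ (M0 - i)) + (\<Sum>s\<in>{\<tau><..card L}. (1 - q) ^ s) \<le> \<epsilon>\<^sub>0"
    and K: "K \<subseteq> {..<N}" and EA: "EA \<inter> I = {}"
    and rows: "\<And>r. r \<in> A \<Longrightarrow> M0 \<le> card {d \<in> L. {r, d} \<in> EA}"
  shows "pexp p J (\<lambda>H. of_bool (\<forall>i\<in>K. bot_bad i (EA \<union> H))) \<le> \<epsilon>\<^sub>0 + (\<eta> ^ card K + real (2 * N) * \<epsilon>)"
proof -
  let ?J = "(bip {b} L \<union> nsets L 2) \<union> (bip {b} U \<union> pairs_into L U)"
  let ?B = "\<eta> ^ card K + real (2 * N) * \<epsilon>"
  show ?thesis
  proof (rule bexp_split_le)
    have "?J \<subseteq> nsets ({b} \<union> (L \<union> U)) 2"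
      using disj disjU nsets_Un[of L U] nsets_Un[of "{b}" "L \<union> U"] bip_Un_right[of "{b}" L U]
      by (auto simp: pairs_into_def)
    also have "\<dots> \<subseteq> J"
      using disj disjU by (intro nsets_subset_J) (auto simp: V_def X_def)
    finally show sub: "?J \<subseteq> J" .
    fix H2 assume H2: "H2 \<subseteq> J - ?J"
    let ?E = "EA \<union> H2"
    have E: "?E \<inter> ?J = {}" using EA H2 sub by (auto simp: J_def)
    have bL: "b \<notin> L" "L \<inter> U = {}" "b \<notin> U" using disj disjU by auto
    define jj where "jj = (\<lambda>i. 2 * N - 2 - 2 * i)"
    define aL where "aL = (\<lambda>ZL y. if y \<in> L then y \<in> ZL else {b, y} \<in> ?E)"
    let ?\<Phi> = "\<lambda>ZL FL Z F. of_bool (\<forall>j\<in>jj ` K. stage_bad t ((?E \<union> FL) \<union> F)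
        (\<lambda>y. if y \<in> U then y \<in> Z else aL ZL y) (A \<union> L) (rev Ds) j) :: real"
    let ?row = "\<lambda>Z. (\<lambda>y. {b, y}) ` Z"
    have eq: "of_bool (\<forall>i\<in>K. bot_bad i (EA \<union> ((?row ZL \<union> FL) \<union> (?row Z \<union> F) \<union> H2))) = ?\<Phi> ZL FL Z F"
      if s: "ZL \<subseteq> L" "FL \<subseteq> nsets L 2" "Z \<subseteq> U" "F \<subseteq> pairs_into L U" for ZL FL Z F
    proof -
      let ?G = "EA \<union> ((?row ZL \<union> FL) \<union> (?row Z \<union> F) \<union> H2)"
      have nb: "{b, y} \<notin> FL" "{b, y} \<notin> F" for y
        using s bL doubleton_in_nsets_2[of b y L] doubleton_in_pairs_into[of b y L U] by blast+
      have "bot_bad i ?G \<longleftrightarrow> stage_bad t ((?E \<union> FL) \<union> F)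
        (\<lambda>y. if y \<in> U then y \<in> Z else aL ZL y) (A \<union> L) (rev Ds) (jj i)" for i
        unfolding bot_bad_def jj_def
      proof (rule stage_bad_cong)
        fix y assume "y \<in> (A \<union> L) \<union> \<Union>(set (rev Ds))"
        then have y: "y \<in> A \<union> L \<union> U" by (auto simp: U_def)
        then have "y \<noteq> b" using disj disjU by auto
        then have "{b, y} \<in> ?G \<longleftrightarrow> y \<in> ZL \<or> y \<in> Z \<or> {b, y} \<in> ?E"
          using nb[of y] by (auto simp: doubleton_eq_iff)
        moreover have "{b, y} \<notin> ?E" if "y \<in> L \<union> U"
          using E that doubleton_in_bip[of b y "{b}"] by blast
        ultimately show "({b, y} \<in> ?G) = (if y \<in> U then y \<in> Z else aL ZL y)"
          using s y bL by (auto simp: aL_def)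
      next
        fix x y assume "x \<in> (A \<union> L) \<union> \<Union>(set (rev Ds))" "y \<in> (A \<union> L) \<union> \<Union>(set (rev Ds))"
        then have "x \<noteq> b" "y \<noteq> b" using disj by auto
        then show "{x, y} \<in> ?G \<longleftrightarrow> {x, y} \<in> (?E \<union> FL) \<union> F" by (auto simp: doubleton_eq_iff)
      qed
      then show ?thesis by (simp only: ball_image)
    qed
    have inner: "pexp p U (\<lambda>Z. pexp p (pairs_into L U) (\<lambda>F. ?\<Phi> ZL FL Z F)) \<le>
        of_bool (\<not> (\<exists>R'\<subseteq>L. card R' \<le> \<tau> \<and> absorbable (?E \<union> FL) (aL ZL) (A \<union> L - R'))) + ?B"
      if s: "ZL \<subseteq> L" "FL \<subseteq> nsets L 2" for ZL FL
    proof (cases "\<exists>R'\<subseteq>L. card R' \<le> \<tau> \<and> absorbable (?E \<union> FL) (aL ZL) (A \<union> L - R')")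
      case True
      then obtain R' where R': "R' \<subseteq> L" "card R' \<le> \<tau>" and ab: "absorbable (?E \<union> FL) (aL ZL) (A \<union> L - R')" by blast
      have revU: "\<Union>(set (rev Ds)) = U" by (simp add: U_def)
      have jK: "jj ` K \<subseteq> {..<length (rev Ds)}" using K lenDs by (auto simp: jj_def)
      have "inj_on jj K"
      proof (rule inj_onI)
        fix i i' assume "i \<in> K" "i' \<in> K" and "jj i = jj i'"
        then have "i < N" "i' < N" "2 * N - 2 - 2 * i = 2 * N - 2 - 2 * i'" using K by (auto simp: jj_def)
        then show "i = i'" by arith
      qed
      then have cK: "card (jj ` K) = card K" by (rule card_image)
      have "nsets L 2 \<inter> pairs_into R' U = {}"
        using bL R' by (auto simp: pairs_into_def bip_def nsets_2_eq doubleton_eq_iff)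
      then have dF: "(?E \<union> FL) \<inter> pairs_into R' U = {}"
        using E s(2) pairs_into_mono[OF R'(1), of U] by blast
      have "pexp p U (\<lambda>Z. pexp p (pairs_into L U) (\<lambda>F. ?\<Phi> ZL FL Z F)) \<le> ?B"
      proof (rule stage_transition[where R' = R' and W' = L, OF _ _ _ revU R'(1) _ ab dF _ _ _ _ jK])
        fix pr' E0' a'
        assume sp: "spread q U pr'" and dj: "E0' \<inter> pairs_into R' U = {}"
        have "bexp U pr' (\<lambda>Z. pexp p (pairs_into R' U) (\<lambda>F.
          of_bool (\<forall>j\<in>jj ` K. stage_bad t (E0' \<union> F) (\<lambda>y. if y \<in> U then y \<in> Z else a' y) R' (rev Ds) j)))
          \<le> \<eta> ^ card (jj ` K) + real (length (rev Ds)) * \<epsilon>"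
          by (rule stage_chain[where M = M and \<tau> = \<tau> and q = q and L = len])
             (use q err t\<tau> pd Ds jK R' finL bL sp dj revU in \<open>auto simp: pdisj_rev intro: finite_subset\<close>)
        then show "bexp U pr' (\<lambda>Z. pexp p (pairs_into R' U) (\<lambda>F.
          of_bool (\<forall>j\<in>jj ` K. stage_bad t (E0' \<union> F) (\<lambda>y. if y \<in> U then y \<in> Z else a' y) R' (rev Ds) j))) \<le> ?B"
          using cK lenDs by simp
      qed (use q finA finL disjU in \<open>auto simp: spread_def\<close>)
      moreover have "(0::real) \<le> of_bool (\<not> (\<exists>R'\<subseteq>L. card R' \<le> \<tau> \<and> absorbable (?E \<union> FL) (aL ZL) (A \<union> L - R')))"
        by simp
      ultimately show ?thesis by linarith
    next
      case False
      have "0 \<le> stage_err q M \<tau> len s" for s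
        unfolding stage_err_def using q by (intro add_nonneg_nonneg sum_nonneg mult_nonneg_nonneg) auto
      then have "0 \<le> \<eta>" "0 \<le> \<epsilon>" using err(1,3) order_trans by blast+
      then have B0: "0 \<le> ?B" by simp
      have "pexp p U (\<lambda>Z. pexp p (pairs_into L U) (\<lambda>F. ?\<Phi> ZL FL Z F)) \<le> 1"
        using finL by (intro bexp_le spread_const) auto
      with B0 show ?thesis unfolding of_bool_1[OF False] by linarith
    qed
    have dJ: "(bip {b} L \<union> nsets L 2) \<inter> (bip {b} U \<union> pairs_into L U) = {}"
      "bip {b} L \<inter> nsets L 2 = {}" "bip {b} U \<inter> pairs_into L U = {}"
      using bL by (auto simp: pairs_into_def bip_def nsets_2_eq doubleton_eq_iff)
    have conv: "pexp p (bip {b} S \<union> P) f = pexp p S (\<lambda>Z. pexp p P (\<lambda>F. f (?row Z \<union> F)))"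
      if "finite S" "finite P" "b \<notin> S" "bip {b} S \<inter> P = {}" for S P f
    proof -
      have "pexp p (bip {b} S \<union> P) f = pexp p (bip {b} S) (\<lambda>Z. pexp p P (\<lambda>F. f (Z \<union> F)))"
        using that by (intro bexp_union) auto
      also have "\<dots> = pexp p S (\<lambda>Z. pexp p P (\<lambda>F. f (?row Z \<union> F)))"
        unfolding bip_singleton using that by (intro bexp_image inj_on_doubleton)
      finally show ?thesis .
    qed
    have "pexp p ?J (\<lambda>H. of_bool (\<forall>i\<in>K. bot_bad i (EA \<union> (H \<union> H2)))) =
        pexp p (bip {b} L \<union> nsets L 2) (\<lambda>H. pexp p (bip {b} U \<union> pairs_into L U)
          (\<lambda>H'. of_bool (\<forall>i\<in>K. bot_bad i (EA \<union> ((H \<union> H') \<union> H2)))))"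
      using finL dJ by (intro bexp_union) auto
    also have "\<dots> = pexp p L (\<lambda>ZL. pexp p (nsets L 2) (\<lambda>FL.
        pexp p U (\<lambda>Z. pexp p (pairs_into L U)
          (\<lambda>F. of_bool (\<forall>i\<in>K. bot_bad i (EA \<union> ((?row ZL \<union> FL) \<union> (?row Z \<union> F) \<union> H2)))))))"
      using finL bL dJ by (simp only: conv finU finite_nsets finite_pairs_into not_False_eq_True)
    also have "\<dots> = pexp p L (\<lambda>ZL. pexp p (nsets L 2) (\<lambda>FL.
        pexp p U (\<lambda>Z. pexp p (pairs_into L U) (\<lambda>F. ?\<Phi> ZL FL Z F))))"
      by (intro bexp_cong eq refl)
    also have "\<dots> \<le> pexp p L (\<lambda>ZL. pexp p (nsets L 2) (\<lambda>FL.
        of_bool (\<not> (\<exists>R'\<subseteq>L. card R' \<le> \<tau> \<and> absorbable (?E \<union> FL) (aL ZL) (A \<union> L - R'))) + ?B))"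
      by (intro bexp_mono spread_const inner)
    also have "\<dots> = pexp p L (\<lambda>ZL. pexp p (nsets L 2) (\<lambda>FL.
        of_bool (\<not> (\<exists>R'\<subseteq>L. card R' \<le> \<tau> \<and> absorbable (?E \<union> FL) (aL ZL) (A \<union> L - R'))))) + ?B"
      using finL by (simp only: bexp_add bexp_const finite_nsets)
    also have "\<dots> \<le> \<epsilon>\<^sub>0 + ?B"
    proof (rule add_right_mono)
      have "pexp p L (\<lambda>ZL. pexp p (nsets L 2) (\<lambda>FL.
        of_bool (\<not> (\<exists>R'\<subseteq>L. card R' \<le> \<tau> \<and> absorbable (?E \<union> FL) (\<lambda>y. if y \<in> L then y \<in> ZL else {b, y} \<in> ?E) (A \<union> L - R')))))
        \<le> (\<Sum>i<card A. (1 - q) ^ (M0 - i)) + (\<Sum>s\<in>{\<tau><..card L}. (1 - q) ^ s)"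
      proof (rule absorb_fixed_bound)
        fix r assume "r \<in> A"
        then have "M0 \<le> card {d \<in> L. {r, d} \<in> EA}" by (rule rows)
        also have "\<dots> \<le> card {d \<in> L. {r, d} \<in> ?E}" using finL by (intro card_mono) auto
        finally show "M0 \<le> card {d \<in> L. {r, d} \<in> ?E}" .
      qed (use finA finL disj q E in \<open>auto simp: spread_def\<close>)
      then show "pexp p L (\<lambda>ZL. pexp p (nsets L 2) (\<lambda>FL.
        of_bool (\<not> (\<exists>R'\<subseteq>L. card R' \<le> \<tau> \<and> absorbable (?E \<union> FL) (aL ZL) (A \<union> L - R'))))) \<le> \<epsilon>\<^sub>0"
        unfolding aL_def using err0 by linarith
    qed
    finally show "pexp p ?J (\<lambda>H. of_bool (\<forall>i\<in>K. bot_bad i (EA \<union> (H \<union> H2)))) \<le> \<epsilon>\<^sub>0 + ?B" .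
  qed (auto simp: spread_const)
qed

end

section \<open>From usable cuts to even-degeneracy\<close>

context windows
begin

text \<open>The parity condition says that the number of edges agrees with what the final pair would
  leave. It is a part of the event, so the random edges need not be conditioned on it.\<close>

definition stuck :: "'a set set \<Rightarrow> bool" where
  "stuck G \<longleftrightarrow> (odd (card G) \<longleftrightarrow> {u, v} \<in> G) \<and> \<not> even_degenerate V G"

text \<open>The witnesses are the union \<open>P\<close> of the leftovers on the two sides and the
  absorbed vertices \<open>T\<close> in front of the cut. The edges from \<open>u\<close> to the
  windows are left out of \<open>E\<close> and supplied by \<open>\<beta>\<close>.\<close>

lemma cut_exists:
  assumes i: "i < N" and "\<not> top_bad i E" "\<not> bot_bad i E" and E: "E \<subseteq> nsets V 2"
    and uE: "\<And>w. w \<in> U \<Longrightarrow> {u, w} \<notin> E"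
  shows "\<exists>P T \<phi>. P \<subseteq> Ds ! (2 * i) \<union> Ds ! (2 * i + 1) \<and> card P \<le> 2 * t \<and>
    T \<subseteq> \<Union>(set (take (2 * i + 1) Ds)) - P \<and> (\<forall>\<gamma>. \<phi> \<gamma> \<subseteq> P) \<and>
    (\<forall>\<beta>\<subseteq>U. \<beta> \<inter> P = \<phi> (\<beta> \<inter> T) \<longrightarrow> \<not> stuck (E \<union> (\<lambda>w. {u, w}) ` \<beta>))"
proof -
  let ?k = "2 * i + 1"
  let ?Up = "\<Union>(set (take ?k Ds))" and ?Lo = "\<Union>(set (drop ?k Ds))"
  have "pdisj (take ?k Ds @ drop ?k Ds)" "U = \<Union>(set (take ?k Ds @ drop ?k Ds))"
    using pd by (simp_all only: append_take_drop_id U_def)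
  then have UpLo: "?Up \<union> ?Lo = U" "?Up \<inter> ?Lo = {}"
    by (simp_all only: pdisj_append set_append Union_Un_distrib)
  have fin: "finite ?Up" "finite ?Lo" using UpLo(1) finU by (metis finite_Un)+
  obtain Rt where Rt: "Rt \<subseteq> Ds ! (2 * i)" "card Rt \<le> t"
    and abt: "absorbable E (\<lambda>y. oddnb E y (X - {y})) (?Up - Rt)"
    using assms(2) unfolding top_bad_def stage_bad_def by auto
  have rev1: "rev Ds ! (2 * N - 2 - 2 * i) = Ds ! (2 * i + 1)"
    using i lenDs by (subst rev_nth) (auto intro: arg_cong[of _ _ "nth Ds"])
  have rev2: "\<Union>(set (take (Suc (2 * N - 2 - 2 * i)) (rev Ds))) = ?Lo"
  proof -
    have "length Ds - Suc (2 * N - 2 - 2 * i) = ?k" using i lenDs by simp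
    then show ?thesis by (simp only: take_rev set_rev)
  qed
  obtain Rb where Rb: "Rb \<subseteq> Ds ! (2 * i + 1)" "card Rb \<le> t"
    and abb: "absorbable E (\<lambda>y. {b, y} \<in> E) (A \<union> L \<union> ?Lo - Rb)"
    using assms(3) unfolding bot_bad_def stage_bad_def rev1 rev2 by blast
  have RtU: "Rt \<subseteq> ?Up"
    using Rt(1) i lenDs nth_mem[of "2 * i" "take ?k Ds"] by auto
  have RbL: "Rb \<subseteq> ?Lo"
    using Rb(1) i lenDs nth_mem[of 0 "drop ?k Ds"] by auto
  obtain xs where xs: "distinct xs" "set xs = ?Up - Rt" "absorb E (\<lambda>y. oddnb E y (X - {y})) xs"
    using abt by (auto simp: absorbable_def)
  obtain ys where ys: "distinct ys" "set ys = A \<union> L \<union> ?Lo - Rb" "absorb E (\<lambda>y. {b, y} \<in> E) ys"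
    using abb by (auto simp: absorbable_def)
  let ?P = "Rt \<union> Rb"
  have finP: "finite ?P" using RtU RbL fin finite_subset by blast
  then obtain js where js: "set js = ?P" "distinct js" using finite_distinct_list by blast
  have dd: "distinct (xs @ js @ ys @ [b])"
    using xs(1) ys(1) js xs(2) ys(2) UpLo RtU RbL disj disjU by auto
  have X_eq: "X = set (xs @ js @ ys @ [b])"
    using js xs(2) ys(2) UpLo(1)[symmetric] RtU RbL by (auto simp: X_def)
  have "set xs \<union> set js \<subseteq> U" using xs(2) js(1) UpLo(1)[symmetric] RtU RbL by auto
  then have nu: "{u, w} \<notin> E" if "w \<in> set xs \<union> set js" for w
    using that uE by blast
  have "\<exists>\<phi>. (\<forall>\<gamma>. \<phi> \<gamma> \<subseteq> set js) \<and> (\<forall>\<beta>. \<beta> \<inter> set js = \<phi> (\<beta> \<inter> set xs) \<longrightarrow>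
    clears (E \<union> (\<lambda>w. {u, w}) ` \<beta>) {u, v} (xs @ js @ rev ys @ [b]))"
    by (rule cut_pattern[OF finX uvX dd X_eq xs(3) ys(3) nu])
  then obtain \<phi> where \<phi>: "\<And>\<gamma>. \<phi> \<gamma> \<subseteq> set js" and clear: "\<And>\<beta>. \<beta> \<inter> set js = \<phi> (\<beta> \<inter> set xs) \<Longrightarrow>
    clears (E \<union> (\<lambda>w. {u, w}) ` \<beta>) {u, v} (xs @ js @ rev ys @ [b])"
    by blast
  have "\<not> stuck (E \<union> (\<lambda>w. {u, w}) ` \<beta>)" if \<beta>: "\<beta> \<subseteq> U" "\<beta> \<inter> ?P = \<phi> (\<beta> \<inter> set xs)" for \<beta>
  proof
    let ?G = "E \<union> (\<lambda>w. {u, w}) ` \<beta>" and ?zs = "xs @ js @ rev ys @ [b]"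
    assume "stuck ?G"
    then have par: "odd (card ?G) \<longleftrightarrow> {u, v} \<in> ?G" and bad: "\<not> even_degenerate V ?G"
      by (auto simp: stuck_def)
    have G: "?G \<subseteq> nsets V 2" using E \<beta>(1) disjU by (auto simp: V_def X_def)
    then have G2: "?G \<subseteq> nsets UNIV 2" using nsets_mono[of V UNIV 2] by blast
    have sz: "set ?zs = X" using X_eq by auto
    have "induced_edges ?G V = ?G" using G by (auto simp: induced_edges_def nsets_def)
    moreover have "induced_edges ?G {u, v} = (if {u, v} \<in> ?G then {{u, v}} else {})"
    proof -
      have "e = {u, v}" if "e \<in> ?G" "e \<subseteq> {u, v}" for e
      proof -
        have "card e = 2" using that(1) G by (auto simp: nsets_def)
        then show ?thesis using that(2) disj(6) by (intro card_subset_eq) auto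
      qed
      then show ?thesis by (auto simp: induced_edges_def)
    qed
    ultimately have "odd_size ?G V \<longleftrightarrow> odd_size ?G {u, v}"
      using par by (simp add: odd_size_def)
    then have "odd_size ?G (set ?zs \<union> {u, v}) \<longleftrightarrow> odd_size ?G {u, v}"
      unfolding sz V_def .
    moreover have "clears ?G {u, v} ?zs" by (rule clear) (use js \<beta> in simp)
    moreover have "distinct ?zs" using dd by simp
    moreover have "set ?zs \<inter> {u, v} = {}" unfolding sz using uvX by auto
    ultimately obtain zs where "distinct zs" "set zs = X" "reduces ?G {u, v} zs"
      using reduces_if_clears[OF G2, of "{u, v}" ?zs] unfolding sz by auto
    then have "even_degenerate V ?G"
      using uvX disj(6) by (intro even_degenerate_if_reduces[of zs u v]) (auto simp: V_def)
    then show False using bad by simp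
  qed
  moreover have "card ?P \<le> 2 * t" using card_Un_le[of Rt Rb] Rt(2) Rb(2) by simp
  moreover have "set xs \<subseteq> ?Up - ?P" using xs(2) UpLo(2) RbL by auto
  moreover have "?P \<subseteq> Ds ! (2 * i) \<union> Ds ! (2 * i + 1)" using Rt(1) Rb(1) by auto
  ultimately show ?thesis
    using \<phi> js by (intro exI[of _ ?P] exI[of _ "set xs"] exI[of _ \<phi>]) auto
qed

lemma window_disjoint:
  assumes "i < j" "j < N"
  shows "(Ds ! (2 * i) \<union> Ds ! (2 * i + 1)) \<inter> (Ds ! (2 * j) \<union> Ds ! (2 * j + 1)) = {}"
    and "\<Union>(set (take (2 * i + 1) Ds)) \<inter> (Ds ! (2 * j) \<union> Ds ! (2 * j + 1)) = {}"
proof -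
  have d: "Ds ! k \<inter> Ds ! l = {}" if "k < l" "l < 2 * N" for k l
    using pdisj_nth[OF pd that(1)] that(2) lenDs by simp
  have "2 * i < 2 * j" "2 * i < 2 * j + 1" "2 * i + 1 < 2 * j" "2 * i + 1 < 2 * j + 1" "2 * j + 1 < 2 * N" "2 * j < 2 * N"
    using assms by auto
  then show "(Ds ! (2 * i) \<union> Ds ! (2 * i + 1)) \<inter> (Ds ! (2 * j) \<union> Ds ! (2 * j + 1)) = {}"
    by (simp only: Int_Un_distrib Int_Un_distrib2 d Un_empty_left)
  have "Ds ! k \<inter> (Ds ! (2 * j) \<union> Ds ! (2 * j + 1)) = {}" if "k < 2 * i + 1" for k
    using d[of k "2 * j"] d[of k "2 * j + 1"] that assms by auto
  then show "\<Union>(set (take (2 * i + 1) Ds)) \<inter> (Ds ! (2 * j) \<union> Ds ! (2 * j + 1)) = {}"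
    unfolding Union_take_nth by fastforce
qed

text \<open>A stuck graph misses the pattern of every usable cut. The patterns lie in disjoint pairs
  of windows, and each depends otherwise only on edges from \<open>u\<close> to vertices in front of
  its cut, as \<open>pattern_bound\<close> requires.\<close>

lemma row_bound:
  assumes E: "E \<subseteq> nsets V 2" and uE: "\<And>w. w \<in> U \<Longrightarrow> {u, w} \<notin> E"
    and K: "K = {i\<in>{..<N}. \<not> top_bad i E \<and> \<not> bot_bad i E}"
  shows "pexp p (bip {u} U) (\<lambda>\<beta>. of_bool (stuck (E \<union> \<beta>))) \<le> (1 - q ^ (2 * t)) ^ card K"
proof -
  let ?row = "\<lambda>\<beta>. (\<lambda>w. {u, w}) ` \<beta>"
  have "\<forall>i\<in>K. \<exists>P T \<phi>. P \<subseteq> Ds ! (2 * i) \<union> Ds ! (2 * i + 1) \<and> card P \<le> 2 * t \<and>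
    T \<subseteq> \<Union>(set (take (2 * i + 1) Ds)) - P \<and> (\<forall>\<gamma>. \<phi> \<gamma> \<subseteq> P) \<and>
    (\<forall>\<beta>\<subseteq>U. \<beta> \<inter> P = \<phi> (\<beta> \<inter> T) \<longrightarrow> \<not> stuck (E \<union> ?row \<beta>))"
    using cut_exists[OF _ _ _ E uE] unfolding K by blast
  then obtain P T \<phi> where *: "\<And>i. i \<in> K \<Longrightarrow> P i \<subseteq> Ds ! (2 * i) \<union> Ds ! (2 * i + 1) \<and> card (P i) \<le> 2 * t \<and>
    T i \<subseteq> \<Union>(set (take (2 * i + 1) Ds)) - P i \<and> (\<forall>\<gamma>. \<phi> i \<gamma> \<subseteq> P i) \<and>
    (\<forall>\<beta>\<subseteq>U. \<beta> \<inter> P i = \<phi> i (\<beta> \<inter> T i) \<longrightarrow> \<not> stuck (E \<union> ?row \<beta>))"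
    by metis
  have KN: "i < N" if "i \<in> K" for i using that K by auto
  have "pexp p (bip {u} U) (\<lambda>\<beta>. of_bool (stuck (E \<union> \<beta>))) =
      pexp p U (\<lambda>\<beta>. of_bool (stuck (E \<union> ?row \<beta>)))"
    unfolding bip_singleton using disjU by (intro bexp_image inj_on_doubleton) auto
  also have "\<dots> \<le> pexp p U (\<lambda>\<beta>. of_bool (\<forall>i\<in>K. \<beta> \<inter> P i \<noteq> \<phi> i (\<beta> \<inter> T i)))"
    by (intro bexp_mono spread_const of_bool_mono) (use * in blast)
  also have "\<dots> \<le> (1 - q ^ (2 * t)) ^ card K"
  proof (rule pattern_bound)
    show "K \<subseteq> {..<N}" using K by auto
    fix i assume i: "i \<in> K"
    have "Ds ! (2 * i) \<subseteq> U" "Ds ! (2 * i + 1) \<subseteq> U"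
      unfolding U_def using KN[OF i] lenDs by (intro Union_upper nth_mem, simp)+
    then show "P i \<subseteq> U \<and> card (P i) \<le> 2 * t \<and> (\<forall>\<gamma>. \<phi> i \<gamma> \<subseteq> P i)" using *[OF i] by blast
    have Pi: "P k \<subseteq> Ds ! (2 * k) \<union> Ds ! (2 * k + 1)" "T k \<subseteq> \<Union>(set (take (2 * k + 1) Ds))" "T k \<inter> P k = {}"
      if "k \<in> K" for k
      using *[OF that] by auto
    fix j assume j: "j \<in> K"
    show "P i \<inter> P j = {}" if "i < j"
      using window_disjoint(1)[OF that KN[OF j]] Pi(1)[OF i] Pi(1)[OF j] by (meson disjoint_iff subsetD)
    show "T i \<inter> P j = {}" if "i \<le> j"
    proof (cases "i = j")
      case False
      then have "i < j" using that by simp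
      from window_disjoint(2)[OF this KN[OF j]] show ?thesis
        using Pi(2)[OF i] Pi(1)[OF j] by (meson disjoint_iff subsetD)
    qed (use Pi(3)[OF i] in simp)
  qed (use q in \<open>auto simp: spread_def\<close>)
  finally show ?thesis .
qed

text \<open>Of the \<open>4 * m\<close> cuts, at least \<open>2 * m\<close> are usable or at least
  \<open>m\<close> are bad on the same side. The latter is a union over at most
  \<open>2 ^ (4 * m)\<close> sets of \<open>m\<close> cuts; so a stage has to be bad with
  probability below \<open>1 / 16\<close>, and later \<open>1 / 32\<close> is used.\<close>

lemma failure_bound:
  assumes EA: "EA \<subseteq> nsets V 2" "EA \<inter> I = {}" and N: "N = 4 * m"
    and top: "\<And>S. S \<subseteq> {..<N} \<Longrightarrow> card S = m \<Longrightarrow>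
      pexp p J (\<lambda>H. of_bool (\<forall>i\<in>S. top_bad i (EA \<union> H))) \<le> B1"
    and bot: "\<And>S. S \<subseteq> {..<N} \<Longrightarrow> card S = m \<Longrightarrow>
      pexp p J (\<lambda>H. of_bool (\<forall>i\<in>S. bot_bad i (EA \<union> H))) \<le> B2"
    and B: "0 \<le> B1" "0 \<le> B2"
  shows "pexp p I (\<lambda>H. of_bool (stuck (EA \<union> H))) \<le> (1 - q ^ (2 * t)) ^ (2 * m) + 2 ^ (4 * m) * (B1 + B2)"
proof -
  let ?\<delta> = "1 - q ^ (2 * t)"
  define SS where "SS = {S. S \<subseteq> {..<N} \<and> card S = m}"
  let ?tb = "\<lambda>H S. of_bool (\<forall>i\<in>S. top_bad i (EA \<union> H)) :: real"
  let ?bb = "\<lambda>H S. of_bool (\<forall>i\<in>S. bot_bad i (EA \<union> H)) :: real"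
  have SS: "finite SS" "real (card SS) \<le> 2 ^ (4 * m)"
  proof -
    have "SS \<subseteq> Pow {..<N}" by (auto simp: SS_def)
    then show "finite SS" using finite_subset by blast
    have "card SS \<le> card (Pow {..<N})" using \<open>SS \<subseteq> Pow {..<N}\<close> by (intro card_mono) auto
    then show "real (card SS) \<le> 2 ^ (4 * m)" using N by (simp add: card_Pow of_nat_le_iff[symmetric] del: of_nat_le_iff)
  qed
  have \<delta>: "0 \<le> ?\<delta>" "?\<delta> \<le> 1" using q by (auto simp: power_le_one)
  have uI: "bip {u} U \<subseteq> I"
    using disj disjU by (auto simp: I_def V_def X_def bip_def)
  have step: "pexp p (bip {u} U) (\<lambda>\<beta>. of_bool (stuck (EA \<union> (H \<union> \<beta>)))) \<le> ?\<delta> ^ (2 * m) + (\<Sum>S\<in>SS. ?tb H S + ?bb H S)"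
    if H: "H \<subseteq> J" for H
  proof -
    let ?E = "EA \<union> H"
    let ?K = "{i\<in>{..<N}. \<not> top_bad i ?E \<and> \<not> bot_bad i ?E}"
    have nn: "0 \<le> (\<Sum>S\<in>SS. ?tb H S + ?bb H S)" by (intro sum_nonneg) simp
    have "{u, w} \<notin> ?E" if "w \<in> U" for w
    proof -
      have "{u, w} \<in> bip {u} U" using that by auto
      then show ?thesis using H EA(2) uI unfolding J_def by blast
    qed
    moreover have "?E \<subseteq> nsets V 2"
      using EA(1) H nsets_mono[of "V - A" V 2] by (auto simp: J_def I_def)
    ultimately have "pexp p (bip {u} U) (\<lambda>\<beta>. of_bool (stuck (?E \<union> \<beta>))) \<le> ?\<delta> ^ card ?K"
      by (intro row_bound) auto
    also have "\<dots> \<le> ?\<delta> ^ (2 * m) + (\<Sum>S\<in>SS. ?tb H S + ?bb H S)"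
    proof (cases "2 * m \<le> card ?K")
      case True
      then have "?\<delta> ^ card ?K \<le> ?\<delta> ^ (2 * m)" using \<delta> by (intro power_decreasing)
      then show ?thesis using nn by linarith
    next
      case False
      let ?T = "{i\<in>{..<N}. top_bad i ?E}" and ?B = "{i\<in>{..<N}. bot_bad i ?E}"
      have "{..<N} = ?K \<union> (?T \<union> ?B)" by auto
      then have "N \<le> card ?K + card (?T \<union> ?B)" by (metis (no_types, lifting) card_Un_le card_lessThan)
      then have "m \<le> card ?T \<or> m \<le> card ?B" using False N card_Un_le[of ?T ?B] by linarith
      then obtain S where S: "S \<in> SS" "?tb H S = 1 \<or> ?bb H S = 1"
      proof
        assume "m \<le> card ?T"
        then obtain S where "S \<subseteq> ?T" "card S = m" using obtain_subset_with_card_n by metis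
        then show ?thesis using that[of S] by (auto simp: SS_def)
      next
        assume "m \<le> card ?B"
        then obtain S where "S \<subseteq> ?B" "card S = m" using obtain_subset_with_card_n by metis
        then show ?thesis using that[of S] by (auto simp: SS_def)
      qed
      have "?\<delta> ^ card ?K \<le> 1" using \<delta> by (intro power_le_one)
      also have "1 \<le> ?tb H S + ?bb H S" using S(2) by auto
      also have "\<dots> \<le> (\<Sum>S\<in>SS. ?tb H S + ?bb H S)"
        by (rule member_le_sum[OF S(1)]) (use SS in simp_all)
      also have "\<dots> \<le> ?\<delta> ^ (2 * m) + (\<Sum>S\<in>SS. ?tb H S + ?bb H S)" using \<delta> by simp
      finally show ?thesis .
    qed
    finally show ?thesis by (simp only: Un_assoc)
  qed
  have "pexp p I (\<lambda>H. of_bool (stuck (EA \<union> H))) =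
      pexp p (J \<union> bip {u} U) (\<lambda>H. of_bool (stuck (EA \<union> H)))"
    using uI by (simp add: J_def Un_absorb2)
  also have "\<dots> = pexp p J (\<lambda>H. pexp p (bip {u} U) (\<lambda>\<beta>. of_bool (stuck (EA \<union> (H \<union> \<beta>)))))"
    by (rule bexp_union) (auto simp: J_def)
  also have "\<dots> \<le> pexp p J (\<lambda>H. ?\<delta> ^ (2 * m) + (\<Sum>S\<in>SS. ?tb H S + ?bb H S))"
    by (intro bexp_mono spread_const step)
  also have "\<dots> = ?\<delta> ^ (2 * m) + (\<Sum>S\<in>SS. pexp p J (\<lambda>H. ?tb H S) + pexp p J (\<lambda>H. ?bb H S))"
    by (simp only: bexp_add bexp_sum bexp_const finJ)
  also have "\<dots> \<le> ?\<delta> ^ (2 * m) + (\<Sum>S\<in>SS. B1 + B2)"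
    using top bot by (intro add_left_mono sum_mono add_mono) (auto simp: SS_def)
  also have "\<dots> \<le> ?\<delta> ^ (2 * m) + 2 ^ (4 * m) * (B1 + B2)"
    using SS B by (auto intro!: mult_right_mono)
  finally show ?thesis .
qed

end

section \<open>Conditioned random graphs\<close>

lemma prob_random_graph:
  assumes "finite V" "0 \<le> p" "p \<le> 1"
  shows "measure_pmf.prob (random_graph V p) S = pexp p (nsets V 2) (\<lambda>H. of_bool (H \<in> S))"
proof -
  let ?I = "nsets V 2"
  let ?P = "Pi_pmf ?I False (\<lambda>_. bernoulli_pmf p)"
  have fin: "finite ?I" using assms by simp
  have point: "pmf (random_graph V p) H = (\<Prod>e\<in>?I. if e \<in> H then p else 1 - p)" if H: "H \<subseteq> ?I" for H
  proof -
    have "pmf (random_graph V p) H = measure_pmf.prob ?P ((\<lambda>b. {e \<in> ?I. b e}) -` {H})"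
      unfolding random_graph_def pmf_map ..
    also have "\<dots> = measure_pmf.prob ?P {\<lambda>e. e \<in> H}"
    proof (rule measure_pmf.finite_measure_eq_AE)
      show "AE b in ?P. b \<in> (\<lambda>b. {e \<in> ?I. b e}) -` {H} \<longleftrightarrow> b \<in> {\<lambda>e. e \<in> H}"
      proof (rule AE_pmfI)
        fix b assume "b \<in> set_pmf ?P"
        then have "b e = False" if "e \<notin> ?I" for e
          using set_Pi_pmf_subset[OF fin, of False "\<lambda>_. bernoulli_pmf p"] that by auto
        then show "b \<in> (\<lambda>b. {e \<in> ?I. b e}) -` {H} \<longleftrightarrow> b \<in> {\<lambda>e. e \<in> H}"
          using H by (auto simp: fun_eq_iff)
      qed
    qed auto
    also have "\<dots> = pmf ?P (\<lambda>e. e \<in> H)" by (rule measure_pmf_single)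
    also have "\<dots> = (\<Prod>e\<in>?I. pmf (bernoulli_pmf p) (e \<in> H))"
      using fin H by (subst pmf_Pi') auto
    also have "\<dots> = (\<Prod>e\<in>?I. if e \<in> H then p else 1 - p)"
      using assms by (intro prod.cong) auto
    finally show ?thesis .
  qed
  have "set_pmf (random_graph V p) \<subseteq> Pow ?I" by (auto simp: random_graph_def)
  then have "S \<inter> Pow ?I \<inter> set_pmf (random_graph V p) = S \<inter> set_pmf (random_graph V p)" by auto
  then have "measure_pmf.prob (random_graph V p) S = measure_pmf.prob (random_graph V p) (S \<inter> Pow ?I)"
    using measure_Int_set_pmf[of "random_graph V p" S] measure_Int_set_pmf[of "random_graph V p" "S \<inter> Pow ?I"] by simp
  also have "\<dots> = (\<Sum>H\<in>S \<inter> Pow ?I. pmf (random_graph V p) H)"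
    using fin by (intro measure_measure_pmf_finite) auto
  also have "\<dots> = (\<Sum>H\<in>S \<inter> Pow ?I. (\<Prod>e\<in>?I. if e \<in> H then p else 1 - p))"
    using point by (intro sum.cong) auto
  also have "\<dots> = pexp p ?I (\<lambda>H. of_bool (H \<in> S))"
    unfolding bexp_def using fin by (intro sum.mono_neutral_cong_left) auto
  finally show ?thesis .
qed

lemma prob_cond_pmf:
  assumes "set_pmf P \<inter> S \<noteq> {}"
  shows "measure_pmf.prob (cond_pmf P S) F = measure_pmf.prob P (F \<inter> S) / measure_pmf.prob P S"
proof -
  have "measure_pmf.prob P S \<noteq> 0" using assms by (metis disjoint_iff inf_commute measure_pmf_zero_iff)
  then have "emeasure (measure_pmf P) S \<noteq> 0" by (simp add: measure_pmf.emeasure_eq_measure)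
  then show ?thesis
    unfolding cond_pmf.rep_eq[OF assms] by (subst measure_uniform_measure) (auto simp: Int_commute)
qed

text \<open>Given the other elements, a single element decides the parity, and both of its outcomes
  have probability at least \<open>q\<close>.\<close>

lemma parity_lower_bound:
  assumes "finite I" "I \<noteq> {}" "0 \<le> q" "q \<le> p" "p \<le> 1 - q"
  shows "q \<le> pexp p I (\<lambda>H. of_bool (odd (card H) = c))"
proof -
  obtain i where i: "i \<in> I" using assms(2) by blast
  let ?I = "I - {i}"
  let ?P = "\<lambda>c. pexp p ?I (\<lambda>H. of_bool (odd (card H) = c))"
  have sp: "spread 0 ?I (\<lambda>_. p)" using assms by (simp add: spread_def)
  have nn: "0 \<le> ?P c" for c by (rule bexp_nonneg[OF sp]) simp
  have "?P c + ?P (\<not> c) = pexp p ?I (\<lambda>_. 1)"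
    unfolding bexp_add[symmetric] by (intro bexp_cong) auto
  then have one: "?P c + ?P (\<not> c) = 1" using assms(1) by simp
  have flip: "pexp p ?I (\<lambda>H. of_bool (odd (card (insert i H)) = c)) = ?P (\<not> c)"
  proof (intro bexp_cong refl arg_cong[of _ _ of_bool])
    fix H assume "H \<subseteq> ?I"
    then have "finite H" "i \<notin> H" using assms(1) finite_subset by auto
    then show "(odd (card (insert i H)) = c) = (odd (card H) = (\<not> c))" by auto
  qed
  have "q * (?P c + ?P (\<not> c)) = q" unfolding one by (rule mult_1_right)
  then have "q = q * ?P (\<not> c) + q * ?P c" unfolding distrib_left by (simp only: add.commute)
  also have "\<dots> \<le> p * ?P (\<not> c) + (1 - p) * ?P c"
    using assms by (intro add_mono mult_right_mono nn) simp_all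
  also have "\<dots> = pexp p (insert i ?I) (\<lambda>H. of_bool (odd (card H) = c))"
    using assms(1) by (subst bexp_insert) (simp_all only: flip finite_Diff Diff_iff insertI1 simp_thms)
  also have "insert i ?I = I" using i by auto
  finally show ?thesis .
qed

lemma odd_card_Un_eq:
  assumes "finite X" "finite Y" "X \<inter> Y = {}"
  shows "(odd (card (X \<union> Y)) = c) \<longleftrightarrow> (odd (card Y) = (c \<noteq> odd (card X)))"
  unfolding card_Un_disjoint[OF assms] odd_add by argo

lemma all_disagree_bound:
  assumes "finite I" "N \<subseteq> I" "0 \<le> q" "q \<le> p" "p \<le> 1 - q"
  shows "pexp p I (\<lambda>H. of_bool (\<forall>e\<in>N. (e \<in> H) \<noteq> c)) \<le> (1 - q) ^ card N"
proof (cases c)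
  case True
  have "pexp p I (\<lambda>H. of_bool (\<forall>e\<in>N. (e \<in> H) \<noteq> c)) = pexp p I (\<lambda>H. of_bool (H \<inter> N = {}))"
    using True by (intro bexp_cong) auto
  also have "\<dots> \<le> (1 - q) ^ card N"
    using assms by (intro bexp_disjoint_le) (auto simp: spread_def)
  finally show ?thesis .
next
  case False
  have "pexp p I (\<lambda>H. of_bool (\<forall>e\<in>N. (e \<in> H) \<noteq> c)) =
      pexp p I (\<lambda>H. of_bool (sym_diff H I \<inter> N = {}))"
    using False assms(2) by (intro bexp_cong refl arg_cong[of _ _ of_bool]) auto
  also have "\<dots> = bexp I (\<lambda>i. if i \<in> I then 1 - p else p) (\<lambda>H. of_bool (H \<inter> N = {}))"
    by (rule bexp_flip) simp
  also have "\<dots> \<le> (1 - q) ^ card N"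
    using assms by (intro bexp_disjoint_le) (auto simp: spread_def)
  finally show ?thesis .
qed

text \<open>The part of \<open>revealed\<close> that is determined by the pairs meeting
  \<open>A\<close>.\<close>

definition row_data :: "'a set \<Rightarrow> 'a set set \<Rightarrow> 'a set set \<times> 'a set" where
  "row_data A E = (induced_edges E A, {a \<in> A. odd (degree E a)})"

lemma Collect_eq_iff: "{x \<in> A. P x} = B \<longleftrightarrow> B \<subseteq> A \<and> (\<forall>x\<in>A. P x = (x \<in> B))"
  by blast

lemma ball_if_eq:
  "a \<in> A \<Longrightarrow> (\<forall>x\<in>A. (if x = a then P else Q x) = R x) \<longleftrightarrow> (\<forall>x\<in>A - {a}. Q x = R x) \<and> P = R a"
  by auto

text \<open>Given all other pairs, the data constrain the row from \<open>a\<close> to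
  \<open>V - A\<close> by its parity only, an event of probability at least \<open>q\<close>. So
  conditioning raises the probability of few neighbours at most by the factor
  \<open>1 / q\<close>.\<close>

lemma conditioned_row_bound:
  assumes fin: "finite V" and A: "A \<subseteq> V" "a \<in> A" and S: "S \<subseteq> V - A" and ne: "V - A \<noteq> {}"
    and q: "0 < q" "q \<le> p" "p \<le> 1 - q"
  shows "pexp p (nsets V 2 - nsets (V - A) 2)
      (\<lambda>E. of_bool (row_data A E = r \<and> card {d \<in> S. {a, d} \<in> E} < M)) \<le>
    2 ^ M * (1 - q / 2) ^ card S / q *
      pexp p (nsets V 2 - nsets (V - A) 2) (\<lambda>E. of_bool (row_data A E = r))"
proof -
  let ?W = "V - A" and ?I = "nsets V 2 - nsets (V - A) 2"
  let ?row = "bip {a} ?W" and ?f = "2 ^ M * (1 - q / 2) ^ card S"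
  let ?few = "\<lambda>E. card {d \<in> S. {a, d} \<in> E} < M"
  let ?r = "\<lambda>\<nu>. (\<lambda>y. {a, y}) ` \<nu>"
  have aV: "a \<in> V" "a \<notin> ?W" using A by auto
  have finI: "finite ?I" "finite ?W" "finite S" using fin S finite_subset by (auto simp: nsets_def)
  have sp: "spread 0 J (\<lambda>_. p)" for J :: "'b set" using q by (simp add: spread_def)
  have rowI: "?row \<subseteq> ?I" using aV by (auto simp: bip_def)
  have f0: "0 \<le> ?f" using q by (intro mult_nonneg_nonneg) auto
  have fixed: "pexp p ?row (\<lambda>F. of_bool (row_data A (\<eta> \<union> F) = r \<and> ?few (\<eta> \<union> F))) \<le>
      ?f / q * pexp p ?row (\<lambda>F. of_bool (row_data A (\<eta> \<union> F) = r))" if \<eta>: "\<eta> \<subseteq> ?I - ?row" for \<eta>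
  proof -
    have conv: "pexp p ?row g = pexp p ?W (\<lambda>\<nu>. g (?r \<nu>))" for g
      unfolding bip_singleton using finI aV by (intro bexp_image inj_on_doubleton) auto
    \<comment> \<open>The part of the condition that is decided outside the row of
      \<open>a\<close>.\<close>
    define c where "c \<longleftrightarrow> induced_edges \<eta> A = fst r \<and> snd r \<subseteq> A \<and> (\<forall>a'\<in>A - {a}. odd (degree \<eta> a') \<longleftrightarrow> a' \<in> snd r)"
    have data: "row_data A (\<eta> \<union> ?r \<nu>) = r \<longleftrightarrow> c \<and> (odd (card \<nu>) = ((a \<in> snd r) \<noteq> odd (degree \<eta> a)))"
      if \<nu>: "\<nu> \<subseteq> ?W" for \<nu>
    proof -
      have ind: "induced_edges (\<eta> \<union> ?r \<nu>) A = induced_edges \<eta> A"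
        using \<nu> by (auto simp: induced_edges_def)
      have deg: "degree (\<eta> \<union> ?r \<nu>) a' = degree \<eta> a'" if "a' \<in> A - {a}" for a'
      proof -
        have "neighbours (\<eta> \<union> ?r \<nu>) a' = neighbours \<eta> a'"
          using that \<nu> by (auto simp: neighbours_def doubleton_eq_iff)
        then show ?thesis by (simp add: degree_def)
      qed
      have dega: "odd (degree (\<eta> \<union> ?r \<nu>) a) \<longleftrightarrow> odd (degree \<eta> a) \<noteq> odd (card \<nu>)"
      proof -
        have "{a, w} \<notin> \<eta>" if "w \<in> ?W" for w
          using \<eta> that doubleton_in_bip[of a w "{a}" ?W] by blast
        then have "neighbours \<eta> a \<inter> \<nu> = {}" using \<nu> by (auto simp: neighbours_def)
        moreover have "neighbours (\<eta> \<union> ?r \<nu>) a = neighbours \<eta> a \<union> \<nu>"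
          using \<nu> aV by (auto simp: neighbours_def doubleton_eq_iff)
        moreover have "finite (neighbours \<eta> a)"
        proof (rule finite_subset[OF _ fin])
          show "neighbours \<eta> a \<subseteq> V" using \<eta> by (auto simp: neighbours_def)
        qed
        moreover have "finite \<nu>" using \<nu> finI finite_subset by blast
        ultimately show ?thesis by (simp add: degree_def card_Un_disjoint)
      qed
      let ?D = "{a' \<in> A. if a' = a then odd (degree \<eta> a) \<noteq> odd (card \<nu>) else odd (degree \<eta> a')}"
      have D: "{a' \<in> A. odd (degree (\<eta> \<union> ?r \<nu>) a')} = ?D"
        by (intro Collect_cong conj_cong refl) (use deg dega in \<open>simp split: if_split\<close>)
      have "?D = snd r \<longleftrightarrow> snd r \<subseteq> A \<and>
          (\<forall>a'\<in>A. (if a' = a then odd (degree \<eta> a) \<noteq> odd (card \<nu>) else odd (degree \<eta> a')) = (a' \<in> snd r))"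
        by (rule Collect_eq_iff)
      also have "\<dots> \<longleftrightarrow> snd r \<subseteq> A \<and> (\<forall>a'\<in>A - {a}. odd (degree \<eta> a') = (a' \<in> snd r)) \<and>
          ((odd (degree \<eta> a) \<noteq> odd (card \<nu>)) = (a \<in> snd r))"
        unfolding ball_if_eq[OF A(2)] ..
      finally show ?thesis
        unfolding row_data_def ind D prod_eq_iff fst_conv snd_conv c_def by argo
    qed
    show ?thesis
    proof (cases c)
      case False
      have "pexp p ?row (\<lambda>F. of_bool (row_data A (\<eta> \<union> F) = r \<and> ?few (\<eta> \<union> F))) \<le> 0"
        unfolding conv using finI sp False data by (intro bexp_le of_bool_le0) auto
      also have "0 \<le> ?f / q * pexp p ?row (\<lambda>F. of_bool (row_data A (\<eta> \<union> F) = r))"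
        using f0 q by (intro mult_nonneg_nonneg bexp_nonneg sp) auto
      finally show ?thesis .
    next
      case True
      have "pexp p ?row (\<lambda>F. of_bool (row_data A (\<eta> \<union> F) = r \<and> ?few (\<eta> \<union> F))) \<le>
          pexp p ?W (\<lambda>\<nu>. of_bool (card (\<nu> \<inter> S) < M))"
        unfolding conv
      proof (intro bexp_mono sp of_bool_mono)
        fix \<nu> assume \<nu>: "\<nu> \<subseteq> ?W" and few: "row_data A (\<eta> \<union> ?r \<nu>) = r \<and> ?few (\<eta> \<union> ?r \<nu>)"
        have "\<nu> \<inter> S \<subseteq> {d \<in> S. {a, d} \<in> \<eta> \<union> ?r \<nu>}" by auto
        then have "card (\<nu> \<inter> S) \<le> card {d \<in> S. {a, d} \<in> \<eta> \<union> ?r \<nu>}"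
          using finI by (intro card_mono) auto
        then show "card (\<nu> \<inter> S) < M" using few by linarith
      qed
      also have "\<dots> \<le> ?f"
      proof (rule bexp_split_le[where J = S])
        fix \<eta>' assume "\<eta>' \<subseteq> ?W - S"
        then have "pexp p S (\<lambda>H. of_bool (card ((H \<union> \<eta>') \<inter> S) < M)) = pexp p S (\<lambda>H. of_bool (card H < M))"
          by (intro bexp_cong refl arg_cong[of _ _ of_bool] arg_cong[of _ _ "\<lambda>x. card x < M"]) auto
        also have "\<dots> \<le> 2 ^ M * (1 - p / 2) ^ card S"
          using finI q by (intro bexp_card_less) auto
        also have "\<dots> \<le> ?f" using q by (intro mult_left_mono power_mono) auto
        finally show "pexp p S (\<lambda>H. of_bool (card ((H \<union> \<eta>') \<inter> S) < M)) \<le> ?f" .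
      qed (use finI S sp in auto)
      also have "?f = ?f / q * q" using q by simp
      also have "\<dots> \<le> ?f / q * pexp p ?W (\<lambda>\<nu>. of_bool (odd (card \<nu>) = ((a \<in> snd r) \<noteq> odd (degree \<eta> a))))"
        using f0 q finI ne by (intro mult_left_mono parity_lower_bound) auto
      also have "pexp p ?W (\<lambda>\<nu>. of_bool (odd (card \<nu>) = ((a \<in> snd r) \<noteq> odd (degree \<eta> a)))) =
          pexp p ?row (\<lambda>F. of_bool (row_data A (\<eta> \<union> F) = r))"
        unfolding conv using True data by (intro bexp_cong refl arg_cong[of _ _ of_bool]) auto
      finally show ?thesis .
    qed
  qed
  have eq: "pexp p ?I g = pexp p (?I - ?row) (\<lambda>\<eta>. pexp p ?row (\<lambda>F. g (\<eta> \<union> F)))" for g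
  proof -
    have "pexp p ?I g = pexp p ((?I - ?row) \<union> ?row) g"
      using rowI by (simp add: Un_absorb2)
    also have "\<dots> = pexp p (?I - ?row) (\<lambda>\<eta>. pexp p ?row (\<lambda>F. g (\<eta> \<union> F)))"
      using finI by (intro bexp_union) auto
    finally show ?thesis .
  qed
  show ?thesis
    unfolding eq bexp_cmult[symmetric] by (rule bexp_mono[OF sp]) (use fixed in \<open>simp only: bexp_cmult\<close>)
qed

section \<open>Numerical estimates and the choice of the windows\<close>

lemma tail_bound:
  fixes q :: real
  assumes "0 < q" "q \<le> 1"
  shows "(\<Sum>s\<in>{t<..L}. (1 - q) ^ s) \<le> (1 - q) ^ Suc t / q"
proof -
  \<comment> \<open>The geometric sum with its remainder, which makes the induction work; the
    \<open>max\<close> covers the empty range \<open>L < t\<close>.\<close>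
  have "(\<Sum>s\<in>{t<..L}. (1 - q) ^ s) \<le> ((1 - q) ^ Suc t - (1 - q) ^ Suc (max t L)) / q"
  proof (induction L)
    case (Suc L)
    show ?case
    proof (cases "t \<le> L")
      case True
      then have "{t<..Suc L} = insert (Suc L) {t<..L}" by auto
      then have "(\<Sum>s\<in>{t<..Suc L}. (1 - q) ^ s) = (1 - q) ^ Suc L + (\<Sum>s\<in>{t<..L}. (1 - q) ^ s)" by simp
      also have "\<dots> \<le> (1 - q) ^ Suc L + ((1 - q) ^ Suc t - (1 - q) ^ Suc L) / q"
        using Suc True by (simp add: max_def)
      also have "\<dots> = ((1 - q) ^ Suc t - (1 - q) ^ Suc (Suc L)) / q"
        using assms by (simp add: field_simps)
      finally show ?thesis using True by (simp add: max_def)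
    next
      case False
      then have "max t (Suc L) = t" "{t<..Suc L} = {}" by auto
      then show ?thesis by simp
    qed
  qed simp
  also have "\<dots> \<le> (1 - q) ^ Suc t / q"
    using assms by (intro divide_right_mono) auto
  finally show ?thesis .
qed

lemma power_half_bound:
  fixes x y :: real
  assumes "0 \<le> x" "x \<le> y" "y \<le> 1" "y ^ h \<le> 1 / 2" "h * k \<le> l"
  shows "x ^ l \<le> (1 / 2) ^ k"
proof -
  have "x ^ l \<le> y ^ l" using assms by (intro power_mono) auto
  also have "\<dots> \<le> y ^ (h * k)" using assms by (intro power_decreasing) auto
  also have "\<dots> = (y ^ h) ^ k" by (rule power_mult)
  also have "\<dots> \<le> (1 / 2) ^ k" using assms by (intro power_mono) auto
  finally show ?thesis .
qed

text \<open>Each \<open>h\<close> factors \<open>1 - q / 2\<close> halve a term. The window length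
  pays for the factor \<open>2 ^ M\<close> with \<open>M = 16 * h * m\<close> and for
  \<open>8 * m\<close> further halvings. Since \<open>M\<close> is twice
  \<open>\<tau> = 8 * h * m\<close>, at least \<open>8 * h * m\<close> neighbours remain while up to
  \<open>\<tau>\<close> leftovers are absorbed.\<close>

lemma stage_err_bound:
  assumes q: "0 < q" "q \<le> 1" and h: "(1 - q / 2) ^ h \<le> 1 / 2"
  shows "stage_err q (16 * h * m) (8 * h * m) (h * (16 * h * m + 8 * m)) s \<le>
    real (16 * h * m) * (1 / 2) ^ (8 * m) + (1 - q) ^ Suc s / q"
proof -
  let ?M = "16 * h * m" and ?\<tau> = "8 * h * m" and ?L = "h * (16 * h * m + 8 * m)"
  have "(2::real) ^ ?M * (1 - q / 2) ^ ?L \<le> 2 ^ ?M * (1 / 2) ^ (?M + 8 * m)"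
    using q h by (intro mult_left_mono power_half_bound[where y = "1 - q / 2" and h = h]) auto
  also have "\<dots> = (1 / 2) ^ (8 * m)" by (simp add: power_add power_one_over)
  finally have 1: "real ?\<tau> * (2 ^ ?M * (1 - q / 2) ^ ?L) \<le> real ?\<tau> * (1 / 2) ^ (8 * m)"
    by (intro mult_left_mono) auto
  have "(\<Sum>i<?\<tau>. (1 - q) ^ (?M - i)) \<le> (\<Sum>i<?\<tau>. (1 / 2) ^ (8 * m))"
  proof (rule sum_mono)
    fix i assume "i \<in> {..<?\<tau>}"
    then show "(1 - q) ^ (?M - i) \<le> (1 / 2) ^ (8 * m)"
      using q h by (intro power_half_bound[where y = "1 - q / 2" and h = h]) auto
  qed
  then have 2: "(\<Sum>i<?\<tau>. (1 - q) ^ (?M - i)) \<le> real ?\<tau> * (1 / 2) ^ (8 * m)" by simp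
  have "real ?\<tau> * (1 / 2) ^ (8 * m) + real ?\<tau> * (1 / 2) ^ (8 * m) = real ?M * (1 / 2) ^ (8 * m)"
    by (simp add: algebra_simps)
  then show ?thesis
    unfolding stage_err_def using 1 2 tail_bound[OF q, of s ?L] by linarith
qed

lemma pick_windows:
  assumes "finite S" "k * len \<le> card S"
  shows "\<exists>Ds. length Ds = k \<and> pdisj Ds \<and> (\<forall>D\<in>set Ds. D \<subseteq> S \<and> card D = len)"
  using assms
proof (induction k arbitrary: S)
  case 0
  show ?case by (intro exI[of _ "[]"]) simp
next
  case (Suc k)
  have "len \<le> card S" using Suc.prems(2) by simp
  then obtain D where D: "D \<subseteq> S" "card D = len" by (meson obtain_subset_with_card_n)
  then have "finite D" using Suc.prems finite_subset by blast
  then have k: "k * len \<le> card (S - D)" using Suc.prems(2) D by (simp add: card_Diff_subset)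
  have "finite (S - D)" using Suc.prems(1) by simp
  from Suc.IH[OF this k] obtain Ds where Ds: "length Ds = k" "pdisj Ds" "\<forall>D'\<in>set Ds. D' \<subseteq> S - D \<and> card D' = len"
    by blast
  then have "D \<inter> \<Union>(set Ds) = {}" by auto
  then show ?case using Ds D by (intro exI[of _ "D # Ds"]) auto
qed

text \<open>The summands bound the probabilities that some vertex of \<open>A\<close> has few neighbours in \<open>L\<close>, that none
  of \<open>m\<close> candidates for \<open>v\<close> makes the parities agree and that, for one of them, the edges at \<open>u\<close> miss
  the pattern at \<open>2 * m\<close> cuts or the greedy orders fail too often. The outer division by \<open>q\<close> comes
  from conditioning on the parity of the number of edges.\<close>

definition fail_bound :: "real \<Rightarrow> nat \<Rightarrow> nat \<Rightarrow> nat \<Rightarrow> nat \<Rightarrow> real" where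
  "fail_bound q h t n m =
    (let x = (1 / 2) ^ (8 * m); y = (1 / 32) ^ m + real (8 * m) * ((real (16 * h * m) + 1 / q) * x)
     in (real n * x / q + ((1 - q) ^ m + real m * ((1 - q ^ (2 * t)) ^ (2 * m) +
          2 ^ (4 * m) * (2 * y + ((real n + 1 / q) * x + y))))) / q)"

text \<open>The row data concern only the pairs meeting \<open>A\<close>, and given these the parity
  of the number of edges is right with probability at least \<open>q\<close>. So numerator and
  denominator are both compared with the probability of the row data, which cancels. The inequality
  \<open>size\<close> makes room for \<open>A\<close>, the \<open>m\<close> candidates for
  \<open>v\<close>, the vertices \<open>u\<close> and \<open>b\<close>, the \<open>8 * m\<close>
  windows and \<open>L\<close>.\<close>

lemma conditional_bound:
  assumes fin: "finite V" and A: "A \<subseteq> V" and q: "0 < q" "q \<le> p" "p \<le> 1 - q"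
    and h: "(1 - q / 2) ^ h \<le> 1 / 2" and t: "(1 - q) ^ Suc t / q \<le> 1 / 64" "t \<le> 8 * h * m"
    and m: "real (16 * h * m) * (1 / 2) ^ (8 * m) \<le> 1 / 64" "real (card V) * (1 / 2) ^ (8 * m) \<le> 1 / 2"
    and size: "card A + m + 2 + 8 * m * (h * (16 * h * m + 8 * m)) + h * (card A + 8 * h * m + 8 * m) \<le> card V"
    and r: "set_pmf (random_graph V p) \<inter> {E. revealed A E = r} \<noteq> {}"
  shows "measure_pmf.prob (cond_pmf (random_graph V p) {E. revealed A E = r}) {E. \<not> even_degenerate V E}
    \<le> fail_bound q h t (card V) m"
proof -
  let ?M = "16 * h * m" and ?\<tau> = "8 * h * m"
  define len where "len = h * (?M + 8 * m)"
  define x :: real where "x = (1 / 2) ^ (8 * m)"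
  define \<epsilon> where "\<epsilon> = (real ?M + 1 / q) * x"
  define y where "y = (1 / 32) ^ m + real (8 * m) * \<epsilon>"
  define B where "B = (1 - q ^ (2 * t)) ^ (2 * m) + 2 ^ (4 * m) * (2 * y + ((real (card V) + 1 / q) * x + y))"
  \<comment> \<open>Absorbing \<open>A\<close> costs each of its vertices fewer than
    \<open>card A\<close> neighbours in \<open>L\<close>; more than \<open>?\<tau>\<close>
    remain.\<close>
  define M0 where "M0 = card A + ?\<tau>"
  have finA: "finite A" using fin A finite_subset by blast
  have q1: "q \<le> 1" "0 \<le> p" "p \<le> 1" using q by auto
  have x0: "0 \<le> x" by (simp add: x_def)
  have \<epsilon>0: "0 \<le> \<epsilon>" unfolding \<epsilon>_def using x0 q by simp
  have y0: "0 \<le> y" unfolding y_def using \<epsilon>0 by simp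
  have sp: "spread 0 J (\<lambda>_. p)" for J :: "'b set" using q1 by (simp add: spread_def)
  have half: "z ^ l \<le> (1 / 2) ^ k" if "0 \<le> z" "z \<le> 1 - q / 2" "h * k \<le> l" for z :: real and k l
    using that q h by (intro power_half_bound[where y = "1 - q / 2" and h = h]) auto
  have err_t: "stage_err q ?M ?\<tau> len t \<le> 1 / 32"
    using stage_err_bound[OF q(1) q1(1) h, of m t] t(1) m(1) unfolding len_def by linarith
  have pow_\<tau>: "(1 - q) ^ ?\<tau> \<le> x" unfolding x_def using q by (intro half) auto
  have tail_\<tau>: "(1 - q) ^ Suc ?\<tau> / q \<le> 1 / q * x"
  proof -
    have "(1 - q) ^ Suc ?\<tau> \<le> (1 - q) ^ ?\<tau>" using q by (intro power_decreasing) auto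
    then have "(1 - q) ^ Suc ?\<tau> \<le> x" using pow_\<tau> by linarith
    then show ?thesis using q by (simp add: divide_right_mono)
  qed
  have err_\<tau>: "stage_err q ?M ?\<tau> len ?\<tau> \<le> \<epsilon>"
    using stage_err_bound[OF q(1) q1(1) h, of m ?\<tau>] tail_\<tau>
    unfolding len_def \<epsilon>_def x_def distrib_right by linarith
  define W where "W = V - A"
  have finW: "finite W" using fin by (simp add: W_def)
  have cW: "card W = card V - card A" unfolding W_def using finA A by (simp add: card_Diff_subset)
  have size1: "card A + m + 2 + 8 * m * len + h * (M0 + 8 * m) \<le> card V"
    using size unfolding len_def M0_def .
  have "card W \<noteq> 0" using cW size1 by linarith
  then obtain u where u: "u \<in> W" by (metis card.empty ex_in_conv)
  have cW1: "card (W - {u}) = card W - 1" using u finW by simp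
  have "card (W - {u}) \<noteq> 0" using cW1 cW size1 by linarith
  then obtain b where b: "b \<in> W - {u}" by (metis card.empty ex_in_conv)
  have cW2: "card (W - {u, b}) = card W - 2" using u b finW by (subst card_Diff_subset) auto
  \<comment> \<open>Candidates for \<open>v\<close> are set aside; when one is chosen, the others
    join \<open>L\<close>.\<close>
  have "m \<le> card (W - {u, b})" using cW2 cW size1 by linarith
  then obtain C where C: "C \<subseteq> W - {u, b}" "card C = m" by (meson obtain_subset_with_card_n)
  have finC: "finite C" using C(1) finW finite_subset by blast
  have cW3: "card (W - {u, b} - C) = card W - 2 - m" using cW2 C finC by (simp add: card_Diff_subset)
  have finW3: "finite (W - {u, b} - C)" using finW by simp
  have "8 * m * len \<le> card (W - {u, b} - C)" using cW3 cW size1 by linarith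
  from pick_windows[OF finW3 this] obtain Ds
    where Ds: "length Ds = 8 * m" "pdisj Ds" "\<forall>D\<in>set Ds. D \<subseteq> W - {u, b} - C \<and> card D = len"
    by blast
  define U where "U = \<Union>(set Ds)"
  define L where "L = W - {u, b} - C - U"
  have UW: "U \<subseteq> W - {u, b} - C" using Ds(3) by (auto simp: U_def)
  then have finU: "finite U" using finW finite_subset by blast
  have cU: "card U \<le> 8 * m * len"
  proof -
    have "card U \<le> (\<Sum>D\<in>set Ds. card D)" unfolding U_def by (rule card_Union_le_sum_card)
    also have "\<dots> = card (set Ds) * len" using Ds(3) by simp
    also have "\<dots> \<le> 8 * m * len" using card_length[of Ds] Ds(1) by (intro mult_le_mono1) simp
    finally show ?thesis .
  qed
  have finL: "finite L" using finW by (simp add: L_def)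
  have cL: "h * (M0 + 8 * m) \<le> card L"
  proof -
    have "card L = card W - 2 - m - card U" unfolding L_def using cW3 UW finU by (simp add: card_Diff_subset)
    then show ?thesis using cU cW size1 by linarith
  qed
  define I where "I = nsets W 2"
  define IA where "IA = nsets V 2 - I"
  have IV: "I \<subseteq> nsets V 2" unfolding I_def W_def by (rule nsets_mono) auto
  have finI: "finite I" "finite IA" using fin finW by (auto simp: I_def IA_def)
  have I_split: "nsets V 2 = IA \<union> I" "IA \<inter> I = {}" using IV by (auto simp: IA_def)
  have IA: "IA = nsets V 2 - nsets (V - A) 2" by (simp add: IA_def I_def W_def)
  obtain r1 r2 \<rho> where r_eq: "r = (r1, r2, \<rho>)" by (cases r) auto
  let ?C = "\<lambda>E. row_data A E = (r1, r2)"
  let ?ED = "\<lambda>E. even_degenerate V E"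
  have rev: "revealed A (E \<union> H) = r \<longleftrightarrow> ?C E \<and> odd (card (E \<union> H)) = \<rho>" if H: "H \<subseteq> I" for E H
  proof -
    have "\<not> e \<subseteq> A" if "e \<in> H" for e
    proof
      assume "e \<subseteq> A"
      moreover have "e \<subseteq> V - A" "card e = 2" using H that by (auto simp: I_def W_def nsets_def)
      ultimately have "e = {}" "card e = 2" by blast+
      then show False by simp
    qed
    then have "induced_edges (E \<union> H) A = induced_edges E A"
      unfolding induced_edges_def by blast
    moreover have "degree (E \<union> H) a = degree E a" if "a \<in> A" for a
    proof -
      have "{a, w} \<notin> H" for w using H that by (auto simp: I_def W_def)
      then show ?thesis by (simp add: degree_def neighbours_def)
    qed
    ultimately show ?thesis
      unfolding r_eq revealed_def row_data_def by (simp cong: conj_cong Collect_cong)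
  qed
  let ?c = "pexp p IA (\<lambda>E. of_bool (?C E))"
  have c0: "0 \<le> ?c" by (rule bexp_nonneg[OF sp]) simp
  let ?P = "measure_pmf.prob (random_graph V p)"
  have P: "?P S = pexp p IA (\<lambda>E. pexp p I (\<lambda>H. of_bool (E \<union> H \<in> S)))" for S
    using prob_random_graph[OF fin q1(2,3), of S] unfolding I_split(1)
    using finI I_split(2) by (simp add: bexp_union)
  have lower: "q * ?c \<le> ?P {E. revealed A E = r}"
  proof -
    have "q * ?c = pexp p IA (\<lambda>E. q * of_bool (?C E))" by (rule bexp_cmult[symmetric])
    also have "\<dots> \<le> ?P {E. revealed A E = r}"
      unfolding P
    proof (rule bexp_mono[OF sp])
      fix E assume E: "E \<subseteq> IA"
      have ne: "I \<noteq> {}" using u b by (auto simp: I_def nsets_2_eq)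
      show "q * of_bool (?C E) \<le> pexp p I (\<lambda>H. of_bool (E \<union> H \<in> {E. revealed A E = r}))"
      proof (cases "?C E")
        case True
        have "q \<le> pexp p I (\<lambda>H. of_bool (odd (card H) = (\<rho> \<noteq> odd (card E))))"
          using finI ne q by (intro parity_lower_bound) auto
        also have "\<dots> = pexp p I (\<lambda>H. of_bool (E \<union> H \<in> {E. revealed A E = r}))"
        proof (intro bexp_cong refl arg_cong[of _ _ of_bool])
          fix H assume H: "H \<subseteq> I"
          have "finite E" "finite H" "E \<inter> H = {}" using E H finI I_split(2) finite_subset by blast+
          from odd_card_Un_eq[OF this, of \<rho>] show "(odd (card H) = (\<rho> \<noteq> odd (card E))) = (E \<union> H \<in> {E. revealed A E = r})"
            using rev[OF H] True by simp
        qed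
        finally show ?thesis using True by simp
      qed (simp add: bexp_nonneg[OF sp])
    qed
    finally show ?thesis .
  qed
  let ?few = "\<lambda>a E. card {d \<in> L. {a, d} \<in> E} < M0"
  have main: "pexp p I (\<lambda>H. of_bool (\<not> ?ED (E \<union> H) \<and> odd (card (E \<union> H)) = \<rho>)) \<le> (1 - q) ^ m + real m * B"
    if E: "E \<subseteq> IA" and good: "\<And>a. a \<in> A \<Longrightarrow> \<not> ?few a E" for E
  proof -
    let ?st = "\<lambda>v G. (odd (card G) \<longleftrightarrow> {u, v} \<in> G) \<and> \<not> ?ED G"
    have st: "pexp p I (\<lambda>H. of_bool (?st v (E \<union> H))) \<le> B" if v: "v \<in> C" for v
    proof -
      have EV: "E \<subseteq> nsets V 2" "E \<inter> I = {}" using E I_split by auto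
      interpret w: windows A "L \<union> (C - {v})" Ds u v b E p q t ?\<tau> ?M len "4 * m"
      proof unfold_locales
        show "finite D \<and> card D = len" if "D \<in> set Ds" for D
          using Ds(3) that finW3 finite_subset by blast
        show "(A \<union> (L \<union> (C - {v}))) \<inter> \<Union>(set Ds) = {}"
          using UW C(1) unfolding U_def[symmetric] L_def W_def by blast
        show "length Ds = 2 * (4 * m)" using Ds(1) by simp
        have "u \<notin> U" "v \<notin> U" "b \<notin> U" using UW v by blast+
        then show "u \<notin> A \<union> (L \<union> (C - {v})) \<union> \<Union>(set Ds)" "v \<notin> A \<union> (L \<union> (C - {v})) \<union> \<Union>(set Ds)"
          "b \<notin> A \<union> (L \<union> (C - {v})) \<union> \<Union>(set Ds)"
          using u b v C(1) unfolding U_def[symmetric] L_def W_def by blast+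
        show "A \<inter> (L \<union> (C - {v})) = {}" using C(1) unfolding L_def W_def by blast
        show "u \<noteq> v" "u \<noteq> b" "v \<noteq> b" using b v C(1) by blast+
      qed (use finA finL finC Ds(2) q t(2) in auto)
      have wU: "w.U = U" by (simp add: w.U_def U_def)
      have wV: "w.V = V"
        unfolding w.V_def w.X_def wU using A u b C(1) v UW by (auto simp: L_def W_def)
      have wI: "w.I = I" by (simp add: w.I_def wV I_def W_def)
      have LL: "card L \<le> card (L \<union> (C - {v}))" using finL finC by (intro card_mono) auto
      have EwI: "E \<inter> w.I = {}" using EV by (simp add: wI)
      have fair: "(1 + \<bar>1 - 2 * p\<bar> ^ card (L \<union> (C - {v}))) ^ card w.U \<le> 2"
      proof -
        let ?z = "\<bar>1 - 2 * p\<bar> ^ card (L \<union> (C - {v}))"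
        have "\<bar>1 - 2 * p\<bar> \<le> 1 - q / 2" using q by (auto simp: abs_if)
        moreover have "h * (8 * m) \<le> card (L \<union> (C - {v}))"
          using cL LL order_trans[of "h * (8 * m)" "h * (M0 + 8 * m)"] by (simp add: distrib_left)
        ultimately have zx: "?z \<le> x" unfolding x_def by (intro half) auto
        have "card U \<le> card V" using UW W_def fin by (intro card_mono) auto
        then have "real (card U) * ?z \<le> real (card V) * x" using zx by (intro mult_mono) auto
        also have "\<dots> \<le> 1 / 2" using m(2) by (simp add: x_def)
        finally have le: "real (card U) * ?z \<le> 1 / 2" .
        have "(1 + ?z) ^ card U \<le> exp ?z ^ card U" by (intro power_mono) auto
        also have "\<dots> = exp (real (card U) * ?z)" by (rule exp_of_nat_mult[symmetric])
        also have "\<dots> \<le> exp (1 / 2)" using le by simp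
        also have "\<dots> \<le> 2" by (rule exp_half_le2)
        finally show ?thesis by (simp add: wU)
      qed
      have N2: "2 * (4 * m) = 8 * m" by simp
      have top: "pexp p w.J (\<lambda>H. of_bool (\<forall>i\<in>S. w.top_bad i (E \<union> H))) \<le> 2 * y"
        if "S \<subseteq> {..<4 * m}" "card S = m" for S
        using w.top_bound[OF fair err_t _ err_\<tau> that(1) EwI] that(2) unfolding N2 y_def by simp
      have err0: "(\<Sum>i<card A. (1 - q) ^ (M0 - i)) + (\<Sum>s\<in>{?\<tau><..card (L \<union> (C - {v}))}. (1 - q) ^ s)
          \<le> (real (card V) + 1 / q) * x"
      proof -
        have "(\<Sum>i<card A. (1 - q) ^ (M0 - i)) \<le> (\<Sum>i<card A. x)"
        proof (rule sum_mono)
          fix i assume "i \<in> {..<card A}"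
          then show "(1 - q) ^ (M0 - i) \<le> x"
            unfolding x_def M0_def using q by (intro half) auto
        qed
        also have "\<dots> \<le> real (card V) * x"
          using card_mono[OF fin A] x0 by (auto intro: mult_right_mono)
        finally have "(\<Sum>i<card A. (1 - q) ^ (M0 - i)) \<le> real (card V) * x" .
        moreover have "(\<Sum>s\<in>{?\<tau><..card (L \<union> (C - {v}))}. (1 - q) ^ s) \<le> 1 / q * x"
          using tail_bound[OF q(1) q1(1), of ?\<tau> "card (L \<union> (C - {v}))"] tail_\<tau> by linarith
        ultimately show ?thesis by (simp only: distrib_right)
      qed
      have rows: "M0 \<le> card {d \<in> L \<union> (C - {v}). {a, d} \<in> E}" if "a \<in> A" for a
      proof -
        have "M0 \<le> card {d \<in> L. {a, d} \<in> E}" using good[OF that] by simp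
        also have "\<dots> \<le> card {d \<in> L \<union> (C - {v}). {a, d} \<in> E}" using finL finC by (intro card_mono) auto
        finally show ?thesis .
      qed
      have bot: "pexp p w.J (\<lambda>H. of_bool (\<forall>i\<in>S. w.bot_bad i (E \<union> H))) \<le> (real (card V) + 1 / q) * x + y"
        if "S \<subseteq> {..<4 * m}" "card S = m" for S
        using w.bot_bound[OF err_t _ err_\<tau> err0 that(1) EwI rows] that(2) unfolding N2 y_def by simp
      have "pexp p w.I (\<lambda>H. of_bool (w.stuck (E \<union> H))) \<le> B"
        unfolding B_def
      proof (rule w.failure_bound)
        show "E \<subseteq> nsets w.V 2" using EV by (simp add: wV)
      qed (use EwI top bot y0 x0 q in auto)
      then show ?thesis unfolding w.stuck_def wI wV .
    qed
    let ?N = "(\<lambda>v. {u, v}) ` C"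
    have uC: "u \<notin> C" using C by auto
    have NI: "?N \<subseteq> I" using C u by (auto simp: I_def)
    have cN: "card ?N = m" using C(2) inj_on_doubleton[OF uC] by (simp add: card_image)
    have NE: "e \<notin> E" if "e \<in> ?N" for e using that NI E I_split(2) by blast
    \<comment> \<open>Either the edge from \<open>u\<close> to every candidate disagrees with
      \<open>\<rho>\<close>, or some candidate satisfies the parity condition of
      \<open>stuck\<close>; a union bound over \<open>C\<close> covers the second case.\<close>
    have "pexp p I (\<lambda>H. of_bool (\<not> ?ED (E \<union> H) \<and> odd (card (E \<union> H)) = \<rho>)) \<le>
        pexp p I (\<lambda>H. of_bool (\<forall>e\<in>?N. (e \<in> H) \<noteq> \<rho>) + (\<Sum>v\<in>C. of_bool (?st v (E \<union> H))))"
    proof (rule bexp_mono[OF sp])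
      fix H
      have nn: "(0::real) \<le> (\<Sum>v\<in>C. of_bool (?st v (E \<union> H)))" by (intro sum_nonneg) simp
      show "(of_bool (\<not> ?ED (E \<union> H) \<and> odd (card (E \<union> H)) = \<rho>) :: real) \<le>
        of_bool (\<forall>e\<in>?N. (e \<in> H) \<noteq> \<rho>) + (\<Sum>v\<in>C. of_bool (?st v (E \<union> H)))"
      proof (cases "(\<not> ?ED (E \<union> H) \<and> odd (card (E \<union> H)) = \<rho>) \<and> \<not> (\<forall>e\<in>?N. (e \<in> H) \<noteq> \<rho>)")
        case True
        then obtain v where v: "v \<in> C" "({u, v} \<in> H) = \<rho>" by auto
        then have "?st v (E \<union> H)" using True NE[of "{u, v}"] by auto
        then have "(1::real) = of_bool (?st v (E \<union> H))" by simp
        also have "\<dots> \<le> (\<Sum>v\<in>C. of_bool (?st v (E \<union> H)))"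
          by (rule member_le_sum[OF v(1)]) (use finC in simp_all)
        finally have "1 \<le> (\<Sum>v\<in>C. of_bool (?st v (E \<union> H)) :: real)" .
        moreover have "(of_bool (\<not> ?ED (E \<union> H) \<and> odd (card (E \<union> H)) = \<rho>) :: real) \<le> 1" by simp
        moreover have "(0::real) \<le> of_bool (\<forall>e\<in>?N. (e \<in> H) \<noteq> \<rho>)" by simp
        ultimately show ?thesis by linarith
      next
        case False
        then have "(of_bool (\<not> ?ED (E \<union> H) \<and> odd (card (E \<union> H)) = \<rho>) :: real) \<le> of_bool (\<forall>e\<in>?N. (e \<in> H) \<noteq> \<rho>)"
          by (intro of_bool_mono) blast
        then show ?thesis using nn by linarith
      qed
    qed
    also have "\<dots> = pexp p I (\<lambda>H. of_bool (\<forall>e\<in>?N. (e \<in> H) \<noteq> \<rho>)) +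
        (\<Sum>v\<in>C. pexp p I (\<lambda>H. of_bool (?st v (E \<union> H))))"
      by (simp only: bexp_add bexp_sum)
    also have "\<dots> \<le> (1 - q) ^ card ?N + (\<Sum>v\<in>C. B)"
      using finI NI q st by (intro add_mono sum_mono all_disagree_bound) auto
    finally show ?thesis using cN C(2) by simp
  qed
  let ?B = "(1 - q) ^ m + real m * B"
  have B0: "0 \<le> ?B"
  proof -
    have "0 \<le> B" unfolding B_def using q y0 x0
      by (intro add_nonneg_nonneg mult_nonneg_nonneg zero_le_power) (auto simp: power_le_one)
    then show ?thesis using q by simp
  qed
  have upper: "?P ({E. \<not> ?ED E} \<inter> {E. revealed A E = r}) \<le> (real (card V) * x / q + ?B) * ?c"
  proof -
    have "?P ({E. \<not> ?ED E} \<inter> {E. revealed A E = r}) \<le>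
        pexp p IA (\<lambda>E. (\<Sum>a\<in>A. of_bool (?C E \<and> ?few a E)) + ?B * of_bool (?C E))"
      unfolding P
    proof (rule bexp_mono[OF sp])
      fix E assume E: "E \<subseteq> IA"
      have nn: "(0::real) \<le> (\<Sum>a\<in>A. of_bool (?C E \<and> ?few a E))" by (intro sum_nonneg) simp
      let ?Q = "pexp p I (\<lambda>H. of_bool (?C E \<and> \<not> ?ED (E \<union> H) \<and> odd (card (E \<union> H)) = \<rho>))"
      have eq: "pexp p I (\<lambda>H. of_bool (E \<union> H \<in> {E. \<not> ?ED E} \<inter> {E. revealed A E = r})) = ?Q"
        by (intro bexp_cong refl arg_cong[of _ _ of_bool]) (auto simp: rev)
      show "pexp p I (\<lambda>H. of_bool (E \<union> H \<in> {E. \<not> ?ED E} \<inter> {E. revealed A E = r})) \<le>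
          (\<Sum>a\<in>A. of_bool (?C E \<and> ?few a E)) + ?B * of_bool (?C E)"
      proof (cases "?C E")
        case False
        have "?Q \<le> 0"
          using finI False by (intro bexp_le sp of_bool_le0) auto
        then show ?thesis unfolding eq using nn False by simp
      next
        case True
        show ?thesis
        proof (cases "\<exists>a\<in>A. ?few a E")
          case f: True
          then obtain a where a: "a \<in> A" "?few a E" by blast
          have "?Q \<le> 1"
            using finI by (intro bexp_le sp) auto
          also have "(1::real) = of_bool (?C E \<and> ?few a E)" using a True by simp
          also have "\<dots> \<le> (\<Sum>a\<in>A. of_bool (?C E \<and> ?few a E))"
            by (rule member_le_sum[OF a(1)]) (use finA in simp_all)
          also have "\<dots> \<le> (\<Sum>a\<in>A. of_bool (?C E \<and> ?few a E)) + ?B * of_bool (?C E)" using B0 by simp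
          finally show ?thesis unfolding eq .
        next
          case False
          have "?Q =
              pexp p I (\<lambda>H. of_bool (\<not> ?ED (E \<union> H) \<and> odd (card (E \<union> H)) = \<rho>))"
            using True by simp
          also have "\<dots> \<le> ?B" by (rule main[OF E]) (use False in blast)
          also have "?B = ?B * of_bool (?C E)" using True by simp
          finally show ?thesis unfolding eq using nn by linarith
        qed
      qed
    qed
    also have "\<dots> = (\<Sum>a\<in>A. pexp p IA (\<lambda>E. of_bool (?C E \<and> ?few a E))) + ?B * ?c"
      by (simp only: bexp_add bexp_sum bexp_cmult)
    also have "\<dots> \<le> (\<Sum>a\<in>A. x / q * ?c) + ?B * ?c"
    proof (intro add_right_mono sum_mono)
      fix a assume a: "a \<in> A"
      have LW: "L \<subseteq> V - A" by (auto simp: L_def W_def)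
      have ne: "V - A \<noteq> {}" using u by (auto simp: W_def)
      have "2 ^ M0 * (1 - q / 2) ^ card L \<le> 2 ^ M0 * (1 / 2) ^ (M0 + 8 * m)"
        using q cL by (intro mult_left_mono half) auto
      also have "\<dots> = x" by (simp add: x_def power_add power_one_over)
      finally have f: "2 ^ M0 * (1 - q / 2) ^ card L / q \<le> x / q" using q by (simp add: divide_right_mono)
      have "pexp p IA (\<lambda>E. of_bool (?C E \<and> ?few a E)) \<le> 2 ^ M0 * (1 - q / 2) ^ card L / q * ?c"
        unfolding IA by (rule conditioned_row_bound[OF fin A a LW ne q])
      also have "\<dots> \<le> x / q * ?c" using f c0 by (rule mult_right_mono)
      finally show "pexp p IA (\<lambda>E. of_bool (?C E \<and> ?few a E)) \<le> x / q * ?c" .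
    qed
    also have "(\<Sum>a\<in>A. x / q * ?c) \<le> real (card V) * x / q * ?c"
    proof -
      have "real (card A) * (x / q * ?c) \<le> real (card V) * (x / q * ?c)"
        using card_mono[OF fin A] x0 c0 q by (intro mult_right_mono mult_nonneg_nonneg) auto
      then show ?thesis by simp
    qed
    finally show ?thesis by (simp add: distrib_right)
  qed
  have pos: "0 < ?P {E. revealed A E = r}"
    using r by (metis disjoint_iff inf_commute measure_nonneg measure_pmf_zero_iff order_le_less)
  let ?T = "real (card V) * x / q + ?B"
  have T0: "0 \<le> ?T" using x0 q B0 by simp
  have "?P ({E. \<not> ?ED E} \<inter> {E. revealed A E = r}) \<le> ?T * ?c" by (rule upper)
  also have "\<dots> = ?T / q * (q * ?c)" using q by simp
  also have "\<dots> \<le> ?T / q * ?P {E. revealed A E = r}"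
    using lower T0 q by (intro mult_left_mono) auto
  finally have "?P ({E. \<not> ?ED E} \<inter> {E. revealed A E = r}) / ?P {E. revealed A E = r} \<le> ?T / q"
    using pos by (simp add: divide_le_eq)
  also have "?T / q = fail_bound q h t (card V) m"
    unfolding fail_bound_def Let_def B_def y_def \<epsilon>_def x_def ..
  finally show ?thesis unfolding prob_cond_pmf[OF r] .
qed

section \<open>Asymptotics\<close>

text \<open>The factor \<open>2 ^ (4 * m)\<close> meets only multiples of
  \<open>(1 / 32) ^ m\<close> and \<open>(1 / 256) ^ m\<close>, so exponential decay survives. The
  cube comes from the union over \<open>m\<close> candidates and from \<open>e\<close>, which is
  quadratic in \<open>m\<close>.\<close>

lemma fail_bound_le:
  fixes q \<gamma> :: real
  assumes q: "0 < q" "q \<le> 1" and m: "m \<le> n" "0 < n" and \<gamma>: "1 / 2 \<le> \<gamma>" "1 - q \<le> \<gamma>" "1 - q ^ (2 * t) \<le> \<gamma>" "\<gamma> \<le> 1"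
  shows "fail_bound q h t n m \<le> (26 / q + 384 * real h + 6) / q * real n ^ 3 * \<gamma> ^ m"
proof -
  define x :: real where "x = (1 / 2) ^ (8 * m)"
  define e where "e = real (8 * m) * (real (16 * h * m) + 1 / q)"
  define y where "y = (1 / 32) ^ m + e * x"
  let ?g = "\<gamma> ^ m" and ?n = "real n"
  have g0: "0 \<le> ?g" using \<gamma> by simp
  have e0: "0 \<le> e" unfolding e_def using q by simp
  have n1: "1 \<le> ?n" using m by simp
  have mn: "real m \<le> ?n" using m by simp
  have r: "r ^ m \<le> ?g" if "0 \<le> r" "r \<le> 1 / 2" for r :: real
    using that \<gamma> by (intro power_mono) auto
  have x256: "x = (1 / 256) ^ m" unfolding x_def power_mult by (simp add: power_divide)
  have x: "x \<le> ?g" unfolding x256 by (intro r) auto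
  have x16: "2 ^ (4 * m) * x \<le> ?g"
  proof -
    have "2 ^ (4 * m) * x = (1 / 16) ^ m" unfolding x256 power_mult by (simp flip: power_mult_distrib)
    also have "\<dots> \<le> ?g" by (intro r) auto
    finally show ?thesis .
  qed
  have y16: "2 ^ (4 * m) * y \<le> ?g + e * ?g"
  proof -
    have "(2::real) ^ (4 * m) * (1 / 32) ^ m = (1 / 2) ^ m" unfolding power_mult by (simp flip: power_mult_distrib)
    also have "\<dots> \<le> ?g" by (intro r) auto
    finally have "(2::real) ^ (4 * m) * (1 / 32) ^ m \<le> ?g" .
    moreover have "e * (2 ^ (4 * m) * x) \<le> e * ?g" using x16 e0 by (rule mult_left_mono)
    ultimately show ?thesis by (simp add: y_def algebra_simps)
  qed
  have q2: "q ^ (2 * t) \<le> 1" using q by (intro power_le_one) auto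
  have cut: "(1 - q ^ (2 * t)) ^ (2 * m) \<le> ?g"
  proof -
    have "(1 - q ^ (2 * t)) ^ (2 * m) \<le> (1 - q ^ (2 * t)) ^ m" using q q2 by (intro power_decreasing) auto
    also have "\<dots> \<le> ?g" using \<gamma> q2 by (intro power_mono) auto
    finally show ?thesis .
  qed
  have low: "(1 - q) ^ m \<le> ?g" using q \<gamma> by (intro power_mono) auto
  have nx: "?n * x / q \<le> ?n / q * ?g"
    using mult_left_mono[OF x, of "?n / q"] q by simp
  have "(?n + 1 / q) * (2 ^ (4 * m) * x) \<le> (?n + 1 / q) * ?g" using x16 q by (intro mult_left_mono) auto
  then have "2 ^ (4 * m) * (2 * y + ((?n + 1 / q) * x + y)) \<le> (3 + 3 * e + ?n + 1 / q) * ?g"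
    using y16 by (simp add: algebra_simps)
  then have "(1 - q ^ (2 * t)) ^ (2 * m) + 2 ^ (4 * m) * (2 * y + ((?n + 1 / q) * x + y)) \<le>
      (4 + 3 * e + ?n + 1 / q) * ?g"
    using cut by (simp add: algebra_simps)
  then have "real m * ((1 - q ^ (2 * t)) ^ (2 * m) + 2 ^ (4 * m) * (2 * y + ((?n + 1 / q) * x + y))) \<le>
      real m * ((4 + 3 * e + ?n + 1 / q) * ?g)"
    by (intro mult_left_mono) auto
  then have "fail_bound q h t n m \<le> (?n / q * ?g + (?g + real m * ((4 + 3 * e + ?n + 1 / q) * ?g))) / q"
    unfolding fail_bound_def Let_def x_def[symmetric] mult.assoc[of _ _ x, symmetric] e_def[symmetric] y_def[symmetric]
    using nx low q by (intro divide_right_mono add_mono) auto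
  also have "\<dots> = (?n / q + 1 + real m * (4 + 3 * e + ?n + 1 / q)) / q * ?g"
    by (simp add: algebra_simps)
  also have "\<dots> \<le> (26 / q + 384 * real h + 6) * ?n ^ 3 / q * ?g"
  proof (intro mult_right_mono divide_right_mono g0)
    define i where "i = 1 / q"
    have i0: "0 \<le> i" using q by (simp add: i_def)
    have sq: "?n \<le> ?n ^ 2" "1 \<le> ?n ^ 2" using n1 by (simp_all add: self_le_power)
    have cu: "?n \<le> ?n ^ 3" "?n ^ 2 \<le> ?n ^ 3" "1 \<le> ?n ^ 3"
      using n1 by (simp_all add: self_le_power power_increasing)
    have "real (16 * h * m) + i \<le> 16 * real h * ?n + i * ?n"
      using mn i0 n1 mult_left_mono[OF n1 i0] mult_left_mono[OF mn, of "16 * real h"] by simp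
    then have "e \<le> 8 * ?n * (16 * real h * ?n + i * ?n)"
      unfolding e_def i_def[symmetric] using mn i0 by (intro mult_mono) auto
    also have "\<dots> = (128 * real h + 8 * i) * ?n ^ 2" by (simp add: algebra_simps power2_eq_square)
    finally have e: "e \<le> (128 * real h + 8 * i) * ?n ^ 2" .
    have "4 + 3 * e + ?n + i \<le> (5 + 384 * real h + 25 * i) * ?n ^ 2"
      using e sq mult_left_mono[OF sq(2) i0] unfolding distrib_right by linarith
    then have "real m * (4 + 3 * e + ?n + i) \<le> ?n * ((5 + 384 * real h + 25 * i) * ?n ^ 2)"
      using mn e0 i0 n1 by (intro mult_mono) auto
    also have "\<dots> = (5 + 384 * real h + 25 * i) * ?n ^ 3" by (simp add: power2_eq_square power3_eq_cube)
    finally have "i * ?n + 1 + real m * (4 + 3 * e + ?n + i) \<le> (26 * i + 384 * real h + 6) * ?n ^ 3"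
      using cu mult_left_mono[OF cu(1) i0] by (simp add: algebra_simps)
    then show "?n / q + 1 + real m * (4 + 3 * e + ?n + 1 / q) \<le> (26 / q + 384 * real h + 6) * ?n ^ 3"
      by (simp add: i_def)
  qed (use q in simp)
  finally show ?thesis by (simp add: mult.commute)
qed

text \<open>The exponent obtained is of order \<open>sqrt n\<close>, which exceeds
  \<open>n powr (1 / 2 - \<alpha>)\<close>. That \<open>\<alpha>\<close> is positive also makes the
  revealed set of size \<open>o(n)\<close>, so \<open>A\<close> and the vertices of \<open>L\<close>
  reserved for it fit.\<close>

lemma eventually_max_failure_prob_le:
  fixes \<alpha> p :: real
  assumes \<alpha>: "0 < \<alpha>" "\<alpha> < 1 / 2" and p: "0 < p" "p < 1"
  shows "\<exists>K>0. \<forall>\<^sub>F n in sequentially. max_failure_prob \<alpha> p n \<le> exp (- K * real n powr (1 / 2 - \<alpha>))"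
proof -
  define q where "q = min p (1 - p)"
  have q: "0 < q" "q \<le> p" "p \<le> 1 - q" "q < 1" using p by (auto simp: q_def)
  obtain h where h: "(1 - q / 2) ^ h < 1 / 2" using real_arch_pow_inv[of "1 / 2" "1 - q / 2"] q by auto
  have h1: "1 \<le> h" using h by (cases h) auto
  \<comment> \<open>With this \<open>t\<close> the leftover term of \<open>stage_err\<close> is at
    most \<open>1 / 64\<close>; the others are together at most \<open>1 / 64\<close> for large
    \<open>m\<close>, which gives \<open>1 / 32\<close>.\<close>
  obtain t where t: "(1 - q) ^ t < q / 64" using real_arch_pow_inv[of "q / 64" "1 - q"] q by auto
  have "(1 - q) ^ Suc t \<le> (1 - q) ^ t" using q by (intro power_decreasing) auto
  then have "(1 - q) ^ Suc t \<le> 1 / 64 * q" using t by linarith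
  then have t: "(1 - q) ^ Suc t / q \<le> 1 / 64" using q by (simp only: pos_divide_le_eq)
  define \<gamma> where "\<gamma> = max (1 / 2) (max (1 - q) (1 - q ^ (2 * t)))"
  have \<gamma>: "1 / 2 \<le> \<gamma>" "1 - q \<le> \<gamma>" "1 - q ^ (2 * t) \<le> \<gamma>" "\<gamma> < 1" using q by (auto simp: \<gamma>_def)
  define \<kappa> where "\<kappa> = - ln \<gamma>"
  have \<kappa>: "0 < \<kappa>" and \<gamma>\<kappa>: "\<gamma> = exp (- \<kappa>)" using \<gamma> by (auto simp: \<kappa>_def)
  \<comment> \<open>With \<open>m \<le> sqrt n / c\<close> the windows, of total size at most
    \<open>192 * h\<^sup>2 * m\<^sup>2\<close>, occupy only a small part of the
    \<open>n \<ge> 4096 * h\<^sup>2 * m\<^sup>2\<close> vertices.\<close>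
  define c where "c = 64 * real h"
  have c: "64 \<le> c" using h1 by (simp add: c_def)
  define m where "m n = nat \<lfloor>sqrt (real n) / c\<rfloor>" for n
  \<comment> \<open>Half of the available exponent \<open>\<kappa> * sqrt n / c\<close>; the other
    half outweighs the polynomial factor.\<close>
  define K where "K = \<kappa> / (2 * c)"
  have K: "0 < K" using \<kappa> c by (simp add: K_def)
  \<comment> \<open>The factor \<open>exp \<kappa>\<close> pays for rounding \<open>m\<close>
    down.\<close>
  define C where "C = (26 / q + 384 * real h + 6) / q * exp \<kappa>"
  have mlim: "filterlim m at_top sequentially" unfolding m_def using c by real_asymp
  have "\<forall>\<^sub>F m in sequentially. real (16 * h) * real m * (1 / 2) ^ (8 * m) \<le> 1 / 64" by real_asymp
  moreover have "\<forall>\<^sub>F m in sequentially. c\<^sup>2 * (real m + 1)\<^sup>2 * (1 / 2) ^ (8 * m) \<le> 1 / 2" by real_asymp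
  moreover have "\<forall>\<^sub>F m in sequentially. t \<le> m" by (rule eventually_ge_at_top)
  ultimately have ev_m: "\<forall>\<^sub>F m in sequentially. real (16 * h) * real m * (1 / 2) ^ (8 * m) \<le> 1 / 64 \<and>
      c\<^sup>2 * (real m + 1)\<^sup>2 * (1 / 2) ^ (8 * m) \<le> 1 / 2 \<and> t \<le> m"
    by eventually_elim simp
  have ev1: "\<forall>\<^sub>F n in sequentially. real (h + 1) * real n powr (1 - 2 * \<alpha>) \<le> real n / 4"
    using \<alpha> by real_asymp
  have ev2: "\<forall>\<^sub>F n in sequentially. 2 + real (17 * h) * sqrt (real n) \<le> real n / 4" by real_asymp
  have ev3: "\<forall>\<^sub>F n in sequentially. C * real n ^ 3 \<le> exp (K * sqrt (real n))" using K by real_asymp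
  have "\<forall>\<^sub>F n in sequentially. max_failure_prob \<alpha> p n \<le> exp (- K * real n powr (1 / 2 - \<alpha>))"
    using eventually_compose_filterlim[OF ev_m mlim] ev1 ev2 ev3 eventually_gt_at_top[of 0]
  proof eventually_elim
    case (elim n)
    let ?s = "sqrt (real n)" and ?m = "m n"
    have s0: "0 \<le> ?s / c" using c by simp
    have ms: "real ?m \<le> ?s / c" "?s / c < real ?m + 1"
      unfolding m_def using s0 by (simp_all add: of_nat_nat)
    have cm: "c * real ?m \<le> ?s" "?s \<le> c * (real ?m + 1)"
      using ms c by (simp_all add: field_simps)
    have "(c * real ?m)\<^sup>2 \<le> ?s\<^sup>2" using cm(1) c by (intro power_mono) auto
    then have cm2: "4096 * (real h)\<^sup>2 * (real ?m)\<^sup>2 \<le> real n" by (simp add: c_def power_mult_distrib)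
    have "?s\<^sup>2 \<le> (c * (real ?m + 1))\<^sup>2" using cm(2) by (intro power_mono) auto
    then have n_le: "real n \<le> c\<^sup>2 * (real ?m + 1)\<^sup>2" by (simp add: power_mult_distrib)
    have s_n: "?s \<le> real n" using elim(5) by (simp add: real_sqrt_le_iff real_le_lsqrt self_le_power)
    have m_s: "real ?m \<le> ?s" using cm(1) c mult_right_mono[of 1 c "real ?m"] by simp
    then have mn: "?m \<le> n" using s_n by linarith
    have half: "real n * (1 / 2) ^ (8 * ?m) \<le> 1 / 2"
    proof -
      have "real n * (1 / 2) ^ (8 * ?m) \<le> c\<^sup>2 * (real ?m + 1)\<^sup>2 * (1 / 2) ^ (8 * ?m)"
        using n_le by (rule mult_right_mono) simp
      then show ?thesis using elim(1) by linarith
    qed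
    have t_m: "t \<le> 8 * h * ?m" using elim(1) h1 mult_le_mono[of 1 "8 * h" t ?m] by simp
    have bound: "measure_pmf.prob M {E. \<not> even_degenerate {..<n} E} \<le> exp (- K * real n powr (1 / 2 - \<alpha>))"
      if M: "partially_revealed \<alpha> p {..<n} M" for M
    proof -
      obtain A r where A: "A \<subseteq> {..<n}" "real (card A) \<le> real (card {..<n}) powr (1 - 2 * \<alpha>)"
        and r: "set_pmf (random_graph {..<n} p) \<inter> {E. revealed A E = r} \<noteq> {}"
        and M: "M = cond_pmf (random_graph {..<n} p) {E. revealed A E = r}"
        using M unfolding partially_revealed_def by blast
      have "real (h + 1) * real (card A) \<le> real (h + 1) * real n powr (1 - 2 * \<alpha>)"
        using A(2) by (intro mult_left_mono) auto
      then have cA: "real (h + 1) * real (card A) \<le> real n / 4" using elim(2) by linarith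
      have "real (card A + ?m + 2 + 8 * ?m * (h * (16 * h * ?m + 8 * ?m)) + h * (card A + 8 * h * ?m + 8 * ?m)) \<le> real n"
      proof -
        have h1': "1 \<le> real h" using h1 by simp
        have "real h * (64 * real h * real ?m) \<le> real h * ?s"
          using cm(1) by (intro mult_left_mono) (auto simp: c_def)
        moreover have "1 * (real h * real ?m) \<le> real h * (real h * real ?m)" using h1' by (rule mult_right_mono) simp
        moreover have "1 * (real h * (real ?m)\<^sup>2) \<le> real h * (real h * (real ?m)\<^sup>2)" using h1' by (rule mult_right_mono) simp
        moreover have "1 * ?s \<le> real h * ?s" using h1' by (rule mult_right_mono) simp
        ultimately show ?thesis
          using cA cm2 m_s elim(3) by (simp add: algebra_simps power2_eq_square)
      qed
      then have size: "card A + ?m + 2 + 8 * ?m * (h * (16 * h * ?m + 8 * ?m)) + h * (card A + 8 * h * ?m + 8 * ?m) \<le> card {..<n}"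
        unfolding card_lessThan of_nat_le_iff .
      have "measure_pmf.prob M {E. \<not> even_degenerate {..<n} E} \<le> fail_bound q h t (card {..<n}) ?m"
        unfolding M
        by (rule conditional_bound[OF finite_lessThan A(1) q(1-3) _ t t_m _ _ size r]) (use h elim(1) half in auto)
      also have "\<dots> \<le> (26 / q + 384 * real h + 6) / q * real n ^ 3 * \<gamma> ^ ?m"
        using fail_bound_le[of q ?m n \<gamma> t h] q mn elim(5) \<gamma> by simp
      also have "\<dots> \<le> (26 / q + 384 * real h + 6) / q * real n ^ 3 * (exp \<kappa> * exp (- (\<kappa> * (?s / c))))"
      proof (rule mult_left_mono)
        have "\<gamma> ^ ?m = exp (- (\<kappa> * real ?m))" unfolding \<gamma>\<kappa> by (simp add: exp_of_nat_mult[symmetric] mult.commute)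
        also have "\<dots> \<le> exp (\<kappa> - \<kappa> * (?s / c))"
          using mult_left_mono[OF less_imp_le[OF ms(2)], of \<kappa>] \<kappa> by (simp add: distrib_left)
        also have "\<dots> = exp \<kappa> * exp (- (\<kappa> * (?s / c)))" unfolding exp_add[symmetric] by simp
        finally show "\<gamma> ^ ?m \<le> exp \<kappa> * exp (- (\<kappa> * (?s / c)))" .
      qed (use q in auto)
      also have "\<dots> = C * real n ^ 3 * exp (- (\<kappa> * (?s / c)))" by (simp add: C_def)
      also have "\<dots> \<le> exp (K * ?s) * exp (- (\<kappa> * (?s / c)))" using elim(4) by (intro mult_right_mono) auto
      also have "\<dots> = exp (- K * ?s)" unfolding exp_add[symmetric] using c by (simp add: K_def field_simps)
      also have "\<dots> \<le> exp (- K * real n powr (1 / 2 - \<alpha>))"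
      proof -
        have "real n powr (1 / 2 - \<alpha>) \<le> real n powr (1 / 2)"
          using elim(5) \<alpha> by (intro powr_mono) auto
        then show ?thesis using K by (simp add: powr_half_sqrt)
      qed
      finally show ?thesis .
    qed
    show ?case
      unfolding max_failure_prob_def using max_failure_prob_wf[where \<alpha> = \<alpha> and p = p and n = n] bound by (subst Max_le_iff) auto
  qed
  then show ?thesis using K by blast
qed

theorem theorem2p3:
  fixes \<alpha> p :: real
  assumes "0 < \<alpha>" "\<alpha> < 1 / 2" "0 < p" "p < 1"
  shows "\<exists>(K::real) (N\<^sub>0::nat) (\<delta>::nat \<Rightarrow> real).
    K > 0 \<and> N\<^sub>0 > 0 \<and> (\<forall>n. \<delta> n \<ge> 0) \<and> (\<lambda>n. \<delta> n / real n) \<longlonglongrightarrow> 0 \<and>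
    (\<forall>n\<ge>N\<^sub>0.
       {n'::nat. real n' \<in> {real n / 4 - \<delta> n .. real n / 4 + \<delta> n}} \<noteq> {} \<and>
       1 - max_failure_prob \<alpha> p n \<ge>
         (1 - exp (- K * real n powr (1 / 2 - \<alpha>))) *
         (1 - (MAX n' \<in> {n'::nat. real n' \<in> {real n / 4 - \<delta> n .. real n / 4 + \<delta> n}}.
                 (max_failure_prob \<alpha> p n')\<^sup>2)))"
proof -
  obtain K N where K: "0 < K" and N: "\<And>n. n \<ge> N \<Longrightarrow> max_failure_prob \<alpha> p n \<le> exp (- K * real n powr (1 / 2 - \<alpha>))"
    using eventually_max_failure_prob_le[OF assms] unfolding eventually_sequentially by blast
  have "{n'::nat. real n' \<in> {real n / 4 - 1 .. real n / 4 + 1}} \<noteq> {} \<and>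
       1 - max_failure_prob \<alpha> p n \<ge>
         (1 - exp (- K * real n powr (1 / 2 - \<alpha>))) *
         (1 - (MAX n' \<in> {n'::nat. real n' \<in> {real n / 4 - 1 .. real n / 4 + 1}}.
                 (max_failure_prob \<alpha> p n')\<^sup>2))" if "n \<ge> Suc N" for n
  proof -
    let ?S = "{n'::nat. real n' \<in> {real n / 4 - 1 .. real n / 4 + 1}}"
    let ?e = "exp (- K * real n powr (1 / 2 - \<alpha>))"
    have "n div 4 \<in> ?S" by (auto simp: field_simps)
    then have ne: "?S \<noteq> {}" by blast
    have "?S \<subseteq> {..n + 1}" by auto
    then have fin: "finite ?S" using finite_subset by blast
    have "0 \<le> Max ((\<lambda>n'. (max_failure_prob \<alpha> p n')\<^sup>2) ` ?S)"
      by (rule order_trans[OF zero_le_power2 Max_ge]) (use fin \<open>n div 4 \<in> ?S\<close> in auto)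
    moreover have "0 \<le> 1 - ?e" using K by simp
    ultimately have "(1 - ?e) * (1 - Max ((\<lambda>n'. (max_failure_prob \<alpha> p n')\<^sup>2) ` ?S)) \<le> 1 - ?e"
      by (intro mult_left_le) auto
    also have "\<dots> \<le> 1 - max_failure_prob \<alpha> p n" using N[of n] that by simp
    finally show ?thesis using ne by blast
  qed
  moreover have "(\<lambda>n. 1 / real n) \<longlonglongrightarrow> 0" by (rule lim_1_over_n)
  ultimately show ?thesis
    using K by (intro exI[of _ K] exI[of _ "Suc N"] exI[of _ "\<lambda>_. 1"]) auto
qed

end
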